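(* Fix the system parameters $(F,L,P,\gamma)$ and a time-invariant symmetric encoder producing $k$ descriptions (as described in the context). Assume i.i.d. packet losses, and let the choice of decoder at time $i$ depend only on the erasure pattern at time $i$, via a jump variable $\xi_i$. Then one can form a Markov jump linear system $$\bar x(i+1)=\mathcal{A}(\xi_i)\,\bar x(i)+\mathcal{B}(\xi_i)\begin{bmatrix} d(i) \\ \bar q(i) \end{bmatrix},$$ which is asymptotically wide sense stationary (AWSS) whenever $\rho(\mathbb{A})<1$, where $\rho(\mathbb{A})$ is the greatest absolute eigenvalue of $\mathbb{A}$ and $\bar x,\bar q,\mathcal{A},\mathcal{B},\mathbb{A}$ are given in the context.
   Context: Plant and loop. The discrete-time LTI plant $P$ is given by $$x(i+1)=Ax(i)+B_1d(i)+B_2u(i),\qquad y(i)=C_2x(i)+D_{21}d(i),$$ with time-invariant matrices, scalar $u$ and $y$, a stationary Gaussian disturbance $d$ and a Gaussian initial state. The loop is $u=Fw$, $v=L_wz^{-1}w+L_yy$, with $F$ and $L=[L_w,L_y]$ proper LTI filters, $z^{-1}$ the one-step delay, and $w$ the quantizer/decoder output. $(F,L,P,\gamma)$ denotes such a system, $\gamma=\sigma_v^2/\sigma_q^2$ being the signal-to-noise ratio of the loop when $w=v+q$ with $q$ additive white Gaussian coding noise. $L_y$ and $L_w$ have minimal state-space representations $(A_{yv},B_{yv},C_{yv},D_{yv})$ and $(A_{wv},B_{wv},C_{wv},D_{wv})$, so that $v(i)=v_y(i)+v_w(i)$ with $$x_{yv}(i+1)=A_{yv}x_{yv}(i)+B_{yv}y(i),\quad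 v_y(i)=C_{yv}x_{yv}(i)+D_{yv}y(i),$$ $$x_{wv}(i+1)=A_{wv}x_{wv}(i)+B_{wv}w(i-1),\quad v_w(i)=C_{wv}x_{wv}(i)+D_{wv}w(i-1).$$ Code and channel. At each time $k$ descriptions are sent over an erasure channel with packet loss probability $p_l$ and i.i.d. losses. The code is symmetric: all descriptions have the same rate, and the distortion depends only on the number of descriptions received, not on which ones. The jump variable $\xi_i\in\{0,\dots,k\}$ is the number of descriptions received at time $i$. Transition probabilities are $p_{j|j'}=\Pr(\xi_i=j\mid\xi_{i-1}=j')=p_j$, with $p_j=\binom kj(1-p_l)^jp_l^{k-j}$. The quantizer output is $$w(i)=M(\xi_i)\,v(i)+J(\xi_i)^T\bar q(i),$$ where $M(0)=0$ and $M(\xi)=1$ for $\xi\ge1$; $J(\xi)\in\mathbb{R}^{k+1}$ is the zero vector except for a $1$ in its $(\xi+1)$th entry; and $\bar q(i)=[0,q_1,\dots,q_k]^T$ is the vector of quantization noises, with $\mathrm{var}(q_\xi)=\sigma^2(\xi)$ the quantization noise variance when $\xi\ge1$ descriptions are received. Thus $w(i)=0$ if all descriptions are lost, and $w(i)=v(i)+q_{\xi_i}$ otherwise. (For the paper's multiple-description code with central step size $\Delta$, side step size $\Delta_s$ and an expansion factor $1\le\psi(k)<2$, $\sigma^2(\ell)$ is taken as $\frac{\Delta^2}{12}+\frac{k-\ell}{2k\ell}\frac{\Delta^2}{12}\big(\frac{\Delta_s}{\Delta}\big)^{2k/(k-1)}\psi(k)^2$.) Matrices. The augmented state is $\bar x(i)=[x(i)^T,\,x_{yv}(i)^T,\,x_{wv}(i)^T,\,w(i-1)]^T$.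 With $\Sigma(\xi)=B_2FM(\xi)$ ($F$ entering as a multiplicative factor), $$\mathcal{A}(\xi)=\begin{bmatrix} A+\Sigma(\xi)D_{yv}C_2 & \Sigma(\xi)C_{yv} & \Sigma(\xi)C_{wv} & \Sigma(\xi)D_{wv} \\ B_{yv}C_2 & A_{yv} & 0 & 0 \\ 0 & 0 & A_{wv} & B_{wv} \\ M(\xi)D_{yv}C_2 & M(\xi)C_{yv} & M(\xi)C_{wv} & M(\xi)D_{wv} \end{bmatrix},$$ $$\mathcal{B}(\xi)=\begin{bmatrix} B_1+\Sigma(\xi)D_{yv}D_{21} & B_2FJ(\xi)^T \\ B_{yv}D_{21} & 0 \\ 0 & 0 \\ M(\xi)D_{yv}D_{21} & J(\xi)^T \end{bmatrix}.$$ $\mathbb{A}$ is the $(k+1)\times(k+1)$ block matrix whose block in position $(j,j')$, with $j,j'$ ranging over the $k+1$ jump states $0,\dots,k$, is $p_{j|j'}\,\mathcal{A}(j')\otimes\mathcal{A}(j')$, where $\otimes$ is the Kronecker product. AWSS. A random process $x$ is AWSS if and only if there exist $\mu_x$ and $C_x(\tau)$ such that, independently of $x(0)$, $\lim_{n\to\infty}\mathbb{E}[x(n)]=\mu_x$ and $\lim_{n\to\infty}\mathbb{E}\big[(x(n+\tau)-\mathbb{E}[x(n+\tau)])(x(n)-\mathbb{E}[x(n)])^T\big]=C_x(\tau)$ for all $\tau$.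
   Formalization: F is taken to be a static real gain, since the matrices are undefined for a dynamic F; quantization noises are explicitly assumed zero-mean, white and independent of disturbance and initial state, and packet losses independent of all of these. *)

theory Defs
  imports "HOL-Probability.Probability" "Jordan_Normal_Form.Spectral_Radius"
begin

unbundle no vec_syntax
hide_type (open) Finite_Cartesian_Product.vec
hide_const (open) Finite_Cartesian_Product.vec Finite_Cartesian_Product.mat

section \<open>Plant, filters and feedback loop\<close>

text \<open>Vectors and matrices are those of the Jordan normal form library, so that all dimensions
  (including 0, for example for a static filter) are ordinary natural numbers.  A scalar enters
  matrix equations as a vector of dimension 1.\<close>

definition scal :: "real \<Rightarrow> real vec" where
  "scal s = vec 1 (\<lambda>_. s)"

record plant =
  pl_A :: "real mat"
  pl_B1 :: "real mat"
  pl_B2 :: "real mat"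
  pl_C2 :: "real mat"
  pl_D21 :: "real mat"

definition plant_dims :: "nat \<Rightarrow> nat \<Rightarrow> plant \<Rightarrow> bool" where
  "plant_dims n m P \<longleftrightarrow>
     pl_A P \<in> carrier_mat n n \<and> pl_B1 P \<in> carrier_mat n m \<and> pl_B2 P \<in> carrier_mat n 1 \<and>
     pl_C2 P \<in> carrier_mat 1 n \<and> pl_D21 P \<in> carrier_mat 1 m"

record realization =
  rz_A :: "real mat"
  rz_B :: "real mat"
  rz_C :: "real mat"
  rz_D :: "real mat"

text \<open>A causal (proper) single-input single-output LTI filter is given by its impulse response
  \<open>h 0, h 1, \<dots>\<close>; it is rational iff it has a finite-dimensional realization, and then
  \<open>h 0 = D\<close>, \<open>h (t + 1) = C A\<^sup>t B\<close>.  A realization is minimal if its state dimension is.\<close>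

definition realizes :: "nat \<Rightarrow> realization \<Rightarrow> (nat \<Rightarrow> real) \<Rightarrow> bool" where
  "realizes r R h \<longleftrightarrow>
     rz_A R \<in> carrier_mat r r \<and> rz_B R \<in> carrier_mat r 1 \<and>
     rz_C R \<in> carrier_mat 1 r \<and> rz_D R \<in> carrier_mat 1 1 \<and>
     h 0 = rz_D R $$ (0, 0) \<and>
     (\<forall>t. h (Suc t) = (rz_C R * (rz_A R ^\<^sub>m t) * rz_B R) $$ (0, 0))"

definition minimal_realization :: "nat \<Rightarrow> realization \<Rightarrow> (nat \<Rightarrow> real) \<Rightarrow> bool" where
  "minimal_realization r R h \<longleftrightarrow>
     realizes r R h \<and> (\<forall>r' R'. realizes r' R' h \<longrightarrow> r \<le> r')"

record 'w loop_signals =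
  sg_x :: "nat \<Rightarrow> 'w \<Rightarrow> real vec"
  sg_xyv :: "nat \<Rightarrow> 'w \<Rightarrow> real vec"
  sg_xwv :: "nat \<Rightarrow> 'w \<Rightarrow> real vec"
  sg_y :: "nat \<Rightarrow> 'w \<Rightarrow> real"
  sg_u :: "nat \<Rightarrow> 'w \<Rightarrow> real"
  sg_vy :: "nat \<Rightarrow> 'w \<Rightarrow> real"
  sg_vw :: "nat \<Rightarrow> 'w \<Rightarrow> real"
  sg_v :: "nat \<Rightarrow> 'w \<Rightarrow> real"
  sg_w :: "nat \<Rightarrow> 'w \<Rightarrow> real"
  sg_winit :: "'w \<Rightarrow> real"

text \<open>\<open>sg_winit\<close> is the value \<open>w(-1)\<close>, and \<open>w_delayed sg i\<close> is \<open>w(i - 1)\<close>.\<close>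

definition w_delayed :: "'w loop_signals \<Rightarrow> nat \<Rightarrow> 'w \<Rightarrow> real" where
  "w_delayed sg i = (case i of 0 \<Rightarrow> sg_winit sg | Suc j \<Rightarrow> sg_w sg j)"

definition aug_state :: "'w loop_signals \<Rightarrow> nat \<Rightarrow> 'w \<Rightarrow> real vec" where
  "aug_state sg i \<omega> =
     sg_x sg i \<omega> @\<^sub>v sg_xyv sg i \<omega> @\<^sub>v sg_xwv sg i \<omega> @\<^sub>v scal (w_delayed sg i \<omega>)"

text \<open>The loop equations, apart from the law that produces \<open>w\<close> from \<open>v\<close>.\<close>

definition loop_equations ::
  "'w measure \<Rightarrow> nat \<Rightarrow> nat \<Rightarrow> nat \<Rightarrow> plant \<Rightarrow> real \<Rightarrow> realization \<Rightarrow> realization \<Rightarrow>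
   (nat \<Rightarrow> 'w \<Rightarrow> real vec) \<Rightarrow> 'w loop_signals \<Rightarrow> bool" where
  "loop_equations M n ny nw P F Ry Rw d sg \<longleftrightarrow> (\<forall>\<omega>\<in>space M.
     sg_x sg 0 \<omega> \<in> carrier_vec n \<and>
     sg_xyv sg 0 \<omega> \<in> carrier_vec ny \<and>
     sg_xwv sg 0 \<omega> \<in> carrier_vec nw \<and>
     (\<forall>i.
       sg_x sg (Suc i) \<omega> =
         pl_A P *\<^sub>v sg_x sg i \<omega> + pl_B1 P *\<^sub>v d i \<omega> + pl_B2 P *\<^sub>v scal (sg_u sg i \<omega>) \<and>
       scal (sg_y sg i \<omega>) = pl_C2 P *\<^sub>v sg_x sg i \<omega> + pl_D21 P *\<^sub>v d i \<omega> \<and>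
       sg_u sg i \<omega> = F * sg_w sg i \<omega> \<and>
       sg_xyv sg (Suc i) \<omega> =
         rz_A Ry *\<^sub>v sg_xyv sg i \<omega> + rz_B Ry *\<^sub>v scal (sg_y sg i \<omega>) \<and>
       scal (sg_vy sg i \<omega>) =
         rz_C Ry *\<^sub>v sg_xyv sg i \<omega> + rz_D Ry *\<^sub>v scal (sg_y sg i \<omega>) \<and>
       sg_xwv sg (Suc i) \<omega> =
         rz_A Rw *\<^sub>v sg_xwv sg i \<omega> + rz_B Rw *\<^sub>v scal (w_delayed sg i \<omega>) \<and>
       scal (sg_vw sg i \<omega>) =
         rz_C Rw *\<^sub>v sg_xwv sg i \<omega> + rz_D Rw *\<^sub>v scal (w_delayed sg i \<omega>) \<and>
       sg_v sg i \<omega> = sg_vy sg i \<omega> + sg_vw sg i \<omega>))"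

section \<open>Random vectors and processes\<close>

definition covariance :: "'w measure \<Rightarrow> ('w \<Rightarrow> real) \<Rightarrow> ('w \<Rightarrow> real) \<Rightarrow> real" where
  "covariance M U V =
     (LINT \<omega>|M. (U \<omega> - (LINT \<omega>'|M. U \<omega>')) * (V \<omega> - (LINT \<omega>'|M. V \<omega>')))"

definition second_order :: "'w measure \<Rightarrow> nat \<Rightarrow> ('w \<Rightarrow> real vec) \<Rightarrow> bool" where
  "second_order M N Z \<longleftrightarrow>
     (\<forall>\<omega>\<in>space M. Z \<omega> \<in> carrier_vec N) \<and>
     (\<forall>a<N. (\<lambda>\<omega>. Z \<omega> $ a) \<in> borel_measurable M \<and> integrable M (\<lambda>\<omega>. (Z \<omega> $ a)\<^sup>2))"

text \<open>Normal random variables, where almost surely constant ones are included.\<close>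

definition normal_rv :: "'w measure \<Rightarrow> ('w \<Rightarrow> real) \<Rightarrow> bool" where
  "normal_rv M X \<longleftrightarrow> X \<in> borel_measurable M \<and>
     (\<exists>\<mu> \<sigma>. (\<sigma> > 0 \<and> distributed M lborel X (normal_density \<mu> \<sigma>)) \<or> (AE \<omega> in M. X \<omega> = \<mu>))"

definition gaussian_family :: "'w measure \<Rightarrow> 'i set \<Rightarrow> ('i \<Rightarrow> 'w \<Rightarrow> real) \<Rightarrow> bool" where
  "gaussian_family M I Z \<longleftrightarrow>
     (\<forall>J c. finite J \<and> J \<subseteq> I \<longrightarrow> normal_rv M (\<lambda>\<omega>. \<Sum>i\<in>J. c i * Z i \<omega>))"

definition path :: "'i set \<Rightarrow> ('i \<Rightarrow> 'w \<Rightarrow> 'b) \<Rightarrow> 'w \<Rightarrow> 'i \<Rightarrow> 'b" where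
  "path I Z \<omega> = (\<lambda>i\<in>I. Z i \<omega>)"

definition path_space :: "'i set \<Rightarrow> ('i \<Rightarrow> real) measure" where
  "path_space I = PiM I (\<lambda>_. borel)"

definition vec_path :: "nat \<Rightarrow> (nat \<Rightarrow> 'w \<Rightarrow> real vec) \<Rightarrow> 'w \<Rightarrow> nat \<times> nat \<Rightarrow> real" where
  "vec_path m d = path (UNIV \<times> {..<m}) (\<lambda>(i, a) \<omega>. d i \<omega> $ a)"

definition init_path :: "nat \<Rightarrow> ('w \<Rightarrow> real vec) \<Rightarrow> 'w \<Rightarrow> nat \<Rightarrow> real" where
  "init_path N z = path {..<N} (\<lambda>a \<omega>. z \<omega> $ a)"

definition stationary_gaussian ::
  "'w measure \<Rightarrow> nat \<Rightarrow> (nat \<Rightarrow> 'w \<Rightarrow> real vec) \<Rightarrow> bool" where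
  "stationary_gaussian M m d \<longleftrightarrow>
     (\<forall>i. \<forall>\<omega>\<in>space M. d i \<omega> \<in> carrier_vec m) \<and>
     gaussian_family M (UNIV \<times> {..<m}) (\<lambda>(i, a) \<omega>. d i \<omega> $ a) \<and>
     (\<forall>h. distr M (path_space (UNIV \<times> {..<m})) (vec_path m (\<lambda>i. d (i + h))) =
          distr M (path_space (UNIV \<times> {..<m})) (vec_path m d))"

text \<open>AWSS is a property of the family of all trajectories of one system: the limits have to be
  the same for every trajectory, that is, independent of the initial state.  The lag ranges over
  all integers; the truncation by \<open>nat\<close> only affects finitely many terms of the sequence.\<close>

definition awss :: "'w measure \<Rightarrow> nat \<Rightarrow> (nat \<Rightarrow> 'w \<Rightarrow> real vec) set \<Rightarrow> bool" where
  "awss M N \<X> \<longleftrightarrow>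
     (\<exists>\<mu> C. \<mu> \<in> carrier_vec N \<and> (\<forall>\<tau>::int. C \<tau> \<in> carrier_mat N N) \<and>
       (\<forall>X\<in>\<X>.
         (\<forall>i. second_order M N (X i)) \<and>
         (\<forall>a<N. (\<lambda>i. LINT \<omega>|M. X i \<omega> $ a) \<longlonglongrightarrow> \<mu> $ a) \<and>
         (\<forall>\<tau>. \<forall>a<N. \<forall>b<N.
            (\<lambda>i. covariance M (\<lambda>\<omega>. X (nat (int i + \<tau>)) \<omega> $ a) (\<lambda>\<omega>. X i \<omega> $ b))
              \<longlonglongrightarrow> C \<tau> $$ (a, b))))"

section \<open>Markov jump linear systems\<close>

text \<open>\<open>P j j'\<close> is the probability of a transition from \<open>j'\<close> to \<open>j\<close>.\<close>

definition markov_chain ::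
  "'w measure \<Rightarrow> nat \<Rightarrow> (nat \<Rightarrow> nat \<Rightarrow> real) \<Rightarrow> (nat \<Rightarrow> 'w \<Rightarrow> nat) \<Rightarrow> bool" where
  "markov_chain M k P \<xi> \<longleftrightarrow>
     (\<forall>i. \<xi> i \<in> M \<rightarrow>\<^sub>M count_space {0..k}) \<and>
     (\<forall>i h j. j \<le> k \<longrightarrow> (\<forall>t\<le>i. h t \<le> k) \<longrightarrow>
        measure M {\<omega>\<in>space M. (\<forall>t\<le>i. \<xi> t \<omega> = h t) \<and> \<xi> (Suc i) \<omega> = j} =
        P j (h i) * measure M {\<omega>\<in>space M. \<forall>t\<le>i. \<xi> t \<omega> = h t})"

definition mjls ::
  "'w measure \<Rightarrow> nat \<Rightarrow> (nat \<Rightarrow> nat \<Rightarrow> real) \<Rightarrow> (nat \<Rightarrow> 'w \<Rightarrow> nat) \<Rightarrow>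
   (nat \<Rightarrow> real mat) \<Rightarrow> (nat \<Rightarrow> real mat) \<Rightarrow>
   (nat \<Rightarrow> 'w \<Rightarrow> real vec) \<Rightarrow> (nat \<Rightarrow> 'w \<Rightarrow> real vec) \<Rightarrow> bool" where
  "mjls M k P \<xi> A B \<eta> X \<longleftrightarrow>
     markov_chain M k P \<xi> \<and>
     (\<forall>i. \<forall>\<omega>\<in>space M. X (Suc i) \<omega> = A (\<xi> i \<omega>) *\<^sub>v X i \<omega> + B (\<xi> i \<omega>) *\<^sub>v \<eta> i \<omega>)"

section \<open>Code, channel and the closed loop\<close>

definition prob_received :: "nat \<Rightarrow> real \<Rightarrow> nat \<Rightarrow> real" where
  "prob_received k pl j = real (k choose j) * (1 - pl) ^ j * pl ^ (k - j)"

definition trans_prob :: "nat \<Rightarrow> real \<Rightarrow> nat \<Rightarrow> nat \<Rightarrow> real" where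
  "trans_prob k pl j j' = prob_received k pl j"

text \<open>\<open>rcv i l\<close> is the event that description \<open>l < k\<close> arrives at time \<open>i\<close>.\<close>

definition iid_losses :: "'w measure \<Rightarrow> nat \<Rightarrow> real \<Rightarrow> (nat \<Rightarrow> nat \<Rightarrow> 'w \<Rightarrow> bool) \<Rightarrow> bool" where
  "iid_losses M k pl rcv \<longleftrightarrow>
     prob_space.indep_vars M (\<lambda>_. count_space UNIV) (\<lambda>(i, l). rcv i l) (UNIV \<times> {..<k}) \<and>
     (\<forall>i. \<forall>l<k. measure M {\<omega>\<in>space M. \<not> rcv i l \<omega>} = pl)"

definition num_received :: "nat \<Rightarrow> (nat \<Rightarrow> nat \<Rightarrow> 'w \<Rightarrow> bool) \<Rightarrow> nat \<Rightarrow> 'w \<Rightarrow> nat" where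
  "num_received k rcv i \<omega> = card {l. l < k \<and> rcv i l \<omega>}"

definition jumpM :: "nat \<Rightarrow> real" where
  "jumpM \<xi> = (if \<xi> = 0 then 0 else 1)"

definition jumpJ :: "nat \<Rightarrow> nat \<Rightarrow> real vec" where
  "jumpJ k \<xi> = unit_vec (k + 1) \<xi>"

text \<open>\<open>q l i\<close> is the quantization noise at time \<open>i\<close> when \<open>l\<close> descriptions arrive.\<close>

definition qbar :: "nat \<Rightarrow> (nat \<Rightarrow> nat \<Rightarrow> 'w \<Rightarrow> real) \<Rightarrow> nat \<Rightarrow> 'w \<Rightarrow> real vec" where
  "qbar k q i \<omega> = vec (k + 1) (\<lambda>l. if l = 0 then 0 else q l i \<omega>)"

text \<open>White in the second-order sense; the noises belonging to different numbers of received
  descriptions may be dependent at equal times.\<close>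

definition white_noises ::
  "'w measure \<Rightarrow> nat \<Rightarrow> (nat \<Rightarrow> real) \<Rightarrow> (nat \<Rightarrow> nat \<Rightarrow> 'w \<Rightarrow> real) \<Rightarrow> bool" where
  "white_noises M k \<sigma>2 q \<longleftrightarrow>
     (\<forall>l\<in>{1..k}. \<forall>i.
        q l i \<in> borel_measurable M \<and> integrable M (\<lambda>\<omega>. (q l i \<omega>)\<^sup>2) \<and>
        (LINT \<omega>|M. q l i \<omega>) = 0 \<and> covariance M (q l i) (q l i) = \<sigma>2 l) \<and>
     (\<forall>l\<in>{1..k}. \<forall>l'\<in>{1..k}. \<forall>i i'. i \<noteq> i' \<longrightarrow> covariance M (q l i) (q l' i') = 0)"

definition quantizer_output ::
  "'w measure \<Rightarrow> nat \<Rightarrow> (nat \<Rightarrow> nat \<Rightarrow> 'w \<Rightarrow> real) \<Rightarrow> (nat \<Rightarrow> 'w \<Rightarrow> nat) \<Rightarrow> 'w loop_signals \<Rightarrow> bool"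
  where
  "quantizer_output M k q \<xi> sg \<longleftrightarrow> (\<forall>i. \<forall>\<omega>\<in>space M.
     sg_w sg i \<omega> =
       jumpM (\<xi> i \<omega>) * sg_v sg i \<omega> + scalar_prod (jumpJ k (\<xi> i \<omega>)) (qbar k q i \<omega>))"

text \<open>Square-integrable initial state with Gaussian plant part (its first \<open>n\<close> entries).\<close>

definition initial_state :: "'w measure \<Rightarrow> nat \<Rightarrow> nat \<Rightarrow> ('w \<Rightarrow> real vec) \<Rightarrow> bool" where
  "initial_state M n N z \<longleftrightarrow>
     second_order M N z \<and> gaussian_family M {..<n} (\<lambda>a \<omega>. z \<omega> $ a)"

text \<open>Independence of two random elements with values in possibly different types, in the
  formulation of the library's \<open>indep_var\<close>, which needs equal value types.\<close>

definition indep_elements ::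
  "'w measure \<Rightarrow> 'a measure \<Rightarrow> ('w \<Rightarrow> 'a) \<Rightarrow> 'b measure \<Rightarrow> ('w \<Rightarrow> 'b) \<Rightarrow> bool" where
  "indep_elements M S X T Y \<longleftrightarrow>
     X \<in> M \<rightarrow>\<^sub>M S \<and> Y \<in> M \<rightarrow>\<^sub>M T \<and>
     prob_space.indep_set M {X -` A \<inter> space M | A. A \<in> sets S} {Y -` B \<inter> space M | B. B \<in> sets T}"

text \<open>The quantization noise is independent of initial state and disturbance, and the packet losses
  are independent of all three.  The disturbance may depend on the initial state.\<close>

definition exogenous_indep ::
  "'w measure \<Rightarrow> nat \<Rightarrow> nat \<Rightarrow> nat \<Rightarrow> ('w \<Rightarrow> real vec) \<Rightarrow> (nat \<Rightarrow> 'w \<Rightarrow> real vec) \<Rightarrow>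
   (nat \<Rightarrow> nat \<Rightarrow> 'w \<Rightarrow> real) \<Rightarrow> (nat \<Rightarrow> nat \<Rightarrow> 'w \<Rightarrow> bool) \<Rightarrow> bool" where
  "exogenous_indep M N m k z d q rcv \<longleftrightarrow>
     (let S = path_space {..<N} \<Otimes>\<^sub>M path_space (UNIV \<times> {..<m});
          zd = (\<lambda>\<omega>. (init_path N z \<omega>, vec_path m d \<omega>));
          T = path_space ({1..k} \<times> UNIV);
          qp = path ({1..k} \<times> UNIV) (\<lambda>(l, i). q l i)
      in indep_elements M T qp S zd \<and>
         indep_elements M
           (PiM (UNIV \<times> {..<k}) (\<lambda>_. count_space UNIV)) (path (UNIV \<times> {..<k}) (\<lambda>(i, l). rcv i l))
           (T \<Otimes>\<^sub>M S) (\<lambda>\<omega>. (qp \<omega>, zd \<omega>)))"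

text \<open>All realizations of the closed loop over the erasure channel, for arbitrary initial states.\<close>

definition erasure_loops ::
  "'w measure \<Rightarrow> nat \<Rightarrow> nat \<Rightarrow> nat \<Rightarrow> nat \<Rightarrow> nat \<Rightarrow> plant \<Rightarrow> real \<Rightarrow> realization \<Rightarrow> realization \<Rightarrow>
   (nat \<Rightarrow> 'w \<Rightarrow> real vec) \<Rightarrow> (nat \<Rightarrow> nat \<Rightarrow> 'w \<Rightarrow> real) \<Rightarrow> (nat \<Rightarrow> nat \<Rightarrow> 'w \<Rightarrow> bool) \<Rightarrow>
   'w loop_signals set" where
  "erasure_loops M n m ny nw k P F Ry Rw d q rcv =
     {sg. loop_equations M n ny nw P F Ry Rw d sg \<and>
          quantizer_output M k q (num_received k rcv) sg \<and>
          initial_state M n (n + ny + nw + 1) (aug_state sg 0) \<and>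
          exogenous_indep M (n + ny + nw + 1) m k (aug_state sg 0) d q rcv}"

text \<open>The signal-to-noise ratio of the loop when \<open>w = v + q\<close> with additive white Gaussian noise:
  the asymptotic variance of \<open>v\<close> divided by the variance of \<open>q\<close>.\<close>

definition awgn_loop_snr ::
  "'w measure \<Rightarrow> nat \<Rightarrow> nat \<Rightarrow> nat \<Rightarrow> nat \<Rightarrow> plant \<Rightarrow> real \<Rightarrow> realization \<Rightarrow> realization \<Rightarrow>
   (nat \<Rightarrow> 'w \<Rightarrow> real vec) \<Rightarrow> real \<Rightarrow> bool" where
  "awgn_loop_snr M n m ny nw P F Ry Rw d \<gamma> \<longleftrightarrow>
     (let N = n + ny + nw + 1 in
      \<exists>sg q \<sigma>q \<sigma>v2. \<sigma>q > 0 \<and>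
        loop_equations M n ny nw P F Ry Rw d sg \<and>
        (\<forall>i. \<forall>\<omega>\<in>space M. sg_w sg i \<omega> = sg_v sg i \<omega> + q i \<omega>) \<and>
        initial_state M n N (aug_state sg 0) \<and>
        prob_space.indep_vars M (\<lambda>_. borel) q UNIV \<and>
        (\<forall>i. distributed M lborel (q i) (normal_density 0 \<sigma>q)) \<and>
        indep_elements M (path_space UNIV) (path UNIV q)
          (path_space {..<N} \<Otimes>\<^sub>M path_space (UNIV \<times> {..<m}))
          (\<lambda>\<omega>. (init_path N (aug_state sg 0) \<omega>, vec_path m d \<omega>)) \<and>
        (\<lambda>i. covariance M (sg_v sg i) (sg_v sg i)) \<longlonglongrightarrow> \<sigma>v2 \<and>
        \<gamma> = \<sigma>v2 / \<sigma>q\<^sup>2)"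

section \<open>System matrices\<close>

definition Sigma_mat :: "plant \<Rightarrow> real \<Rightarrow> nat \<Rightarrow> real mat" where
  "Sigma_mat P F \<xi> = (F * jumpM \<xi>) \<cdot>\<^sub>m pl_B2 P"

definition A_jump ::
  "nat \<Rightarrow> nat \<Rightarrow> nat \<Rightarrow> plant \<Rightarrow> real \<Rightarrow> realization \<Rightarrow> realization \<Rightarrow> nat \<Rightarrow> real mat" where
  "A_jump n ny nw P F Ry Rw \<xi> =
     (let S = Sigma_mat P F \<xi>; c = jumpM \<xi> in
      four_block_mat
        (four_block_mat
          (pl_A P + S * rz_D Ry * pl_C2 P)   (S * rz_C Ry)
          (rz_B Ry * pl_C2 P)                (rz_A Ry))
        (four_block_mat
          (S * rz_C Rw)                      (S * rz_D Rw)
          (0\<^sub>m ny nw)                          (0\<^sub>m ny 1))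
        (four_block_mat
          (0\<^sub>m nw n)                           (0\<^sub>m nw ny)
          (c \<cdot>\<^sub>m (rz_D Ry * pl_C2 P))         (c \<cdot>\<^sub>m rz_C Ry))
        (four_block_mat
          (rz_A Rw)                          (rz_B Rw)
          (c \<cdot>\<^sub>m rz_C Rw)                     (c \<cdot>\<^sub>m rz_D Rw)))"

definition B_jump ::
  "nat \<Rightarrow> nat \<Rightarrow> nat \<Rightarrow> nat \<Rightarrow> plant \<Rightarrow> real \<Rightarrow> realization \<Rightarrow> nat \<Rightarrow> real mat" where
  "B_jump m ny nw k P F Ry \<xi> =
     (let S = Sigma_mat P F \<xi>; c = jumpM \<xi>; JT = mat_of_row (jumpJ k \<xi>) in
      four_block_mat
          (pl_B1 P + S * rz_D Ry * pl_D21 P) (F \<cdot>\<^sub>m (pl_B2 P * JT))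
          (rz_B Ry * pl_D21 P)               (0\<^sub>m ny (k + 1))
      @\<^sub>r
      four_block_mat
          (0\<^sub>m nw m)                           (0\<^sub>m nw (k + 1))
          (c \<cdot>\<^sub>m (rz_D Ry * pl_D21 P))        JT)"

definition kronecker :: "real mat \<Rightarrow> real mat \<Rightarrow> real mat" where
  "kronecker X Y =
     mat (dim_row X * dim_row Y) (dim_col X * dim_col Y)
       (\<lambda>(r, c). X $$ (r div dim_row Y, c div dim_col Y) * Y $$ (r mod dim_row Y, c mod dim_col Y))"

text \<open>The block in position \<open>(j, j')\<close> is \<open>P j j'\<close> times the Kronecker square of \<open>A j'\<close>,
  where every \<open>A j'\<close> is an \<open>N \<times> N\<close> matrix.\<close>

definition big_A :: "nat \<Rightarrow> nat \<Rightarrow> (nat \<Rightarrow> nat \<Rightarrow> real) \<Rightarrow> (nat \<Rightarrow> real mat) \<Rightarrow> real mat" where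
  "big_A k N P A =
     mat ((k + 1) * N\<^sup>2) ((k + 1) * N\<^sup>2)
       (\<lambda>(r, c). let j = r div N\<^sup>2; j' = c div N\<^sup>2 in
          P j j' * kronecker (A j') (A j') $$ (r mod N\<^sup>2, c mod N\<^sup>2))"

end

theory Submission
  imports Defs
begin

text \<open>Everything is done with first and second moments.  The jumps are independent, so \<open>\<xi> i\<close> is
  independent of the state \<open>x i\<close> and of all noises, and averaging the state equation over \<open>\<xi> i\<close>
  turns it into linear recursions for the moments.  The matrix \<open>E[x x\<^sup>T]\<close> evolves by the averaged
  Kronecker square \<open>T = E[A(\<xi>) \<otimes> A(\<xi>)]\<close>, and the mean, the correlation with the disturbance and the
  correlation at positive lags evolve by the average \<open>E[A(\<xi>)]\<close>.  For independent jumps the columns of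
  the big matrix factor through \<open>T\<close>, so a spectral radius below 1 makes the powers of \<open>T\<close> decay
  geometrically, and by Jensen's inequality those of \<open>E[A(\<xi>)]\<close> as well.  Hence all moments converge, to
  limits that do not depend on the initial state.  The disturbance may have arbitrarily slowly decaying
  correlations: the moments \<open>E[x(i) d(i + l)\<^sup>T]\<close> for all lags \<open>l \<ge> 0\<close> are treated as one infinite system
  of recursions.\<close>

section \<open>Limits of stable linear recursions\<close>

text \<open>The disturbance is only stationary, so the state is correlated with its future values
  and the second moment has the forcing term E[x(i) d(i)^T]. The recursion for that term does not
  close: passing from x(i) to x(i+1) with the time of d held fixed turns lag l + 1 of the old state
  into lag l of the new one. Unrolling meets correlations at ever larger lags; stationarity bounds
  them all by variances, and the geometric factor in front of them makes the series converge. This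
  dictates the order: mean and E[x d^T], then E[x x^T], then positive lags by induction on the lag,
  then negative lags by symmetry. The hypothesis speaks only about second moments, so stability of
  E[A(\<xi>)] has to be extracted from it; this is the purpose of the Jensen argument. The
  quantization noises are white only to second order. What the moment recursions use is that the
  noise at time i' is uncorrelated with x(i) for i \<le> i', which follows by induction along the
  state equation. Independence of the initial state is captured by treating a whole set of
  trajectories at once and asking for one limit for all of them.\<close>

primrec kpow :: "'i set \<Rightarrow> ('i \<Rightarrow> 'i \<Rightarrow> real) \<Rightarrow> nat \<Rightarrow> 'i \<Rightarrow> 'i \<Rightarrow> real" where
  "kpow I T 0 a b = of_bool (a = b)"
| "kpow I T (Suc t) a b = (\<Sum>c\<in>I. T a c * kpow I T t c b)"

text \<open>The form in which stability is passed on: an entrywise bound on the powers makes sense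
  for pairs as indices too, and it is the majorant that the series argument needs.\<close>

definition geometric_decay :: "'i set \<Rightarrow> ('i \<Rightarrow> 'i \<Rightarrow> real) \<Rightarrow> bool" where
  "geometric_decay I T \<longleftrightarrow>
     (\<exists>C r. 0 \<le> r \<and> r < 1 \<and> (\<forall>t. \<forall>a\<in>I. \<forall>b\<in>I. \<bar>kpow I T t a b\<bar> \<le> C * r ^ t))"

text \<open>\<open>S\<close> is the set of trajectories. Choosing \<open>L\<close> before
  \<open>s\<close> is what expresses that the limit does not depend on the initial state.\<close>

definition common_limit :: "'s set \<Rightarrow> ('s \<Rightarrow> nat \<Rightarrow> real) \<Rightarrow> bool" where
  "common_limit S f \<longleftrightarrow> (\<exists>L. \<forall>s\<in>S. f s \<longlonglongrightarrow> L)"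

lemma common_limit_const: "common_limit S (\<lambda>s i. c)"
  by (auto simp: common_limit_def)

lemma common_limit_add:
  "common_limit S f \<Longrightarrow> common_limit S g \<Longrightarrow> common_limit S (\<lambda>s i. f s i + g s i)"
  unfolding common_limit_def by (blast intro: tendsto_add)

lemma common_limit_diff:
  "common_limit S f \<Longrightarrow> common_limit S g \<Longrightarrow> common_limit S (\<lambda>s i. f s i - g s i)"
  unfolding common_limit_def by (blast intro: tendsto_diff)

lemma common_limit_mult:
  "common_limit S f \<Longrightarrow> common_limit S g \<Longrightarrow> common_limit S (\<lambda>s i. f s i * g s i)"
  unfolding common_limit_def by (blast intro: tendsto_mult)

lemma common_limit_scale: "common_limit S f \<Longrightarrow> common_limit S (\<lambda>s i. c * f s i)"
  by (intro common_limit_mult common_limit_const)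

lemma common_limit_sum:
  assumes "\<And>j. j \<in> J \<Longrightarrow> common_limit S (f j)"
  shows "common_limit S (\<lambda>s i. \<Sum>j\<in>J. f j s i)"
  using assms
  by (induction J rule: infinite_finite_induct) (auto intro: common_limit_const common_limit_add)

lemma common_limit_shift:
  assumes "common_limit S f"
  shows "common_limit S (\<lambda>s i. f s (i + h))"
  using assms unfolding common_limit_def by (blast intro: LIMSEQ_ignore_initial_segment)

lemma common_limit_unshift:
  assumes "common_limit S (\<lambda>s i. f s (i + h))"
  shows "common_limit S f"
  using assms unfolding common_limit_def by (blast intro: LIMSEQ_offset)

lemma common_limit_cong:
  assumes "common_limit S f" "\<And>s i. s \<in> S \<Longrightarrow> g s i = f s i"
  shows "common_limit S g"
proof -
  have "g s = f s" if "s \<in> S" for s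
    using assms(2)[OF that] by auto
  then show ?thesis
    using assms(1) unfolding common_limit_def by auto
qed

text \<open>Variation of constants for a recursion that raises its parameter: each unrolling
  replaces \<open>l\<close> by \<open>Suc l\<close>, so a source that has been propagated
  \<open>t\<close> times is read at \<open>l + t\<close>. In the application \<open>l\<close> is the
  lag between state and disturbance.\<close>

lemma linear_recursion_closed_form:
  fixes u c :: "nat \<Rightarrow> 'i \<Rightarrow> nat \<Rightarrow> real"
  assumes I: "finite I"
    and step: "\<And>i a l. a \<in> I \<Longrightarrow> u (Suc i) a l = (\<Sum>b\<in>I. T a b * u i b (Suc l)) + c i a l"
    and a: "a \<in> I"
  shows "u i a l = (\<Sum>b\<in>I. kpow I T i a b * u 0 b (l + i)) +
    (\<Sum>t<i. \<Sum>b\<in>I. kpow I T t a b * c (i - Suc t) b (l + t))"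
  using a
proof (induction i arbitrary: a l)
  case 0
  then show ?case
    using I by (simp add: of_bool_def if_distrib if_distribR cong: if_cong)
next
  case (Suc i)
  have *: "(\<Sum>d\<in>I. T a d * (\<Sum>b\<in>I. kpow I T t d b * v b)) = (\<Sum>b\<in>I. kpow I T (Suc t) a b * v b)"
    for t and v :: "'i \<Rightarrow> real"
    unfolding kpow.simps sum_distrib_left sum_distrib_right
    by (subst sum.swap) (simp add: mult_ac)
  have swap: "(\<Sum>d\<in>I. T a d * (\<Sum>t<i. g t d)) = (\<Sum>t<i. \<Sum>d\<in>I. T a d * g t d)" for g
    by (subst sum.swap) (simp only: sum_distrib_left)
  \<comment> \<open>The newest source is multiplied by the identity \<open>kpow I T 0\<close>, so
    that it becomes the summand \<open>t = 0\<close> once the others have moved up by one.\<close>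
  have c0: "c i a l = (\<Sum>b\<in>I. kpow I T 0 a b * c i b l)"
    using I Suc.prems by (simp add: of_bool_def if_distrib if_distribR cong: if_cong)
  have "u (Suc i) a l = (\<Sum>d\<in>I. T a d * u i d (Suc l)) + c i a l"
    by (rule step[OF Suc.prems])
  also have "(\<Sum>d\<in>I. T a d * u i d (Suc l)) =
      (\<Sum>d\<in>I. T a d * ((\<Sum>b\<in>I. kpow I T i d b * u 0 b (Suc l + i)) +
        (\<Sum>t<i. \<Sum>b\<in>I. kpow I T t d b * c (i - Suc t) b (Suc l + t))))"
    by (intro sum.cong refl arg_cong[where f = "(*) _"] Suc.IH)
  also have "\<dots> = (\<Sum>d\<in>I. T a d * (\<Sum>b\<in>I. kpow I T i d b * u 0 b (Suc l + i))) +
        (\<Sum>t<i. \<Sum>d\<in>I. T a d * (\<Sum>b\<in>I. kpow I T t d b * c (i - Suc t) b (Suc l + t)))"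
    unfolding distrib_left sum.distrib swap ..
  also have "\<dots> = (\<Sum>b\<in>I. kpow I T (Suc i) a b * u 0 b (l + Suc i)) +
        (\<Sum>t<i. \<Sum>b\<in>I. kpow I T (Suc t) a b * c (i - Suc t) b (l + Suc t))"
    unfolding * by simp
  also have "\<dots> + c i a l = (\<Sum>b\<in>I. kpow I T (Suc i) a b * u 0 b (l + Suc i)) +
        (\<Sum>t<Suc i. \<Sum>b\<in>I. kpow I T t a b * c (Suc i - Suc t) b (l + t))"
    unfolding c0 sum.lessThan_Suc_shift by (simp del: kpow.simps)
  finally show ?case .
qed

text \<open>In the closed form the contribution of the start vanishes, being bounded while the
  kernel powers decay, and the propagated sources converge by Tannery's theorem with a geometric
  majorant. The limit is built from \<open>T\<close> and the limits of the sources alone, hence is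
  the same for every \<open>s\<close>. The bounds are uniform in \<open>l\<close> because the
  unrolling visits arbitrarily large parameters.\<close>

lemma common_limit_recursion:
  fixes u c :: "'s \<Rightarrow> nat \<Rightarrow> 'i \<Rightarrow> nat \<Rightarrow> real"
  assumes I: "finite I" and decay: "geometric_decay I T"
    and step: "\<And>s i a l. s \<in> S \<Longrightarrow> a \<in> I \<Longrightarrow>
      u s (Suc i) a l = (\<Sum>b\<in>I. T a b * u s i b (Suc l)) + c s i a l"
    and lim: "\<And>a l. a \<in> I \<Longrightarrow> common_limit S (\<lambda>s i. c s i a l)"
    and bc: "\<And>s. s \<in> S \<Longrightarrow> \<exists>K. \<forall>i. \<forall>a\<in>I. \<forall>l. \<bar>c s i a l\<bar> \<le> K"
    and bu: "\<And>s. s \<in> S \<Longrightarrow> \<exists>K. \<forall>a\<in>I. \<forall>l. \<bar>u s 0 a l\<bar> \<le> K"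
    and a: "a \<in> I"
  shows "common_limit S (\<lambda>s i. u s i a l)"
proof -
  have "\<exists>L. \<forall>s\<in>S. (\<lambda>i. c s i b l) \<longlonglongrightarrow> L" if "b \<in> I" for b l
    using lim[OF that, of l] unfolding common_limit_def .
  then obtain cl where cl: "\<And>b l s. b \<in> I \<Longrightarrow> s \<in> S \<Longrightarrow> (\<lambda>i. c s i b l) \<longlonglongrightarrow> cl b l"
    by metis
  obtain C r where r: "0 \<le> r" "r < 1"
    and C: "\<And>t a b. a \<in> I \<Longrightarrow> b \<in> I \<Longrightarrow> \<bar>kpow I T t a b\<bar> \<le> C * r ^ t"
    using decay unfolding geometric_decay_def by blast
  have C0: "C \<ge> 0"
    using C[OF a a, of 0] by simp
  define f where "f t = (\<Sum>b\<in>I. kpow I T t a b * cl b (l + t))" for t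
  have "(\<lambda>i. u s i a l) \<longlonglongrightarrow> suminf f" if s: "s \<in> S" for s
  proof -
    obtain K1 where K1: "\<And>i b l. b \<in> I \<Longrightarrow> \<bar>c s i b l\<bar> \<le> K1" using bc[OF s] by blast
    obtain K2 where K2: "\<And>b l. b \<in> I \<Longrightarrow> \<bar>u s 0 b l\<bar> \<le> K2" using bu[OF s] by blast
    have K: "0 \<le> K1" "0 \<le> K2"
      using K1[OF a, of 0 0] K2[OF a, of 0] by linarith+
    have r_lim: "(\<lambda>i. r ^ i) \<longlonglongrightarrow> 0"
      using r by (intro LIMSEQ_power_zero) auto
    have kpow_lim: "(\<lambda>i. kpow I T i a b * u s 0 b (l + i)) \<longlonglongrightarrow> 0" if b: "b \<in> I" for b
    proof (rule Lim_null_comparison)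
      show "\<forall>\<^sub>F i in sequentially. norm (kpow I T i a b * u s 0 b (l + i)) \<le> C * r ^ i * K2"
        unfolding real_norm_def abs_mult
        by (intro always_eventually allI mult_mono C K2 a b) (use C0 r in auto)
      show "(\<lambda>i. C * r ^ i * K2) \<longlonglongrightarrow> 0"
        using tendsto_mult_right_zero[OF tendsto_mult_left_zero[OF r_lim, of K2], of C]
        by (simp add: mult_ac)
    qed
    have first: "(\<lambda>i. \<Sum>b\<in>I. kpow I T i a b * u s 0 b (l + i)) \<longlonglongrightarrow> 0"
      by (rule tendsto_null_sum) (rule kpow_lim)
    \<comment> \<open>Extending the summand by zero outside \<open>t < i\<close> turns the finite
      sum into a series over all \<open>t\<close>, as Tannery's theorem requires; for fixed
      \<open>t\<close> the cutoff is eventually inactive.\<close>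
    define g where
      "g t i = (if t < i then \<Sum>b\<in>I. kpow I T t a b * c s (i - Suc t) b (l + t) else 0)" for t i
    have "(\<lambda>i. \<Sum>t. g t i) \<longlonglongrightarrow> suminf f"
    proof (rule tannerys_theorem[THEN conjunct2, THEN conjunct2])
      show "(\<lambda>i. g t i) \<longlonglongrightarrow> f t" for t
      proof (rule LIMSEQ_offset[where k = "Suc t"])
        have "(\<lambda>i. \<Sum>b\<in>I. kpow I T t a b * c s i b (l + t)) \<longlonglongrightarrow> f t"
          unfolding f_def by (intro tendsto_sum tendsto_mult tendsto_const cl s)
        then show "(\<lambda>i. g t (i + Suc t)) \<longlonglongrightarrow> f t"
          by (simp add: g_def)
      qed
      have gb: "norm (g t i) \<le> (\<Sum>b\<in>I. C * r ^ t * K1)" for t i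
      proof (cases "t < i")
        case True
        then have "norm (g t i) \<le> (\<Sum>b\<in>I. \<bar>kpow I T t a b * c s (i - Suc t) b (l + t)\<bar>)"
          by (simp add: g_def sum_abs)
        also have "\<dots> \<le> (\<Sum>b\<in>I. C * r ^ t * K1)"
          unfolding abs_mult by (intro sum_mono mult_mono C K1 a) (use C0 r in auto)
        finally show ?thesis .
      next
        case False
        then show ?thesis using C0 r K by (simp add: g_def)
      qed
      then show "\<forall>\<^sub>F (t, i) in at_top \<times>\<^sub>F sequentially. norm (g t i) \<le> (\<Sum>b\<in>I. C * r ^ t * K1)"
        by (intro always_eventually) auto
      show "summable (\<lambda>t. \<Sum>b\<in>I. C * r ^ t * K1)"
        using r by (intro summable_sum summable_mult2 summable_mult summable_geometric) auto
    qed simp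
    moreover have "(\<Sum>t. g t i) = (\<Sum>t<i. \<Sum>b\<in>I. kpow I T t a b * c s (i - Suc t) b (l + t))" for i
    proof -
      have "(\<Sum>t. g t i) = (\<Sum>t<i. g t i)"
        by (rule suminf_finite) (auto simp: g_def)
      then show ?thesis by (simp add: g_def)
    qed
    ultimately have "(\<lambda>i. (\<Sum>b\<in>I. kpow I T i a b * u s 0 b (l + i)) +
        (\<Sum>t<i. \<Sum>b\<in>I. kpow I T t a b * c s (i - Suc t) b (l + t))) \<longlonglongrightarrow> 0 + suminf f"
      using first by (intro tendsto_add) simp_all
    then show ?thesis
      using linear_recursion_closed_form[where u = "u s" and c = "c s" and T = T, OF I step[OF s] a]
      by simp
  qed
  then show ?thesis
    unfolding common_limit_def by blast
qed

text \<open>The parameter \<open>l\<close> becomes a dummy. The uniform bounds come for free: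
  convergent sequences are bounded and the index set is finite.\<close>

lemma common_limit_recursion_simple:
  fixes u c :: "'s \<Rightarrow> nat \<Rightarrow> 'i \<Rightarrow> real"
  assumes I: "finite I" and decay: "geometric_decay I T"
    and step: "\<And>s i a. s \<in> S \<Longrightarrow> a \<in> I \<Longrightarrow>
      u s (Suc i) a = (\<Sum>b\<in>I. T a b * u s i b) + c s i a"
    and lim: "\<And>a. a \<in> I \<Longrightarrow> common_limit S (\<lambda>s i. c s i a)"
    and a: "a \<in> I"
  shows "common_limit S (\<lambda>s i. u s i a)"
proof (rule common_limit_recursion[where u = "\<lambda>s i a l. u s i a" and c = "\<lambda>s i a l. c s i a",
      OF I decay step lim _ _ a])
  fix s assume s: "s \<in> S"
  have "\<exists>K. \<forall>i. \<bar>c s i a\<bar> \<le> K" if "a \<in> I" for a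
  proof -
    have "convergent (\<lambda>i. c s i a)"
      using lim[OF that] s unfolding common_limit_def convergent_def by blast
    then have "Bseq (\<lambda>i. c s i a)"
      by (rule convergent_imp_Bseq)
    then show ?thesis
      by (auto simp: Bseq_def)
  qed
  then obtain K where K: "\<And>i a. a \<in> I \<Longrightarrow> \<bar>c s i a\<bar> \<le> K a"
    by metis
  have "\<bar>c s i a\<bar> \<le> (\<Sum>a\<in>I. \<bar>K a\<bar>)" if a: "a \<in> I" for i a
  proof -
    have "\<bar>c s i a\<bar> \<le> \<bar>K a\<bar>" using K[OF a, of i] by linarith
    also have "\<dots> \<le> (\<Sum>a\<in>I. \<bar>K a\<bar>)" by (rule member_le_sum[OF a]) (use I in auto)
    finally show ?thesis .
  qed
  then show "\<exists>K. \<forall>i. \<forall>a\<in>I. \<forall>l::nat. \<bar>c s i a\<bar> \<le> K"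
    by blast
  have "\<bar>u s 0 a\<bar> \<le> (\<Sum>a\<in>I. \<bar>u s 0 a\<bar>)" if a: "a \<in> I" for a
    by (rule member_le_sum[OF a]) (use I in auto)
  then show "\<exists>K. \<forall>a\<in>I. \<forall>l::nat. \<bar>u s 0 a\<bar> \<le> K"
    by blast
qed

section \<open>Mean-square stability\<close>

definition mean_kernel :: "nat \<Rightarrow> (nat \<Rightarrow> real) \<Rightarrow> (nat \<Rightarrow> nat \<Rightarrow> nat \<Rightarrow> real) \<Rightarrow> nat \<Rightarrow> nat \<Rightarrow> real" where
  "mean_kernel k p A a b = (\<Sum>j\<le>k. p j * A j a b)"

text \<open>Rows and columns of the averaged Kronecker square are numbered by pairs; flattening
  pairs to numbers is confined to the comparison with \<open>big_A\<close>.\<close>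

definition square_kernel ::
  "nat \<Rightarrow> (nat \<Rightarrow> real) \<Rightarrow> (nat \<Rightarrow> nat \<Rightarrow> nat \<Rightarrow> real) \<Rightarrow> nat \<times> nat \<Rightarrow> nat \<times> nat \<Rightarrow> real" where
  "square_kernel k p A aa bb =
     (\<Sum>j\<le>k. p j * (A j (fst aa) (fst bb) * A j (snd aa) (snd bb)))"

text \<open>The variance of \<open>f\<close> under the weights \<open>p\<close> is
  nonnegative.\<close>

lemma weighted_square_le:
  fixes p f :: "nat \<Rightarrow> real"
  assumes p: "\<And>j. j \<le> k \<Longrightarrow> 0 \<le> p j" and p1: "(\<Sum>j\<le>k. p j) = 1"
  shows "(\<Sum>j\<le>k. p j * f j)\<^sup>2 \<le> (\<Sum>j\<le>k. p j * (f j)\<^sup>2)"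
proof -
  define e where "e = (\<Sum>j\<le>k. p j * f j)"
  have "0 \<le> (\<Sum>j\<le>k. p j * (f j - e)\<^sup>2)"
    by (intro sum_nonneg mult_nonneg_nonneg p) auto
  also have "\<dots> = (\<Sum>j\<le>k. p j * (f j)\<^sup>2) - 2 * e * (\<Sum>j\<le>k. p j * f j) + e\<^sup>2 * (\<Sum>j\<le>k. p j)"
  proof -
    have "p j * (f j - e)\<^sup>2 = p j * (f j)\<^sup>2 - 2 * e * (p j * f j) + e\<^sup>2 * p j" for j
      by (simp add: power2_eq_square algebra_simps)
    then show ?thesis
      by (simp only: sum.distrib sum_subtractf sum_distrib_left)
  qed
  also have "\<dots> = (\<Sum>j\<le>k. p j * (f j)\<^sup>2) - e\<^sup>2"
    unfolding p1 e_def[symmetric] by (simp add: power2_eq_square)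
  finally show ?thesis by (simp add: e_def)
qed

text \<open>Jensen's inequality for the random transition matrix, tested against a vector \<open>w\<close>.\<close>

lemma mean_kernel_square_le:
  fixes A :: "nat \<Rightarrow> nat \<Rightarrow> nat \<Rightarrow> real"
  assumes p: "\<And>j. j \<le> k \<Longrightarrow> 0 \<le> p j" and p1: "(\<Sum>j\<le>k. p j) = 1"
  shows "(\<Sum>a<N. w a * kpow {..<N} (mean_kernel k p A) t a b)\<^sup>2 \<le>
    (\<Sum>a<N. \<Sum>a'<N. w a * w a' *
       kpow ({..<N} \<times> {..<N}) (square_kernel k p A) t (a, a') (b, b))"
proof (induction t arbitrary: w)
  case 0
  have "(\<Sum>a<N. w a * of_bool (a = b))\<^sup>2 =
      (\<Sum>a<N. \<Sum>a'<N. (w a * of_bool (a = b)) * (w a' * of_bool (a' = b)))"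
    unfolding power2_eq_square sum_product ..
  also have "\<dots> = (\<Sum>a<N. \<Sum>a'<N. w a * w a' * of_bool ((a, a') = (b, b)))"
    by (intro sum.cong refl) auto
  finally show ?case by simp
next
  case (Suc t)
  let ?M = "kpow {..<N} (mean_kernel k p A) t"
  let ?T = "kpow ({..<N} \<times> {..<N}) (square_kernel k p A) t"
  \<comment> \<open>\<open>v j\<close> is the row vector \<open>w\<close> times \<open>A j\<close>.
    The induction hypothesis is applied with \<open>v j\<close> in place of \<open>w\<close>, which
    is why the inequality is stated for all test vectors.\<close>
  define v where "v j c = (\<Sum>a<N. w a * A j a c)" for j c
  have "(\<Sum>a<N. w a * kpow {..<N} (mean_kernel k p A) (Suc t) a b) =
      (\<Sum>a<N. \<Sum>c<N. \<Sum>j\<le>k. p j * (w a * A j a c * ?M c b))"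
    by (simp add: mean_kernel_def sum_distrib_left sum_distrib_right mult_ac)
  also have "\<dots> = (\<Sum>j\<le>k. \<Sum>c<N. \<Sum>a<N. p j * (w a * A j a c * ?M c b))"
    by (subst sum.swap, subst (2) sum.swap, subst sum.swap) (rule refl)
  also have "\<dots> = (\<Sum>j\<le>k. p j * (\<Sum>c<N. v j c * ?M c b))"
    by (simp add: v_def sum_distrib_left sum_distrib_right)
  finally have "(\<Sum>a<N. w a * kpow {..<N} (mean_kernel k p A) (Suc t) a b)\<^sup>2 =
      (\<Sum>j\<le>k. p j * (\<Sum>c<N. v j c * ?M c b))\<^sup>2" by simp
  also have "\<dots> \<le> (\<Sum>j\<le>k. p j * (\<Sum>c<N. v j c * ?M c b)\<^sup>2)"
    by (rule weighted_square_le[OF p p1])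
  also have "\<dots> \<le> (\<Sum>j\<le>k. p j * (\<Sum>c<N. \<Sum>c'<N. v j c * v j c' * ?T (c, c') (b, b)))"
    by (intro sum_mono mult_left_mono Suc.IH p) auto
  also have "\<dots> = (\<Sum>j\<le>k. \<Sum>c<N. \<Sum>c'<N. \<Sum>a<N. \<Sum>a'<N.
      p j * (w a * A j a c * (w a' * A j a' c') * ?T (c, c') (b, b)))"
    unfolding v_def sum_product by (simp add: sum_distrib_left sum_distrib_right)
  also have "\<dots> = (\<Sum>(j, c, c', a, a')\<in>{..k} \<times> {..<N} \<times> {..<N} \<times> {..<N} \<times> {..<N}.
      p j * (w a * A j a c * (w a' * A j a' c') * ?T (c, c') (b, b)))"
    by (simp only: sum.cartesian_product split_def)
  \<comment> \<open>Once the five nested sums are one sum over tuples, a single bijection moves the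
    jump index innermost, where \<open>square_kernel\<close> has it.\<close>
  also have "\<dots> = (\<Sum>(a, a', c, c', j)\<in>{..<N} \<times> {..<N} \<times> {..<N} \<times> {..<N} \<times> {..k}.
      p j * (w a * A j a c * (w a' * A j a' c') * ?T (c, c') (b, b)))"
    by (rule sum.reindex_bij_witness[where j = "\<lambda>(j, c, c', a, a'). (a, a', c, c', j)"
          and i = "\<lambda>(a, a', c, c', j). (j, c, c', a, a')"]) auto
  also have "\<dots> = (\<Sum>a<N. \<Sum>a'<N. \<Sum>c<N. \<Sum>c'<N. \<Sum>j\<le>k.
      p j * (w a * A j a c * (w a' * A j a' c') * ?T (c, c') (b, b)))"
    by (simp only: sum.cartesian_product split_def)
  also have "\<dots> = (\<Sum>a<N. \<Sum>a'<N. w a * w a' *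
      (\<Sum>c<N. \<Sum>c'<N. square_kernel k p A (a, a') (c, c') * ?T (c, c') (b, b)))"
    by (simp add: square_kernel_def sum_distrib_left sum_distrib_right mult_ac)
  also have "\<dots> = (\<Sum>a<N. \<Sum>a'<N. w a * w a' *
       kpow ({..<N} \<times> {..<N}) (square_kernel k p A) (Suc t) (a, a') (b, b))"
    by (simp only: kpow.simps(2) prod.collapse sum.cartesian_product split_def)
  finally show ?case .
qed

text \<open>With a unit vector as test vector, Jensen's inequality bounds the square of an entry by
  one entry of the power of the second-moment kernel. The rate passes from \<open>r\<close> to
  \<open>sqrt r\<close>, still below 1.\<close>

lemma geometric_decay_mean_kernel:
  assumes p: "\<And>j. j \<le> k \<Longrightarrow> 0 \<le> p j" and p1: "(\<Sum>j\<le>k. p j) = 1"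
    and decay: "geometric_decay ({..<N} \<times> {..<N}) (square_kernel k p A)"
  shows "geometric_decay {..<N} (mean_kernel k p A)"
proof -
  obtain C r where r: "0 \<le> r" "r < 1"
    and bound: "\<forall>t. \<forall>a\<in>{..<N} \<times> {..<N}. \<forall>b\<in>{..<N} \<times> {..<N}.
      \<bar>kpow ({..<N} \<times> {..<N}) (square_kernel k p A) t a b\<bar> \<le> C * r ^ t"
    using decay unfolding geometric_decay_def by (elim exE conjE)
  have C: "\<bar>kpow ({..<N} \<times> {..<N}) (square_kernel k p A) t a b\<bar> \<le> C * r ^ t"
    if "a \<in> {..<N} \<times> {..<N}" "b \<in> {..<N} \<times> {..<N}" for t a b
    using bound[rule_format, OF that] .
  have "\<bar>kpow {..<N} (mean_kernel k p A) t a b\<bar> \<le> sqrt C * sqrt r ^ t" if "a < N" "b < N" for t a b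
  proof -
    have select: "(\<Sum>c<N. (if c = a then 1 else 0) * f c) = f a" for f :: "nat \<Rightarrow> real"
      using \<open>a < N\<close> by (simp add: if_distrib[where f = "\<lambda>x. x * _"] cong: if_cong)
    have "(kpow {..<N} (mean_kernel k p A) t a b)\<^sup>2 \<le>
        kpow ({..<N} \<times> {..<N}) (square_kernel k p A) t (a, a) (b, b)"
      using mean_kernel_square_le[OF p p1, where N = N and t = t and b = b and
          w = "\<lambda>c. if c = a then 1 else 0"]
      unfolding mult.assoc sum_distrib_left[symmetric] select .
    also have "\<dots> \<le> C * r ^ t"
      using C[of "(a, a)" "(b, b)" t] that by auto
    finally have "\<bar>kpow {..<N} (mean_kernel k p A) t a b\<bar> \<le> sqrt (C * r ^ t)"
      using real_le_rsqrt real_sqrt_abs real_sqrt_le_mono by metis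
    then show ?thesis
      by (simp add: real_sqrt_mult real_sqrt_power)
  qed
  then show ?thesis
    unfolding geometric_decay_def using r by (intro exI[of _ "sqrt C"] exI[of _ "sqrt r"]) auto
qed

section \<open>Matrix powers and the spectral radius\<close>

lemma pow_mat_Suc_left:
  assumes A: "(A :: 'a :: semiring_1 mat) \<in> carrier_mat n n"
  shows "A ^\<^sub>m Suc t = A * A ^\<^sub>m t"
proof (induction t)
  case 0
  then show ?case using A by simp
next
  case (Suc t)
  have "A ^\<^sub>m Suc (Suc t) = (A * A ^\<^sub>m t) * A"
    using Suc by simp
  also have "\<dots> = A * (A ^\<^sub>m t * A)"
    using A by (intro assoc_mult_mat[of _ n n _ n _ n]) auto
  finally show ?case by simp
qed

lemma smult_pow_mat:
  assumes A: "(A :: 'a :: comm_semiring_1 mat) \<in> carrier_mat n n"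
  shows "(c \<cdot>\<^sub>m A) ^\<^sub>m t = c ^ t \<cdot>\<^sub>m (A ^\<^sub>m t)"
proof (induction t)
  case 0
  then show ?case using A by (intro eq_matI) auto
next
  case (Suc t)
  have At: "A ^\<^sub>m t \<in> carrier_mat n n" using A by simp
  have "(c \<cdot>\<^sub>m A) ^\<^sub>m Suc t = (c ^ t \<cdot>\<^sub>m (A ^\<^sub>m t)) * (c \<cdot>\<^sub>m A)"
    using Suc by simp
  also have "\<dots> = c ^ Suc t \<cdot>\<^sub>m (A ^\<^sub>m t * A)"
    using A At by (intro eq_matI) (auto simp: scalar_prod_def sum_distrib_left mult_ac)
  finally show ?case by simp
qed

text \<open>The library bounds the powers of a matrix of spectral radius below 1 by a constant; rescaling
  by a number between the spectral radius and 1 turns this into geometric decay.\<close>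

lemma spectral_radius_less_1_geometric:
  fixes A :: "complex mat"
  assumes A: "A \<in> carrier_mat n n" and n: "n > 0" and sr: "spectral_radius A < 1"
  shows "\<exists>C r. 0 \<le> r \<and> r < 1 \<and> (\<forall>t. \<forall>i<n. \<forall>j<n. norm ((A ^\<^sub>m t) $$ (i, j)) \<le> C * r ^ t)"
proof -
  have "spectral_radius A \<ge> 0"
    using spectral_radius_mem_max(1)[OF A n] by auto
  \<comment> \<open>Any number strictly between the spectral radius and 1 would do; the midpoint is
    positive because the spectral radius is nonnegative, so one may divide by it.\<close>
  define r where "r = (1 + spectral_radius A) / 2"
  have r: "0 < r" "r < 1" "spectral_radius A < r"
    using sr \<open>spectral_radius A \<ge> 0\<close> by (auto simp: r_def)
  define B where "B = complex_of_real (1 / r) \<cdot>\<^sub>m A"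
  have B: "B \<in> carrier_mat n n" using A by (simp add: B_def)
  have AB: "A = complex_of_real r \<cdot>\<^sub>m B"
    using A r by (intro eq_matI) (auto simp: B_def)
  have "spectral_radius B < 1"
  proof -
    \<comment> \<open>An eigenvector of \<open>B\<close> for \<open>ev\<close> is one of
      \<open>A\<close> for \<open>r * ev\<close>; hence \<open>r * norm ev\<close> is at most the
      spectral radius of \<open>A\<close>, which is below \<open>r\<close>.\<close>
    obtain ev where ev: "ev \<in> spectrum B" "spectral_radius B = norm ev"
      using spectral_radius_mem_max(1)[OF B n] by auto
    then obtain v where v: "v \<in> carrier_vec n" "v \<noteq> 0\<^sub>v n" "B *\<^sub>v v = ev \<cdot>\<^sub>v v"
      using B unfolding spectrum_def eigenvalue_def eigenvector_def by auto
    have "A *\<^sub>v v = complex_of_real r \<cdot>\<^sub>v (B *\<^sub>v v)"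
      unfolding AB using B v(1) by (intro eq_vecI) (auto simp: scalar_prod_def sum_distrib_left mult_ac)
    also have "\<dots> = (complex_of_real r * ev) \<cdot>\<^sub>v v"
      unfolding v(3) by (simp add: smult_smult_assoc)
    finally have "eigenvalue A (complex_of_real r * ev)"
      using v A unfolding eigenvalue_def eigenvector_def by auto
    then have "norm (complex_of_real r * ev) \<le> spectral_radius A"
      by (intro spectral_radius_mem_max(2)[OF A n]) (auto simp: spectrum_def)
    then have "r * norm ev \<le> spectral_radius A"
      using r by (simp add: norm_mult)
    then have "r * norm ev < r * 1" using r by linarith
    then show ?thesis using r(1) ev(2) by (simp only: mult_less_cancel_left_pos)
  qed
  then obtain c where c: "\<And>t. norm_bound (B ^\<^sub>m t) c"
    using spectral_radius_jnf_norm_bound_less_1_upper_triangular[OF B] by blast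
  have "norm ((A ^\<^sub>m t) $$ (i, j)) \<le> c * r ^ t" if ij: "i < n" "j < n" for t i j
  proof -
    have Bt: "B ^\<^sub>m t \<in> carrier_mat n n" using B by simp
    have "A ^\<^sub>m t = complex_of_real r ^ t \<cdot>\<^sub>m (B ^\<^sub>m t)"
      unfolding AB by (rule smult_pow_mat[OF B])
    then have "norm ((A ^\<^sub>m t) $$ (i, j)) = r ^ t * norm ((B ^\<^sub>m t) $$ (i, j))"
      using ij carrier_matD[OF Bt] r by (simp add: norm_mult norm_power del: pow_mat_dim)
    also have "\<dots> \<le> r ^ t * c"
      using c[of t] ij carrier_matD[OF Bt] r unfolding norm_bound_def by (intro mult_left_mono) auto
    finally show ?thesis by (simp add: mult_ac)
  qed
  then show ?thesis using r by (intro exI[of _ c] exI[of _ r]) auto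
qed

section \<open>Rows of the big matrix as a jump state with a pair of coordinates\<close>

definition block_index :: "nat \<Rightarrow> nat \<Rightarrow> nat \<times> nat \<Rightarrow> nat" where
  "block_index N j aa = j * N\<^sup>2 + (fst aa * N + snd aa)"

lemma pair_index_less:
  assumes "a < N" "b < (N::nat)"
  shows "a * N + b < N\<^sup>2"
proof -
  have "a * N + b < Suc a * N" using assms by simp
  also have "\<dots> \<le> N * N" using assms by (intro mult_right_mono) auto
  finally show ?thesis by (simp add: power2_eq_square)
qed

lemma block_index_div_mod:
  assumes "aa \<in> {..<N} \<times> {..<N}"
  shows "block_index N j aa div N\<^sup>2 = j" "block_index N j aa mod N\<^sup>2 = fst aa * N + snd aa"
    "(fst aa * N + snd aa) div N = fst aa" "(fst aa * N + snd aa) mod N = snd aa"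
  using assms pair_index_less[of "fst aa" N "snd aa"] by (auto simp: block_index_def)

lemma block_index_less:
  assumes "aa \<in> {..<N} \<times> {..<N}" "j \<le> k"
  shows "block_index N j aa < (k + 1) * N\<^sup>2"
proof -
  have "block_index N j aa < Suc j * N\<^sup>2"
    using assms pair_index_less[of "fst aa" N "snd aa"] by (auto simp: block_index_def)
  also have "\<dots> \<le> (k + 1) * N\<^sup>2" using assms by (intro mult_right_mono) auto
  finally show ?thesis .
qed

text \<open>Mixed-radix numbering: \<open>j\<close> is the leading digit, followed by two digits
  below \<open>N\<close>. Division with remainder by \<open>N\<^sup>2\<close> and then by
  \<open>N\<close> recovers the digits and gives the inverse map of the reindexing.\<close>

lemma sum_block_index:
  assumes "N > 0"
  shows "(\<Sum>r<(k + 1) * N\<^sup>2. f r) = (\<Sum>j\<le>k. \<Sum>aa\<in>{..<N} \<times> {..<N}. f (block_index N j aa))"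
proof -
  have "(\<Sum>j\<le>k. \<Sum>aa\<in>{..<N} \<times> {..<N}. f (block_index N j aa)) =
      (\<Sum>(j, aa)\<in>{..k} \<times> ({..<N} \<times> {..<N}). f (block_index N j aa))"
    by (rule sum.cartesian_product)
  also have "\<dots> = (\<Sum>r<(k + 1) * N\<^sup>2. f r)"
  proof (rule sum.reindex_bij_witness[where j = "\<lambda>(j, aa). block_index N j aa"
        and i = "\<lambda>r. (r div N\<^sup>2, (r mod N\<^sup>2) div N, (r mod N\<^sup>2) mod N)"])
    fix r assume "r \<in> {..<(k + 1) * N\<^sup>2}"
    then have "r div N\<^sup>2 < k + 1" by (simp add: less_mult_imp_div_less)
    moreover have "r mod N\<^sup>2 < N * N" using assms by (simp add: power2_eq_square)
    then have "(r mod N\<^sup>2) div N < N" by (rule less_mult_imp_div_less)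
    ultimately show "(r div N\<^sup>2, r mod N\<^sup>2 div N, r mod N\<^sup>2 mod N) \<in> {..k} \<times> {..<N} \<times> {..<N}"
      using assms by auto
    show "(case (r div N\<^sup>2, r mod N\<^sup>2 div N, r mod N\<^sup>2 mod N) of (j, aa) \<Rightarrow> block_index N j aa) = r"
      by (simp add: block_index_def div_mult_mod_eq)
  next
    fix x assume "x \<in> {..k} \<times> {..<N} \<times> {..<N}"
    moreover obtain j aa where "x = (j, aa)" by (cases x)
    ultimately have x: "x = (j, aa)" "j \<le> k" "aa \<in> {..<N} \<times> {..<N}" by auto
    show "(case x of (j, aa) \<Rightarrow> block_index N j aa) \<in> {..<(k + 1) * N\<^sup>2}"
      using x block_index_less[of aa N j k] by simp
    show "((case x of (j, aa) \<Rightarrow> block_index N j aa) div N\<^sup>2,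
        (case x of (j, aa) \<Rightarrow> block_index N j aa) mod N\<^sup>2 div N,
        (case x of (j, aa) \<Rightarrow> block_index N j aa) mod N\<^sup>2 mod N) = x"
      using x by (auto simp: block_index_div_mod)
  qed auto
  finally show ?thesis ..
qed

lemma big_A_block_index:
  assumes "\<And>j. j \<le> k \<Longrightarrow> A j \<in> carrier_mat N N"
    and "j \<le> k" "j' \<le> k" "aa \<in> {..<N} \<times> {..<N}" "bb \<in> {..<N} \<times> {..<N}"
  shows "big_A k N P A $$ (block_index N j aa, block_index N j' bb) =
    P j j' * (A j' $$ (fst aa, fst bb) * A j' $$ (snd aa, snd bb))"
proof -
  have dims: "dim_row (A j') = N" "dim_col (A j') = N"
    using assms(1)[OF assms(3)] by auto
  have less: "fst aa * N + snd aa < N * N" "fst bb * N + snd bb < N * N"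
    using assms(4,5) pair_index_less[of "fst aa" N "snd aa"] pair_index_less[of "fst bb" N "snd bb"]
    by (auto simp: power2_eq_square)
  note div_mod = block_index_div_mod[OF assms(4)] block_index_div_mod[OF assms(5)]
  have "kronecker (A j') (A j') $$ (fst aa * N + snd aa, fst bb * N + snd bb) =
      A j' $$ (fst aa, fst bb) * A j' $$ (snd aa, snd bb)"
    unfolding kronecker_def dims by (simp only: index_mat(1)[OF less] split div_mod)
  then show ?thesis
    using block_index_less[OF assms(4,2)] block_index_less[OF assms(5,3)]
    unfolding big_A_def by (simp only: index_mat(1) split Let_def div_mod)
qed

text \<open>For independent jumps the powers of the big matrix, applied to the jump distribution, reproduce
  those of the averaged Kronecker square.\<close>

lemma big_A_power:
  fixes A :: "nat \<Rightarrow> real mat"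
  assumes A: "\<And>j. j \<le> k \<Longrightarrow> A j \<in> carrier_mat N N" and N: "N > 0"
    and j: "j \<le> k" and aa: "aa \<in> {..<N} \<times> {..<N}" and bb: "bb \<in> {..<N} \<times> {..<N}"
  shows "(\<Sum>j'\<le>k. (big_A k N (\<lambda>j _. p j) A ^\<^sub>m t) $$ (block_index N j aa, block_index N j' bb) * p j') =
    p j * kpow ({..<N} \<times> {..<N}) (square_kernel k p (\<lambda>j a b. A j $$ (a, b))) t aa bb"
  using j aa
proof (induction t arbitrary: j aa)
  case 0
  \<comment> \<open>The numbering is injective, so the identity matrix contributes exactly when jump
    and pair both agree.\<close>
  have "block_index N j aa = block_index N j' bb \<longleftrightarrow> j' = j \<and> aa = bb" for j'
    using block_index_div_mod[OF 0(2)] block_index_div_mod[OF bb]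
    by (metis prod.expand)
  moreover have "dim_row (big_A k N (\<lambda>j _. p j) A) = (k + 1) * N\<^sup>2"
    by (simp add: big_A_def)
  ultimately have "(\<Sum>j'\<le>k. (big_A k N (\<lambda>j _. p j) A ^\<^sub>m 0) $$ (block_index N j aa, block_index N j' bb) * p j') =
      (\<Sum>j'\<le>k. if j' = j then of_bool (aa = bb) * p j' else 0)"
    using block_index_less[OF 0(2) 0(1)] block_index_less[OF bb, of _ k] by (intro sum.cong) auto
  also have "\<dots> = p j * of_bool (aa = bb)" using 0(1) by simp
  finally show ?case by simp
next
  case (Suc t)
  let ?G = "big_A k N (\<lambda>j _. p j) A"
  let ?I = "{..<N} \<times> {..<N}"
  let ?T = "square_kernel k p (\<lambda>j a b. A j $$ (a, b))"
  have G: "?G \<in> carrier_mat ((k + 1) * N\<^sup>2) ((k + 1) * N\<^sup>2)" by (simp add: big_A_def)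
  have Gt: "?G ^\<^sub>m t \<in> carrier_mat ((k + 1) * N\<^sup>2) ((k + 1) * N\<^sup>2)" using G by simp
  have entry: "(?G ^\<^sub>m Suc t) $$ (block_index N j aa, block_index N j' bb) =
      (\<Sum>i\<le>k. \<Sum>cc\<in>?I. ?G $$ (block_index N j aa, block_index N i cc) *
         (?G ^\<^sub>m t) $$ (block_index N i cc, block_index N j' bb))" if "j' \<le> k" for j'
  proof -
    have "(?G ^\<^sub>m Suc t) $$ (block_index N j aa, block_index N j' bb) =
        (\<Sum>r<(k + 1) * N\<^sup>2. ?G $$ (block_index N j aa, r) * (?G ^\<^sub>m t) $$ (r, block_index N j' bb))"
      unfolding pow_mat_Suc_left[OF G]
      using G Gt block_index_less[OF Suc.prems(2,1)] block_index_less[OF bb that]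
      by (auto simp: scalar_prod_def lessThan_atLeast0 intro!: sum.cong)
    then show ?thesis unfolding sum_block_index[OF N] .
  qed
  have "(\<Sum>j'\<le>k. (?G ^\<^sub>m Suc t) $$ (block_index N j aa, block_index N j' bb) * p j') =
      (\<Sum>j'\<le>k. \<Sum>i\<le>k. \<Sum>cc\<in>?I. ?G $$ (block_index N j aa, block_index N i cc) *
         ((?G ^\<^sub>m t) $$ (block_index N i cc, block_index N j' bb) * p j'))"
    by (intro sum.cong refl) (simp add: entry sum_distrib_right mult.assoc del: pow_mat.simps)
  also have "\<dots> = (\<Sum>i\<le>k. \<Sum>cc\<in>?I. \<Sum>j'\<le>k. ?G $$ (block_index N j aa, block_index N i cc) *
         ((?G ^\<^sub>m t) $$ (block_index N i cc, block_index N j' bb) * p j'))"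
    by (subst sum.swap, intro sum.cong refl, subst sum.swap) (rule refl)
  also have "\<dots> = (\<Sum>i\<le>k. \<Sum>cc\<in>?I. ?G $$ (block_index N j aa, block_index N i cc) *
         (p i * kpow ?I ?T t cc bb))"
    using Suc.IH by (intro sum.cong refl) (simp flip: sum_distrib_left)
  \<comment> \<open>Independence of the jumps enters here: every block in row \<open>j\<close>
    carries the same factor \<open>p j\<close>, which comes out of the sum, and the weights
    \<open>p i\<close> left over by the induction hypothesis combine with the products of entries of
    \<open>A i\<close> to \<open>square_kernel\<close>.\<close>
  also have "\<dots> = (\<Sum>i\<le>k. \<Sum>cc\<in>?I. p j * (A i $$ (fst aa, fst cc) * A i $$ (snd aa, snd cc)) *
         (p i * kpow ?I ?T t cc bb))"
    using Suc.prems by (intro sum.cong refl) (simp add: big_A_block_index[OF A])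
  also have "\<dots> = (\<Sum>cc\<in>?I. \<Sum>i\<le>k. p j * (A i $$ (fst aa, fst cc) * A i $$ (snd aa, snd cc)) *
         (p i * kpow ?I ?T t cc bb))"
    by (rule sum.swap)
  also have "\<dots> = p j * kpow ?I ?T (Suc t) aa bb"
    by (simp add: square_kernel_def sum_distrib_left sum_distrib_right mult_ac)
  finally show ?case .
qed

text \<open>Summing \<open>big_A_power\<close> over the row state \<open>j\<close> removes the
  factor \<open>p j\<close>, because the weights add up to 1. An entry of a power of the averaged
  square is thus a finite weighted sum of entries of the same power of the big matrix, obtained
  without dividing by a \<open>p j\<close> that may be zero.\<close>

lemma geometric_decay_square_kernel:
  fixes A :: "nat \<Rightarrow> real mat"
  assumes A: "\<And>j. j \<le> k \<Longrightarrow> A j \<in> carrier_mat N N" and N: "N > 0"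
    and p1: "(\<Sum>j\<le>k. p j) = 1"
    and sr: "spectral_radius (map_mat complex_of_real (big_A k N (\<lambda>j _. p j) A)) < 1"
  shows "geometric_decay ({..<N} \<times> {..<N}) (square_kernel k p (\<lambda>j a b. A j $$ (a, b)))"
proof -
  let ?G = "big_A k N (\<lambda>j _. p j) A"
  let ?n = "(k + 1) * N\<^sup>2"
  have G: "?G \<in> carrier_mat ?n ?n" by (simp add: big_A_def)
  have cG: "map_mat complex_of_real ?G \<in> carrier_mat ?n ?n" using G by simp
  have "?n > 0" using N by simp
  then obtain C r where r: "0 \<le> r" "r < 1" and bound: "\<forall>t. \<forall>i<?n. \<forall>j<?n.
      norm ((map_mat complex_of_real ?G ^\<^sub>m t) $$ (i, j)) \<le> C * r ^ t"
    using spectral_radius_less_1_geometric[OF cG _ sr] by (elim exE conjE meta_impE)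
  have Gt: "\<bar>(?G ^\<^sub>m t) $$ (i, j)\<bar> \<le> C * r ^ t" if "i < ?n" "j < ?n" for t i j
  proof -
    have dims: "dim_row (?G ^\<^sub>m t) = ?n" "dim_col (?G ^\<^sub>m t) = ?n"
      using G by auto
    have "(map_mat complex_of_real ?G ^\<^sub>m t) $$ (i, j) = complex_of_real ((?G ^\<^sub>m t) $$ (i, j))"
      unfolding of_real_hom.mat_hom_pow[OF G, symmetric]
      by (rule index_map_mat(1)) (simp_all only: dims that)
    then show ?thesis using bound[rule_format, OF that, of t] by simp
  qed
  have bound: "\<bar>kpow ({..<N} \<times> {..<N}) (square_kernel k p (\<lambda>j a b. A j $$ (a, b))) t aa bb\<bar> \<le>
      (\<Sum>j\<le>k. \<Sum>j'\<le>k. C * \<bar>p j'\<bar>) * r ^ t"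
    if aa: "aa \<in> {..<N} \<times> {..<N}" and bb: "bb \<in> {..<N} \<times> {..<N}" for t aa bb
  proof -
    let ?K = "kpow ({..<N} \<times> {..<N}) (square_kernel k p (\<lambda>j a b. A j $$ (a, b))) t aa bb"
    have "?K = (\<Sum>j\<le>k. p j * ?K)"
      using p1 by (simp flip: sum_distrib_right)
    also have "\<dots> = (\<Sum>j\<le>k. \<Sum>j'\<le>k. (?G ^\<^sub>m t) $$ (block_index N j aa, block_index N j' bb) * p j')"
      using big_A_power[OF A N _ aa bb, where p = p and t = t] by (intro sum.cong refl) simp
    finally have "\<bar>?K\<bar> \<le> (\<Sum>j\<le>k. \<Sum>j'\<le>k. \<bar>(?G ^\<^sub>m t) $$ (block_index N j aa, block_index N j' bb) * p j'\<bar>)"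
      by (simp only:) (intro order_trans[OF sum_abs] sum_mono order_refl)
    also have "\<dots> \<le> (\<Sum>j\<le>k. \<Sum>j'\<le>k. (C * r ^ t) * \<bar>p j'\<bar>)"
      unfolding abs_mult
      by (intro sum_mono mult_right_mono Gt block_index_less aa bb) auto
    also have "\<dots> = (\<Sum>j\<le>k. \<Sum>j'\<le>k. C * \<bar>p j'\<bar>) * r ^ t"
      by (simp add: sum_distrib_left sum_distrib_right mult_ac)
    finally show ?thesis .
  qed
  show ?thesis
    unfolding geometric_decay_def
    by (rule exI[of _ "\<Sum>j\<le>k. \<Sum>j'\<le>k. C * \<bar>p j'\<bar>"], rule exI[of _ r])
      (intro conjI r allI ballI bound)
qed

section \<open>Square-integrable functions and independence\<close>

definition sq_int :: "'w measure \<Rightarrow> ('w \<Rightarrow> real) \<Rightarrow> bool" where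
  "sq_int M f \<longleftrightarrow> f \<in> borel_measurable M \<and> integrable M (\<lambda>\<omega>. (f \<omega>)\<^sup>2)"

lemma sq_int_cong:
  "(\<And>\<omega>. \<omega> \<in> space M \<Longrightarrow> f \<omega> = g \<omega>) \<Longrightarrow> sq_int M f \<longleftrightarrow> sq_int M g"
  unfolding sq_int_def by (intro conj_cong measurable_cong Bochner_Integration.integrable_cong refl) simp_all

lemma abs_mult_le_squares: "\<bar>u * v\<bar> \<le> u * u + v * v" for u v :: real
proof -
  have "2 * \<bar>u * v\<bar> \<le> u * u + v * v"
    using sum_squares_bound[of "\<bar>u\<bar>" "\<bar>v\<bar>"] by (simp add: abs_mult power2_eq_square)
  then show ?thesis by linarith
qed

lemma sq_int_mult_integrable:
  assumes "sq_int M f" "sq_int M g"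
  shows "integrable M (\<lambda>\<omega>. f \<omega> * g \<omega>)"
proof (rule Bochner_Integration.integrable_bound)
  show "integrable M (\<lambda>\<omega>. (f \<omega>)\<^sup>2 + (g \<omega>)\<^sup>2)"
    using assms by (auto simp: sq_int_def)
  show "(\<lambda>\<omega>. f \<omega> * g \<omega>) \<in> borel_measurable M"
    using assms by (auto simp: sq_int_def)
  show "AE \<omega> in M. norm (f \<omega> * g \<omega>) \<le> norm ((f \<omega>)\<^sup>2 + (g \<omega>)\<^sup>2)"
    using abs_mult_le_squares by (intro AE_I2) (simp add: abs_of_nonneg power2_eq_square)
qed

text \<open>A crude form of Cauchy-Schwarz, good enough for bounding correlations uniformly over
  time.\<close>

lemma abs_integral_mult_le:
  assumes "sq_int M f" "sq_int M g"
  shows "\<bar>LINT \<omega>|M. f \<omega> * g \<omega>\<bar> \<le> (LINT \<omega>|M. f \<omega> * f \<omega>) + (LINT \<omega>|M. g \<omega> * g \<omega>)"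
proof -
  have "\<bar>LINT \<omega>|M. f \<omega> * g \<omega>\<bar> \<le> (LINT \<omega>|M. \<bar>f \<omega> * g \<omega>\<bar>)"
    by (rule integral_abs_bound)
  also have "\<dots> \<le> (LINT \<omega>|M. f \<omega> * f \<omega> + g \<omega> * g \<omega>)"
    using assms by (intro integral_mono abs_mult_le_squares) (auto intro: sq_int_mult_integrable integrable_abs)
  also have "\<dots> = (LINT \<omega>|M. f \<omega> * f \<omega>) + (LINT \<omega>|M. g \<omega> * g \<omega>)"
    using assms by (intro Bochner_Integration.integral_add sq_int_mult_integrable)
  finally show ?thesis .
qed

lemma sq_int_add:
  assumes "sq_int M f" "sq_int M g"
  shows "sq_int M (\<lambda>\<omega>. f \<omega> + g \<omega>)"
proof -
  have "integrable M (\<lambda>\<omega>. (f \<omega>)\<^sup>2 + 2 * (f \<omega> * g \<omega>) + (g \<omega>)\<^sup>2)"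
    using assms sq_int_mult_integrable[OF assms] by (auto simp: sq_int_def)
  moreover have "(f \<omega> + g \<omega>)\<^sup>2 = (f \<omega>)\<^sup>2 + 2 * (f \<omega> * g \<omega>) + (g \<omega>)\<^sup>2" for \<omega>
    by (simp add: power2_sum)
  ultimately show ?thesis
    using assms by (auto simp: sq_int_def)
qed

lemma sq_int_scale: "sq_int M f \<Longrightarrow> sq_int M (\<lambda>\<omega>. c * f \<omega>)"
  by (auto simp: sq_int_def power_mult_distrib)

lemma sq_int_zero: "sq_int M (\<lambda>\<omega>. 0)"
  by (simp add: sq_int_def)

lemma sq_int_sum:
  "(\<And>i. i \<in> I \<Longrightarrow> sq_int M (f i)) \<Longrightarrow> sq_int M (\<lambda>\<omega>. \<Sum>i\<in>I. f i \<omega>)"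
  by (induction I rule: infinite_finite_induct) (auto intro: sq_int_zero sq_int_add)

lemma sq_int_indicator:
  assumes f: "sq_int M f" and C: "C \<in> sets M"
  shows "sq_int M (\<lambda>\<omega>. indicator C \<omega> * f \<omega>)"
proof -
  have "integrable M (\<lambda>\<omega>. indicator C \<omega> * (f \<omega>)\<^sup>2)"
    using f integrable_real_mult_indicator[OF C, of "\<lambda>\<omega>. (f \<omega>)\<^sup>2"]
    by (simp add: sq_int_def mult.commute)
  moreover have "(indicator C \<omega> * f \<omega>)\<^sup>2 = indicator C \<omega> * (f \<omega>)\<^sup>2" for \<omega>
    by (auto simp: indicator_def)
  ultimately show ?thesis
    using f C by (auto simp: sq_int_def)
qed

lemma (in prob_space) sq_int_one: "sq_int M (\<lambda>\<omega>. 1)"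
  by (simp add: sq_int_def)

lemma (in prob_space) sq_int_integrable: "sq_int M f \<Longrightarrow> integrable M f"
  using sq_int_mult_integrable[OF _ sq_int_one, of f] by simp

lemma (in prob_space) covariance_eq:
  assumes "sq_int M U" "sq_int M V"
  shows "covariance M U V = expectation (\<lambda>\<omega>. U \<omega> * V \<omega>) - expectation U * expectation V"
proof -
  have "covariance M U V =
      expectation (\<lambda>\<omega>. U \<omega> * V \<omega> - expectation V * U \<omega> - expectation U * V \<omega> + expectation U * expectation V)"
    unfolding covariance_def by (intro Bochner_Integration.integral_cong refl) (simp add: algebra_simps)
  also have "\<dots> = expectation (\<lambda>\<omega>. U \<omega> * V \<omega>) - expectation U * expectation V"
    using assms by (simp add: sq_int_mult_integrable sq_int_integrable prob_space)
  finally show ?thesis .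
qed

text \<open>Independence passes from intersection-stable families to the sigma-algebras they
  generate. The generators are left open so that they can be the events of a path-valued element as
  well as one single event.\<close>

lemma (in prob_space) indep_var_borelI:
  assumes X: "X \<in> borel_measurable M" and Y: "Y \<in> borel_measurable M"
    and G: "Int_stable G" "{X -` A \<inter> space M | A. A \<in> sets borel} \<subseteq> sigma_sets (space M) G"
    and H: "Int_stable H" "{Y -` B \<inter> space M | B. B \<in> sets borel} \<subseteq> sigma_sets (space M) H"
    and GH: "indep_set G H"
  shows "indep_var borel X borel Y"
proof -
  have "indep_set (sigma_sets (space M) G) (sigma_sets (space M) H)"
    by (rule indep_set_sigma_sets[OF GH G(1) H(1)])
  moreover have "sigma_sets (space M) {X -` A \<inter> space M | A. A \<in> sets borel} \<subseteq> sigma_sets (space M) G"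
    "sigma_sets (space M) {Y -` B \<inter> space M | B. B \<in> sets borel} \<subseteq> sigma_sets (space M) H"
    by (rule sigma_sets_mono[OF G(2)], rule sigma_sets_mono[OF H(2)])
  ultimately have "indep_set (sigma_sets (space M) {X -` A \<inter> space M | A. A \<in> sets borel})
      (sigma_sets (space M) {Y -` B \<inter> space M | B. B \<in> sets borel})"
    unfolding indep_sets2_eq by (meson subset_iff)
  then show ?thesis
    using X Y by (simp add: indep_var_eq)
qed

lemma Int_stable_preimages:
  "Int_stable {X -` A \<inter> space M | A. A \<in> sets S}"
proof (rule Int_stableI)
  fix a b assume "a \<in> {X -` A \<inter> space M | A. A \<in> sets S}" "b \<in> {X -` A \<inter> space M | A. A \<in> sets S}"
  then obtain A B where "a = X -` A \<inter> space M" "A \<in> sets S" "b = X -` B \<inter> space M" "B \<in> sets S"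
    by auto
  then show "a \<inter> b \<in> {X -` A \<inter> space M | A. A \<in> sets S}"
    by (intro CollectI exI[of _ "A \<inter> B"]) auto
qed

lemma preimages_compose_subset:
  assumes Z: "Z \<in> M \<rightarrow>\<^sub>M S" and h: "h \<in> S \<rightarrow>\<^sub>M T"
  shows "{(\<lambda>\<omega>. h (Z \<omega>)) -` A \<inter> space M | A. A \<in> sets T} \<subseteq>
    sigma_sets (space M) {Z -` A \<inter> space M | A. A \<in> sets S}"
proof safe
  fix A assume "A \<in> sets T"
  then have "h -` A \<inter> space S \<in> sets S"
    using h by (rule measurable_sets[rotated])
  moreover have "(\<lambda>\<omega>. h (Z \<omega>)) -` A \<inter> space M = Z -` (h -` A \<inter> space S) \<inter> space M"
    using measurable_space[OF Z] by auto
  ultimately show "(\<lambda>\<omega>. h (Z \<omega>)) -` A \<inter> space M \<in> sigma_sets (space M) {Z -` A \<inter> space M | A. A \<in> sets S}"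
    by (intro sigma_sets.Basic CollectI) blast
qed

lemma (in prob_space) indep_elements_expectation_mult:
  fixes f :: "'b \<Rightarrow> real" and g :: "'c \<Rightarrow> real"
  assumes ind: "indep_elements M S X T Y"
    and f: "f \<in> borel_measurable S" and g: "g \<in> borel_measurable T"
    and int: "integrable M (\<lambda>\<omega>. f (X \<omega>))" "integrable M (\<lambda>\<omega>. g (Y \<omega>))"
  shows "expectation (\<lambda>\<omega>. f (X \<omega>) * g (Y \<omega>)) = expectation (\<lambda>\<omega>. f (X \<omega>)) * expectation (\<lambda>\<omega>. g (Y \<omega>))"
proof -
  have X: "X \<in> M \<rightarrow>\<^sub>M S" and Y: "Y \<in> M \<rightarrow>\<^sub>M T"
    and XY: "indep_set {X -` A \<inter> space M | A. A \<in> sets S} {Y -` B \<inter> space M | B. B \<in> sets T}"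
    using ind unfolding indep_elements_def by auto
  have "indep_var borel (\<lambda>\<omega>. f (X \<omega>)) borel (\<lambda>\<omega>. g (Y \<omega>))"
    by (rule indep_var_borelI[OF _ _ Int_stable_preimages preimages_compose_subset[OF X f] Int_stable_preimages preimages_compose_subset[OF Y g] XY])
      (use X Y f g in measurable)
  from indep_var_lebesgue_integral[OF this int] show ?thesis .
qed

text \<open>The indicator of \<open>C\<close> is measurable for the sigma-algebra generated by
  \<open>{C}\<close>, so the product rule for \<open>C\<close> against the events of
  \<open>U\<close> already makes indicator and \<open>U\<close> independent.\<close>

lemma (in prob_space) expectation_indicator_mult:
  fixes U :: "'a \<Rightarrow> real"
  assumes C: "C \<in> events" and U: "integrable M U"
    and ind: "\<And>B. B \<in> sets borel \<Longrightarrow>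
      prob (C \<inter> (U -` B \<inter> space M)) = prob C * prob (U -` B \<inter> space M)"
  shows "expectation (\<lambda>\<omega>. indicator C \<omega> * U \<omega>) = prob C * expectation U"
proof -
  have Um: "U \<in> borel_measurable M" using U by simp
  have "indep_set {C} {U -` B \<inter> space M | B. B \<in> sets borel}"
    using C Um ind by (intro indep_setI) (auto intro: measurable_sets)
  moreover have "{(indicator C :: _ \<Rightarrow> real) -` A \<inter> space M | A. A \<in> sets borel} \<subseteq> sigma_sets (space M) {C}"
  proof safe
    fix A :: "real set" assume A: "A \<in> sets borel"
    have sp: "C \<subseteq> space M" using C sets.sets_into_space by auto
    then have s: "sets (sigma (space M) {C}) = sigma_sets (space M) {C}" by simp
    have "C \<in> sets (sigma (space M) {C})" unfolding s by auto
    then have "(indicator C :: _ \<Rightarrow> real) \<in> borel_measurable (sigma (space M) {C})"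
      by (rule borel_measurable_indicator)
    from measurable_sets[OF this A] show "(indicator C :: _ \<Rightarrow> real) -` A \<inter> space M \<in> sigma_sets (space M) {C}"
      unfolding s using sp by (simp add: space_measure_of_conv)
  qed
  ultimately have "indep_var borel (indicator C :: _ \<Rightarrow> real) borel U"
    using C Um by (intro indep_var_borelI[where G = "{C}" and H = "{U -` B \<inter> space M | B. B \<in> sets borel}"]
        Int_stable_preimages) (auto simp: Int_stable_def)
  then have "expectation (\<lambda>\<omega>. indicator C \<omega> * U \<omega>) = expectation (indicator C) * expectation U"
    using C U by (intro indep_var_lebesgue_integral) (auto simp: integrable_real_indicator less_top[symmetric])
  then show ?thesis using C by simp
qed

section \<open>Linear systems with independent jumps\<close>

text \<open>The jump process is independent of the \<open>\<sigma>\<close>-algebra \<open>W\<close> generated by initial state and noises.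
  \<open>R s\<close> and \<open>D\<close> are the second moments at lag \<open>s\<close> and the means of the disturbance.\<close>

locale jump_loop = prob_space M for M :: "'w measure" +
  fixes W :: "'w measure" and k N m :: nat and p :: "nat \<Rightarrow> real" and \<xi> :: "nat \<Rightarrow> 'w \<Rightarrow> nat"
    and A B :: "nat \<Rightarrow> nat \<Rightarrow> nat \<Rightarrow> real" and \<beta> :: "nat \<Rightarrow> real"
    and d :: "nat \<Rightarrow> nat \<Rightarrow> 'w \<Rightarrow> real" and q :: "nat \<Rightarrow> nat \<Rightarrow> 'w \<Rightarrow> real"
    and R :: "nat \<Rightarrow> nat \<Rightarrow> nat \<Rightarrow> real" and D \<sigma>2 :: "nat \<Rightarrow> real"
    and x :: "nat \<Rightarrow> nat \<Rightarrow> 'w \<Rightarrow> real"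
  assumes subalg: "subalgebra M W"
    and jump_measurable [measurable]: "\<And>i. \<xi> i \<in> M \<rightarrow>\<^sub>M count_space UNIV"
    and jump_le: "\<And>i \<omega>. \<omega> \<in> space M \<Longrightarrow> \<xi> i \<omega> \<le> k"
    and jump_law: "\<And>i h E. E \<in> sets W \<Longrightarrow> (\<And>t. t < i \<Longrightarrow> h t \<le> k) \<Longrightarrow>
      prob ({\<omega>\<in>space M. \<forall>t<i. \<xi> t \<omega> = h t} \<inter> E) = (\<Prod>t<i. p (h t)) * prob E"
    and init_W: "\<And>a. a < N \<Longrightarrow> x 0 a \<in> borel_measurable W"
    and init_sq_int: "\<And>a. a < N \<Longrightarrow> sq_int M (x 0 a)"
    and dist_W: "\<And>i c. c < m \<Longrightarrow> d i c \<in> borel_measurable W"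
    and dist_sq_int: "\<And>i c. c < m \<Longrightarrow> sq_int M (d i c)"
    and noise_W: "\<And>l i. l \<le> k \<Longrightarrow> q l i \<in> borel_measurable W"
    and noise_sq_int: "\<And>l i. l \<le> k \<Longrightarrow> sq_int M (q l i)"
    and noise_mean: "\<And>l i. l \<le> k \<Longrightarrow> expectation (q l i) = 0"
    and noise_noise: "\<And>l l' i i'. l \<le> k \<Longrightarrow> l' \<le> k \<Longrightarrow> i \<noteq> i' \<Longrightarrow>
      expectation (\<lambda>\<omega>. q l i \<omega> * q l' i' \<omega>) = 0"
    and noise_var: "\<And>l i. l \<le> k \<Longrightarrow> expectation (\<lambda>\<omega>. q l i \<omega> * q l i \<omega>) = \<sigma>2 l"
    and noise_dist: "\<And>l i i' c. l \<le> k \<Longrightarrow> c < m \<Longrightarrow> expectation (\<lambda>\<omega>. q l i \<omega> * d i' c \<omega>) = 0"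
    and noise_init: "\<And>l i a. l \<le> k \<Longrightarrow> a < N \<Longrightarrow> expectation (\<lambda>\<omega>. q l i \<omega> * x 0 a \<omega>) = 0"
    and dist_mean: "\<And>i c. c < m \<Longrightarrow> expectation (d i c) = D c"
    and dist_dist: "\<And>i s c c'. c < m \<Longrightarrow> c' < m \<Longrightarrow>
      expectation (\<lambda>\<omega>. d i c \<omega> * d (i + s) c' \<omega>) = R s c c'"
    and state_step: "\<And>i a \<omega>. \<omega> \<in> space M \<Longrightarrow> a < N \<Longrightarrow>
      x (Suc i) a \<omega> = (\<Sum>b<N. A (\<xi> i \<omega>) a b * x i b \<omega>) + (\<Sum>c<m. B (\<xi> i \<omega>) a c * d i c \<omega>) +
        \<beta> a * q (\<xi> i \<omega>) i \<omega>"
begin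

abbreviation moment :: "('w \<Rightarrow> real) \<Rightarrow> ('w \<Rightarrow> real) \<Rightarrow> real" where
  "moment U V \<equiv> expectation (\<lambda>\<omega>. U \<omega> * V \<omega>)"

text \<open>The paths of the jump process before time \<open>i\<close> are finitely many, so a function depending on
  them and on \<open>W\<close> is a finite combination of \<open>W\<close>-measurable functions.\<close>

definition adapted :: "nat \<Rightarrow> ('w \<Rightarrow> real) \<Rightarrow> bool" where
  "adapted i U \<longleftrightarrow> (\<exists>g. (\<forall>h. g h \<in> borel_measurable W) \<and>
     (\<forall>\<omega>\<in>space M. U \<omega> = g (restrict (\<lambda>t. \<xi> t \<omega>) {..<i}) \<omega>))"

lemma adapted_W: "U \<in> borel_measurable W \<Longrightarrow> adapted i U"
  unfolding adapted_def by (intro exI[of _ "\<lambda>_. U"]) auto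

lemma adapted_mono:
  assumes "adapted i U" "i \<le> i'"
  shows "adapted i' U"
proof -
  obtain g where g: "\<And>h. g h \<in> borel_measurable W"
    "\<And>\<omega>. \<omega> \<in> space M \<Longrightarrow> U \<omega> = g (restrict (\<lambda>t. \<xi> t \<omega>) {..<i}) \<omega>"
    using assms(1) unfolding adapted_def by blast
  have "{..<i} \<inter> {..<i'} = {..<i}" using assms(2) by auto
  then show ?thesis
    unfolding adapted_def using g
    by (intro exI[of _ "\<lambda>h. g (restrict h {..<i})"]) (auto simp: restrict_restrict Int_commute)
qed

lemma adapted_add:
  assumes "adapted i U" "adapted i V"
  shows "adapted i (\<lambda>\<omega>. U \<omega> + V \<omega>)"
proof -
  obtain g where g: "\<And>h. g h \<in> borel_measurable W"
    "\<And>\<omega>. \<omega> \<in> space M \<Longrightarrow> U \<omega> = g (restrict (\<lambda>t. \<xi> t \<omega>) {..<i}) \<omega>"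
    using assms(1) unfolding adapted_def by blast
  obtain g' where g': "\<And>h. g' h \<in> borel_measurable W"
    "\<And>\<omega>. \<omega> \<in> space M \<Longrightarrow> V \<omega> = g' (restrict (\<lambda>t. \<xi> t \<omega>) {..<i}) \<omega>"
    using assms(2) unfolding adapted_def by blast
  show ?thesis
    unfolding adapted_def using g g'
    by (intro exI[of _ "\<lambda>h \<omega>. g h \<omega> + g' h \<omega>"]) auto
qed

lemma adapted_mult:
  assumes "adapted i U" "adapted i V"
  shows "adapted i (\<lambda>\<omega>. U \<omega> * V \<omega>)"
proof -
  obtain g where g: "\<And>h. g h \<in> borel_measurable W"
    "\<And>\<omega>. \<omega> \<in> space M \<Longrightarrow> U \<omega> = g (restrict (\<lambda>t. \<xi> t \<omega>) {..<i}) \<omega>"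
    using assms(1) unfolding adapted_def by blast
  obtain g' where g': "\<And>h. g' h \<in> borel_measurable W"
    "\<And>\<omega>. \<omega> \<in> space M \<Longrightarrow> V \<omega> = g' (restrict (\<lambda>t. \<xi> t \<omega>) {..<i}) \<omega>"
    using assms(2) unfolding adapted_def by blast
  show ?thesis
    unfolding adapted_def using g g'
    by (intro exI[of _ "\<lambda>h \<omega>. g h \<omega> * g' h \<omega>"]) auto
qed

lemma adapted_const: "adapted i (\<lambda>\<omega>. c)"
  by (rule adapted_W) simp

lemma adapted_sum:
  "(\<And>j. j \<in> J \<Longrightarrow> adapted i (U j)) \<Longrightarrow> adapted i (\<lambda>\<omega>. \<Sum>j\<in>J. U j \<omega>)"
  by (induction J rule: infinite_finite_induct) (auto intro: adapted_const adapted_add)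

text \<open>Selecting among the \<open>U j\<close> by the value of \<xi> at time \<open>i\<close>
  adds one coordinate to the path. The default zero keeps the witness measurable for every
  \<open>h\<close>; it is never evaluated, since the jumps are at most \<open>k\<close>.\<close>

lemma adapted_jump:
  assumes U: "\<And>j. j \<le> k \<Longrightarrow> adapted i (U j)"
    and V: "\<And>\<omega>. \<omega> \<in> space M \<Longrightarrow> V \<omega> = U (\<xi> i \<omega>) \<omega>"
  shows "adapted (Suc i) V"
proof -
  have "\<exists>g. (\<forall>h. g h \<in> borel_measurable W) \<and>
     (\<forall>\<omega>\<in>space M. U j \<omega> = g (restrict (\<lambda>t. \<xi> t \<omega>) {..<i}) \<omega>)" if "j \<le> k" for j
    using U[OF that] unfolding adapted_def .
  then obtain g where g: "\<And>j h. j \<le> k \<Longrightarrow> g j h \<in> borel_measurable W"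
    "\<And>j \<omega>. j \<le> k \<Longrightarrow> \<omega> \<in> space M \<Longrightarrow> U j \<omega> = g j (restrict (\<lambda>t. \<xi> t \<omega>) {..<i}) \<omega>"
    by metis
  have "{..<Suc i} \<inter> {..<i} = {..<i}" by auto
  then show ?thesis
    unfolding adapted_def using g jump_le V
    by (intro exI[of _ "\<lambda>h. if h i \<le> k then g (h i) (restrict h {..<i}) else (\<lambda>_. 0)"])
      (auto simp: restrict_restrict)
qed

lemma path_event: "{\<omega>\<in>space M. \<forall>t<i. \<xi> t \<omega> = h t} \<in> events"
  by measurable

text \<open>Split by the finitely many jump paths before time \<open>i\<close>. On each of them
  \<open>U\<close> is a \<open>W\<close>-measurable function, so \<open>jump_law\<close> gives the
  probability of the piece both with and without the extra condition at time \<open>i\<close>, and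
  the two differ by the factor \<open>p j\<close>.\<close>

lemma prob_adapted_jump:
  assumes U: "adapted i U" and j: "j \<le> k" and B: "S \<in> sets borel"
  shows "prob ({\<omega>\<in>space M. \<xi> i \<omega> = j} \<inter> (U -` S \<inter> space M)) = p j * prob (U -` S \<inter> space M)"
proof -
  obtain g where g: "\<And>h. g h \<in> borel_measurable W"
    "\<And>\<omega>. \<omega> \<in> space M \<Longrightarrow> U \<omega> = g (restrict (\<lambda>t. \<xi> t \<omega>) {..<i}) \<omega>"
    using U unfolding adapted_def by blast
  \<comment> \<open>Extensional functions: each sample point belongs to the path of exactly one
    member of \<open>H\<close>, which makes the pieces disjoint.\<close>
  define H where "H = PiE {..<i} (\<lambda>_. {..k})"
  define E where "E h = g h -` S \<inter> space M" for h
  have space_W: "space W = space M" and sets_W: "sets W \<subseteq> events"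
    using subalg by (auto simp: subalgebra_def)
  have E: "E h \<in> sets W" for h
    using measurable_sets[OF g(1) B] unfolding E_def space_W .
  have H: "finite H" "\<And>h t. h \<in> H \<Longrightarrow> t < i \<Longrightarrow> h t \<le> k"
    unfolding H_def by (auto intro!: finite_PiE)
  define path where "path h = {\<omega>\<in>space M. \<forall>t<i. \<xi> t \<omega> = h t}" for h
  have path_of: "restrict (\<lambda>t. \<xi> t \<omega>) {..<i} = h" if "\<omega> \<in> path h" "h \<in> H" for \<omega> h
    using that by (auto simp: path_def H_def PiE_def extensional_def)
  have U_eq: "U -` S \<inter> space M = (\<Union>h\<in>H. path h \<inter> E h)"
  proof (intro equalityI subsetI)
    fix \<omega> assume \<omega>: "\<omega> \<in> U -` S \<inter> space M"
    define h where "h = restrict (\<lambda>t. \<xi> t \<omega>) {..<i}"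
    have "h \<in> H" "\<omega> \<in> path h" "\<omega> \<in> E h"
      using \<omega> jump_le[of \<omega>] g(2)[of \<omega>] by (auto simp: H_def h_def path_def E_def)
    then show "\<omega> \<in> (\<Union>h\<in>H. path h \<inter> E h)" by auto
  next
    fix \<omega> assume "\<omega> \<in> (\<Union>h\<in>H. path h \<inter> E h)"
    then obtain h where h: "h \<in> H" "\<omega> \<in> path h" "\<omega> \<in> E h" by auto
    have "\<omega> \<in> space M" using h(2) by (simp add: path_def)
    then show "\<omega> \<in> U -` S \<inter> space M"
      using g(2)[of \<omega>] path_of[OF h(2,1)] h(3) by (simp add: E_def)
  qed
  have disj: "disjoint_family_on (\<lambda>h. path h \<inter> Z h) H" for Z
    unfolding disjoint_family_on_def using path_of by blast
  have path_ev: "path h \<in> events" for h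
    unfolding path_def by (rule path_event)
  have E_ev: "E h \<in> events" for h
    using E sets_W by blast
  have jump_ev: "{\<omega>\<in>space M. \<xi> i \<omega> = j} \<in> events"
    by measurable
  have "prob (U -` S \<inter> space M) = (\<Sum>h\<in>H. prob (path h \<inter> E h))"
    unfolding U_eq by (rule finite_measure_finite_Union[OF H(1) _ disj]) (use path_ev E_ev in blast)
  also have "\<dots> = (\<Sum>h\<in>H. (\<Prod>t<i. p (h t)) * prob (E h))"
    unfolding path_def by (intro sum.cong refl jump_law E H(2))
  finally have eq1: "prob (U -` S \<inter> space M) = (\<Sum>h\<in>H. (\<Prod>t<i. p (h t)) * prob (E h))" .
  have "{\<omega>\<in>space M. \<xi> i \<omega> = j} \<inter> (U -` S \<inter> space M) =
      (\<Union>h\<in>H. path h \<inter> ({\<omega>\<in>space M. \<xi> i \<omega> = j} \<inter> E h))"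
    unfolding U_eq by auto
  then have "prob ({\<omega>\<in>space M. \<xi> i \<omega> = j} \<inter> (U -` S \<inter> space M)) =
      (\<Sum>h\<in>H. prob (path h \<inter> ({\<omega>\<in>space M. \<xi> i \<omega> = j} \<inter> E h)))"
    by (simp only:) (rule finite_measure_finite_Union[OF H(1) _ disj], use path_ev E_ev jump_ev in blast)
  also have "\<dots> = (\<Sum>h\<in>H. p j * ((\<Prod>t<i. p (h t)) * prob (E h)))"
  proof (intro sum.cong refl)
    fix h assume h: "h \<in> H"
    \<comment> \<open>Overwriting \<open>h\<close> at \<open>i\<close> by \<open>j\<close> gives a
      path of length \<open>Suc i\<close>; \<open>jump_law\<close> applies again and its product
      gains the one factor \<open>p j\<close>.\<close>
    have "path h \<inter> ({\<omega>\<in>space M. \<xi> i \<omega> = j} \<inter> E h) =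
        {\<omega>\<in>space M. \<forall>t<Suc i. \<xi> t \<omega> = (h(i := j)) t} \<inter> E h"
      by (auto simp: path_def less_Suc_eq)
    also have "prob \<dots> = (\<Prod>t<Suc i. p ((h(i := j)) t)) * prob (E h)"
      using H(2)[OF h] j by (intro jump_law E) (auto simp: less_Suc_eq)
    also have "\<dots> = p j * ((\<Prod>t<i. p (h t)) * prob (E h))"
      by simp
    finally show "prob (path h \<inter> ({\<omega>\<in>space M. \<xi> i \<omega> = j} \<inter> E h)) =
        p j * ((\<Prod>t<i. p (h t)) * prob (E h))" .
  qed
  also have "\<dots> = p j * prob (U -` S \<inter> space M)"
    unfolding eq1 by (rule sum_distrib_left[symmetric])
  finally show ?thesis .
qed

lemma jump_event [measurable]: "{\<omega>\<in>space M. \<xi> i \<omega> = j} \<in> events"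
  by measurable

lemma prob_jump: "j \<le> k \<Longrightarrow> prob {\<omega>\<in>space M. \<xi> i \<omega> = j} = p j"
  using prob_adapted_jump[OF adapted_const, of j UNIV i 0] prob_space
  by (simp add: Int_def conj_commute)

lemma jump_sum:
  assumes "\<omega> \<in> space M"
  shows "U (\<xi> i \<omega>) \<omega> = (\<Sum>j\<le>k. indicator {\<omega>\<in>space M. \<xi> i \<omega> = j} \<omega> * (U j \<omega> :: real))"
proof -
  have "(\<Sum>j\<le>k. indicator {\<omega>\<in>space M. \<xi> i \<omega> = j} \<omega> * U j \<omega>) = (\<Sum>j\<le>k. if j = \<xi> i \<omega> then U j \<omega> else 0)"
    using assms by (intro sum.cong refl) (auto simp: indicator_def)
  also have "\<dots> = U (\<xi> i \<omega>) \<omega>"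
    using jump_le[OF assms] by simp
  finally show ?thesis ..
qed

text \<open>The averaging step behind every moment recursion: split \<open>V\<close> by the events
  that the jump is \<open>j\<close>, each of which is independent of the adapted
  \<open>U j\<close>.\<close>

lemma expectation_jump:
  assumes U: "\<And>j. j \<le> k \<Longrightarrow> adapted i (U j)" "\<And>j. j \<le> k \<Longrightarrow> integrable M (U j)"
    and V: "\<And>\<omega>. \<omega> \<in> space M \<Longrightarrow> V \<omega> = U (\<xi> i \<omega>) \<omega>"
  shows "expectation V = (\<Sum>j\<le>k. p j * expectation (U j))"
proof -
  let ?C = "\<lambda>j. {\<omega>\<in>space M. \<xi> i \<omega> = j}"
  have "expectation V = expectation (\<lambda>\<omega>. \<Sum>j\<le>k. indicator (?C j) \<omega> * U j \<omega>)"
    using jump_sum[of _ U i] V by (intro Bochner_Integration.integral_cong refl) simp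
  also have "\<dots> = (\<Sum>j\<le>k. expectation (\<lambda>\<omega>. indicator (?C j) \<omega> * U j \<omega>))"
    using U(2) integrable_real_mult_indicator[OF jump_event]
    by (intro Bochner_Integration.integral_sum) (simp add: mult.commute)
  also have "\<dots> = (\<Sum>j\<le>k. p j * expectation (U j))"
    using U prob_adapted_jump prob_jump
    by (intro sum.cong refl) (simp add: expectation_indicator_mult)
  finally show ?thesis .
qed

lemma sq_int_jump:
  assumes U: "\<And>j. j \<le> k \<Longrightarrow> sq_int M (U j)"
    and V: "\<And>\<omega>. \<omega> \<in> space M \<Longrightarrow> V \<omega> = U (\<xi> i \<omega>) \<omega>"
  shows "sq_int M V"
proof (rule iffD2[OF sq_int_cong])
  show "V \<omega> = (\<Sum>j\<le>k. indicator {\<omega>\<in>space M. \<xi> i \<omega> = j} \<omega> * U j \<omega>)" if "\<omega> \<in> space M" for \<omega>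
    using jump_sum[OF that, of U i] V[OF that] by simp
  show "sq_int M (\<lambda>\<omega>. \<Sum>j\<le>k. indicator {\<omega>\<in>space M. \<xi> i \<omega> = j} \<omega> * U j \<omega>)"
    by (intro sq_int_sum sq_int_indicator U) auto
qed

text \<open>The next state with the jump at time \<open>i\<close> frozen at \<open>j\<close>. It
  depends only on earlier jumps, so the actual jump can be averaged out afterwards.\<close>

definition next_state :: "nat \<Rightarrow> nat \<Rightarrow> nat \<Rightarrow> 'w \<Rightarrow> real" where
  "next_state i j a \<omega> = (\<Sum>b<N. A j a b * x i b \<omega>) + (\<Sum>c<m. B j a c * d i c \<omega>) + \<beta> a * q j i \<omega>"

lemma state_next: "\<omega> \<in> space M \<Longrightarrow> a < N \<Longrightarrow> x (Suc i) a \<omega> = next_state i (\<xi> i \<omega>) a \<omega>"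
  unfolding next_state_def by (rule state_step)

lemma state_sq_int: "a < N \<Longrightarrow> sq_int M (x i a)"
proof (induction i arbitrary: a)
  case 0
  then show ?case by (rule init_sq_int)
next
  case (Suc i)
  have "sq_int M (next_state i j a)" if "j \<le> k" for j
    unfolding next_state_def using that
    by (auto intro!: sq_int_add sq_int_sum sq_int_scale Suc.IH dist_sq_int noise_sq_int)
  then show ?case
    by (rule sq_int_jump) (simp_all add: state_next Suc.prems)
qed

lemma next_state_sq_int: "j \<le> k \<Longrightarrow> sq_int M (next_state i j a)"
  unfolding next_state_def
  by (auto intro!: sq_int_add sq_int_sum sq_int_scale state_sq_int dist_sq_int noise_sq_int)

lemma adapted_scale: "adapted i U \<Longrightarrow> adapted i (\<lambda>\<omega>. c * U \<omega>)"
  by (intro adapted_mult adapted_const)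

lemma dist_adapted: "c < m \<Longrightarrow> adapted i (d i' c)"
  by (intro adapted_W dist_W)

lemma noise_adapted: "l \<le> k \<Longrightarrow> adapted i (q l i')"
  by (intro adapted_W noise_W)

text \<open>The step to time \<open>Suc i\<close> consumes the jump at time \<open>i\<close>, so the
  state at \<open>i\<close> depends on strictly earlier jumps only. This is why it is independent of
  the jump that multiplies it.\<close>

lemma state_adapted: "a < N \<Longrightarrow> adapted i (x i a)"
proof (induction i arbitrary: a)
  case 0
  then show ?case by (intro adapted_W init_W)
next
  case (Suc i)
  have "adapted i (next_state i j a)" if "j \<le> k" for j
    unfolding next_state_def using that
    by (auto intro!: adapted_add adapted_sum adapted_scale Suc.IH dist_adapted noise_adapted)
  then show ?case
    by (rule adapted_jump) (simp_all add: state_next Suc.prems)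
qed

lemma next_state_adapted: "j \<le> k \<Longrightarrow> adapted i (next_state i j a)"
  unfolding next_state_def
  by (auto intro!: adapted_add adapted_sum adapted_scale state_adapted dist_adapted noise_adapted)

lemma moment_commute: "moment U V = moment V U"
  by (simp add: mult.commute)

lemma moment_next_state:
  assumes j: "j \<le> k" and U: "sq_int M U"
  shows "moment (next_state i j a) U = (\<Sum>b<N. A j a b * moment (x i b) U) +
    (\<Sum>c<m. B j a c * moment (d i c) U) + \<beta> a * moment (q j i) U"
proof -
  have x_int: "integrable M (\<lambda>\<omega>. A j a b * (x i b \<omega> * U \<omega>))" if "b \<in> {..<N}" for b
    using that by (intro integrable_mult_right sq_int_mult_integrable state_sq_int U) simp
  have d_int: "integrable M (\<lambda>\<omega>. B j a c * (d i c \<omega> * U \<omega>))" if "c \<in> {..<m}" for c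
    using that by (intro integrable_mult_right sq_int_mult_integrable dist_sq_int U) simp
  have q_int: "integrable M (\<lambda>\<omega>. \<beta> a * (q j i \<omega> * U \<omega>))"
    by (intro integrable_mult_right sq_int_mult_integrable noise_sq_int j U)
  note x_sum = Bochner_Integration.integrable_sum[where I = "{..<N}", OF x_int]
  note d_sum = Bochner_Integration.integrable_sum[where I = "{..<m}", OF d_int]
  have "moment (next_state i j a) U = expectation (\<lambda>\<omega>. (\<Sum>b<N. A j a b * (x i b \<omega> * U \<omega>)) +
      (\<Sum>c<m. B j a c * (d i c \<omega> * U \<omega>)) + \<beta> a * (q j i \<omega> * U \<omega>))"
    unfolding next_state_def by (simp add: distrib_right sum_distrib_right mult.assoc)
  also have "\<dots> = (\<Sum>b<N. A j a b * moment (x i b) U) +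
    (\<Sum>c<m. B j a c * moment (d i c) U) + \<beta> a * moment (q j i) U"
    using Bochner_Integration.integral_add[OF Bochner_Integration.integrable_add[OF x_sum d_sum] q_int]
      Bochner_Integration.integral_add[OF x_sum d_sum]
      Bochner_Integration.integral_sum[where I = "{..<N}", OF x_int]
      Bochner_Integration.integral_sum[where I = "{..<m}", OF d_int]
    by (simp only: integral_mult_right_zero)
  finally show ?thesis .
qed

text \<open>The master identity for first-order recursions. Taking \<open>U\<close> to be the
  constant 1, a disturbance component, an earlier state component or a noise gives the recursions
  for mean, disturbance correlation and lagged moment, and the orthogonality of noise and
  state.\<close>

lemma moment_state_Suc:
  assumes a: "a < N" and U: "sq_int M U" "adapted i U"
  shows "moment (x (Suc i) a) U = (\<Sum>b<N. mean_kernel k p A a b * moment (x i b) U) +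
    (\<Sum>c<m. mean_kernel k p B a c * moment (d i c) U) + \<beta> a * (\<Sum>j\<le>k. p j * moment (q j i) U)"
proof -
  have "moment (x (Suc i) a) U = (\<Sum>j\<le>k. p j * moment (next_state i j a) U)"
    by (rule expectation_jump[where U = "\<lambda>j \<omega>. next_state i j a \<omega> * U \<omega>" and i = i])
      (auto simp: state_next a intro!: adapted_mult next_state_adapted U sq_int_mult_integrable next_state_sq_int)
  also have "\<dots> = (\<Sum>j\<le>k. (\<Sum>b<N. p j * A j a b * moment (x i b) U) +
    (\<Sum>c<m. p j * B j a c * moment (d i c) U) + \<beta> a * (p j * moment (q j i) U))"
    by (intro sum.cong refl) (simp only: atMost_iff moment_next_state U(1) distrib_left
        sum_distrib_left mult.assoc mult.left_commute[of _ "\<beta> a"])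
  also have "\<dots> = (\<Sum>b<N. mean_kernel k p A a b * moment (x i b) U) +
    (\<Sum>c<m. mean_kernel k p B a c * moment (d i c) U) + \<beta> a * (\<Sum>j\<le>k. p j * moment (q j i) U)"
    unfolding sum.distrib mean_kernel_def sum_distrib_right sum_distrib_left[of "\<beta> a"]
    by (simp only: sum.swap[of _ "{..k}"])
  finally show ?thesis .
qed

text \<open>The state at \<open>i\<close> is driven by the initial state, the disturbance and the
  noises before \<open>i\<close>, and noise at a time \<open>i'\<close> with
  \<open>i \<le> i'\<close> is uncorrelated with all three; whiteness covers the last because the
  times differ.\<close>

lemma noise_state: "l \<le> k \<Longrightarrow> a < N \<Longrightarrow> i \<le> i' \<Longrightarrow> moment (x i a) (q l i') = 0"
proof (induction i arbitrary: a)
  case 0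
  then show ?case using noise_init[of l a i'] by (simp add: mult.commute)
next
  case (Suc i)
  have "moment (x (Suc i) a) (q l i') = (\<Sum>b<N. mean_kernel k p A a b * moment (x i b) (q l i')) +
    (\<Sum>c<m. mean_kernel k p B a c * moment (d i c) (q l i')) +
    \<beta> a * (\<Sum>j\<le>k. p j * moment (q j i) (q l i'))"
    using Suc.prems by (intro moment_state_Suc noise_sq_int adapted_W noise_W)
  moreover have "moment (d i c) (q l i') = 0" if "c < m" for c
    using noise_dist[OF Suc.prems(1) that, of i' i] by (simp add: mult.commute)
  ultimately show ?case
    using Suc.prems Suc.IH noise_noise[OF _ Suc.prems(1), of _ i i'] by simp
qed

lemma mean_Suc:
  assumes "a < N"
  shows "expectation (x (Suc i) a) = (\<Sum>b<N. mean_kernel k p A a b * expectation (x i b)) +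
    (\<Sum>c<m. mean_kernel k p B a c * D c)"
  using moment_state_Suc[OF assms sq_int_one adapted_const, of i] by (simp add: noise_mean dist_mean)

text \<open>The disturbance stays at time \<open>Suc i + l\<close> while the state goes back to
  \<open>i\<close>, so the right-hand side has lag \<open>Suc l\<close>. All lags must therefore be
  treated together.\<close>

lemma state_dist_Suc:
  assumes "a < N" "c' < m"
  shows "moment (x (Suc i) a) (d (Suc i + l) c') =
    (\<Sum>b<N. mean_kernel k p A a b * moment (x i b) (d (i + Suc l) c')) +
    (\<Sum>c<m. mean_kernel k p B a c * R (Suc l) c c')"
  using moment_state_Suc[OF assms(1) dist_sq_int[OF assms(2)] adapted_W[OF dist_W[OF assms(2)]],
      of i "Suc i + l"] dist_dist[OF _ assms(2), of _ i "Suc l"]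
  by (simp add: noise_dist assms(2))

lemma state_state_Suc:
  assumes "a < N" "a' < N" "i' \<le> i"
  shows "moment (x (Suc i) a) (x i' a') =
    (\<Sum>b<N. mean_kernel k p A a b * moment (x i b) (x i' a')) +
    (\<Sum>c<m. mean_kernel k p B a c * moment (x i' a') (d i c))"
  using moment_state_Suc[OF assms(1) state_sq_int[OF assms(2)] adapted_mono[OF state_adapted[OF assms(2)] assms(3)]]
    noise_state[OF _ assms(2,3)]
  by (simp add: mult.commute)

text \<open>Both factors are multiplied by the same jump, so the products of entries are averaged
  jointly, which produces \<open>square_kernel\<close> and not a product of means. Mixed terms with
  the noise vanish; the noise itself contributes its variance averaged over the number of received
  descriptions.\<close>

lemma second_moment_Suc:
  assumes "a < N" "a' < N"
  shows "moment (x (Suc i) a) (x (Suc i) a') =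
    (\<Sum>(b, b')\<in>{..<N} \<times> {..<N}. square_kernel k p A (a, a') (b, b') * moment (x i b) (x i b')) +
    ((\<Sum>b<N. \<Sum>c<m. (\<Sum>j\<le>k. p j * (A j a b * B j a' c)) * moment (x i b) (d i c)) +
     (\<Sum>b<N. \<Sum>c<m. (\<Sum>j\<le>k. p j * (A j a' b * B j a c)) * moment (x i b) (d i c)) +
     (\<Sum>c<m. \<Sum>c'<m. (\<Sum>j\<le>k. p j * (B j a c * B j a' c')) * R 0 c c') +
     \<beta> a * \<beta> a' * (\<Sum>j\<le>k. p j * \<sigma>2 j))"
proof -
  have dd: "moment (d i c) (d i c') = R 0 c c'" if "c < m" "c' < m" for c c'
    using dist_dist[OF that, of i 0] by simp
  have xq: "moment (x i b) (q j i) = 0" "moment (q j i) (x i b) = 0" if "b < N" "j \<le> k" for b j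
    using noise_state[OF that(2,1), of i i] by (simp_all add: mult.commute)
  have dq: "moment (d i c) (q j i) = 0" "moment (q j i) (d i c) = 0" if "c < m" "j \<le> k" for c j
    using noise_dist[OF that(2,1), of i i] by (simp_all add: mult.commute)
  have next_x: "moment (next_state i j a') (x i b) = (\<Sum>b'<N. A j a' b' * moment (x i b) (x i b')) +
      (\<Sum>c<m. B j a' c * moment (x i b) (d i c))" if "b < N" "j \<le> k" for b j
    using moment_next_state[OF that(2) state_sq_int[OF that(1)], of i a' i] xq[OF that]
    by (simp add: mult.commute)
  have next_d: "moment (next_state i j a') (d i c) = (\<Sum>b<N. A j a' b * moment (x i b) (d i c)) +
      (\<Sum>c'<m. B j a' c' * R 0 c c')" if "c < m" "j \<le> k" for c j
    using moment_next_state[OF that(2) dist_sq_int[OF that(1)], of i a' i] dq[OF that] dd[OF that(1)]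
    by (simp add: mult.commute)
  have next_q: "moment (next_state i j a') (q j i) = \<beta> a' * \<sigma>2 j" if "j \<le> k" for j
    using moment_next_state[OF that noise_sq_int[OF that], of i a' i] xq dq noise_var that by simp
  have "moment (x (Suc i) a) (x (Suc i) a') = (\<Sum>j\<le>k. p j * moment (next_state i j a) (next_state i j a'))"
    by (rule expectation_jump[where U = "\<lambda>j \<omega>. next_state i j a \<omega> * next_state i j a' \<omega>" and i = i])
      (auto simp: state_next assms intro!: adapted_mult next_state_adapted sq_int_mult_integrable next_state_sq_int)
  also have "\<dots> = (\<Sum>j\<le>k. p j * (
      (\<Sum>b<N. A j a b * ((\<Sum>b'<N. A j a' b' * moment (x i b) (x i b')) +
         (\<Sum>c<m. B j a' c * moment (x i b) (d i c)))) +
      (\<Sum>c<m. B j a c * ((\<Sum>b<N. A j a' b * moment (x i b) (d i c)) + (\<Sum>c'<m. B j a' c' * R 0 c c'))) +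
      \<beta> a * (\<beta> a' * \<sigma>2 j)))"
  proof (intro sum.cong refl)
    fix j assume "j \<in> {..k}"
    then have j: "j \<le> k" by simp
    have "moment (next_state i j a) (next_state i j a') =
        (\<Sum>b<N. A j a b * moment (next_state i j a') (x i b)) +
        (\<Sum>c<m. B j a c * moment (next_state i j a') (d i c)) + \<beta> a * moment (next_state i j a') (q j i)"
      using moment_next_state[OF j next_state_sq_int[OF j], of i a i a'] by (simp only: moment_commute[of "next_state i j a'"])
    then show "p j * moment (next_state i j a) (next_state i j a') = p j * (
      (\<Sum>b<N. A j a b * ((\<Sum>b'<N. A j a' b' * moment (x i b) (x i b')) +
         (\<Sum>c<m. B j a' c * moment (x i b) (d i c)))) +
      (\<Sum>c<m. B j a c * ((\<Sum>b<N. A j a' b * moment (x i b) (d i c)) + (\<Sum>c'<m. B j a' c' * R 0 c c'))) +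
      \<beta> a * (\<beta> a' * \<sigma>2 j))"
      using j by (simp add: next_x next_d next_q)
  qed
  also have "\<dots> =
    (\<Sum>j\<le>k. \<Sum>b<N. \<Sum>b'<N. p j * (A j a b * A j a' b') * moment (x i b) (x i b')) +
    ((\<Sum>j\<le>k. \<Sum>b<N. \<Sum>c<m. p j * (A j a b * B j a' c) * moment (x i b) (d i c)) +
     (\<Sum>j\<le>k. \<Sum>c<m. \<Sum>b<N. p j * (A j a' b * B j a c) * moment (x i b) (d i c)) +
     (\<Sum>j\<le>k. \<Sum>c<m. \<Sum>c'<m. p j * (B j a c * B j a' c') * R 0 c c') +
     (\<Sum>j\<le>k. \<beta> a * \<beta> a' * (p j * \<sigma>2 j)))"
    by (simp add: distrib_left sum.distrib sum_distrib_left mult_ac)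
  \<comment> \<open>Moving the average over \<open>j\<close> innermost isolates coefficients that do
    not change with time; in the second mixed term the sums over \<open>c\<close> and
    \<open>b\<close> are exchanged as well.\<close>
  also have "\<dots> =
    (\<Sum>b<N. \<Sum>b'<N. \<Sum>j\<le>k. p j * (A j a b * A j a' b') * moment (x i b) (x i b')) +
    ((\<Sum>b<N. \<Sum>c<m. \<Sum>j\<le>k. p j * (A j a b * B j a' c) * moment (x i b) (d i c)) +
     (\<Sum>b<N. \<Sum>c<m. \<Sum>j\<le>k. p j * (A j a' b * B j a c) * moment (x i b) (d i c)) +
     (\<Sum>c<m. \<Sum>c'<m. \<Sum>j\<le>k. p j * (B j a c * B j a' c') * R 0 c c') +
     (\<Sum>j\<le>k. \<beta> a * \<beta> a' * (p j * \<sigma>2 j)))"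
    by (simp only: sum.swap[of _ "{..k}"] sum.swap[of _ "{..<m}" "{..<N}"])
  also have "\<dots> = (\<Sum>(b, b')\<in>{..<N} \<times> {..<N}. square_kernel k p A (a, a') (b, b') * moment (x i b) (x i b')) +
    ((\<Sum>b<N. \<Sum>c<m. (\<Sum>j\<le>k. p j * (A j a b * B j a' c)) * moment (x i b) (d i c)) +
     (\<Sum>b<N. \<Sum>c<m. (\<Sum>j\<le>k. p j * (A j a' b * B j a c)) * moment (x i b) (d i c)) +
     (\<Sum>c<m. \<Sum>c'<m. (\<Sum>j\<le>k. p j * (B j a c * B j a' c')) * R 0 c c') +
     \<beta> a * \<beta> a' * (\<Sum>j\<le>k. p j * \<sigma>2 j))"
    by (simp only: square_kernel_def fst_conv snd_conv sum_distrib_right sum_distrib_left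
        flip: sum.cartesian_product)
  finally show ?thesis .
qed

end

section \<open>Convergence of the moments, jointly for all trajectories\<close>

lemma (in jump_loop) correlation_bound:
  assumes "c < m" "c' < m"
  shows "\<bar>R s c c'\<bar> \<le> R 0 c c + R 0 c' c'"
  using abs_integral_mult_le[OF dist_sq_int[OF assms(1)] dist_sq_int[OF assms(2)], of 0 s]
    dist_dist[OF assms, of 0 s] dist_dist[OF assms(1,1), of 0 0] dist_dist[OF assms(2,2), of s 0]
  by simp

lemma (in jump_loop) init_dist_bound:
  assumes "a < N" "c < m"
  shows "\<bar>moment (x 0 a) (d i c)\<bar> \<le> moment (x 0 a) (x 0 a) + R 0 c c"
  using abs_integral_mult_le[OF init_sq_int[OF assms(1)] dist_sq_int[OF assms(2)], of i]
    dist_dist[OF assms(2,2), of i 0]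
  by simp

text \<open>The trajectories share jumps, noises, disturbance and their moments. Only
  \<open>x\<close> and \<open>W\<close> vary with \<open>s\<close>, the latter because the initial
  state is among its generators.\<close>

context
  fixes S :: "'s set" and M :: "'w measure" and W :: "'s \<Rightarrow> 'w measure" and k N m :: nat
    and p :: "nat \<Rightarrow> real" and \<xi> :: "nat \<Rightarrow> 'w \<Rightarrow> nat" and A B :: "nat \<Rightarrow> nat \<Rightarrow> nat \<Rightarrow> real"
    and \<beta> :: "nat \<Rightarrow> real" and d q :: "nat \<Rightarrow> nat \<Rightarrow> 'w \<Rightarrow> real"
    and R :: "nat \<Rightarrow> nat \<Rightarrow> nat \<Rightarrow> real" and D \<sigma>2 :: "nat \<Rightarrow> real"
    and x :: "'s \<Rightarrow> nat \<Rightarrow> nat \<Rightarrow> 'w \<Rightarrow> real"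
  assumes loop: "\<And>s. s \<in> S \<Longrightarrow> jump_loop M (W s) k N m p \<xi> A B \<beta> d q R D \<sigma>2 (x s)"
    and p: "\<And>j. j \<le> k \<Longrightarrow> 0 \<le> p j" and p1: "(\<Sum>j\<le>k. p j) = 1"
    and decay: "geometric_decay ({..<N} \<times> {..<N}) (square_kernel k p A)"
begin

lemmas mean_decay = geometric_decay_mean_kernel[OF p p1 decay]

lemma common_limit_mean:
  assumes "a < N"
  shows "common_limit S (\<lambda>s i. LINT \<omega>|M. x s i a \<omega>)"
proof (rule common_limit_recursion_simple[where u = "\<lambda>s i a. LINT \<omega>|M. x s i a \<omega>", OF _ mean_decay])
  show "(LINT \<omega>|M. x s (Suc i) a \<omega>) = (\<Sum>b<N. mean_kernel k p A a b * (LINT \<omega>|M. x s i b \<omega>)) +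
    (\<Sum>c<m. mean_kernel k p B a c * D c)" if "s \<in> S" "a \<in> {..<N}" for s i a
    using jump_loop.mean_Suc[OF loop[OF that(1)], of a i] that(2) by simp
qed (use assms in \<open>auto intro: common_limit_const\<close>)

text \<open>The sources are correlations of the disturbance with itself; by stationarity they do not
  depend on \<open>i\<close>, so their convergence is trivial and the work lies in bounds uniform in
  the lag.\<close>

lemma common_limit_state_dist:
  assumes a: "a < N" and c': "c' < m"
  shows "common_limit S (\<lambda>s i. LINT \<omega>|M. x s i a \<omega> * d (i + l) c' \<omega>)"
proof (rule common_limit_recursion[where u = "\<lambda>s i a l. LINT \<omega>|M. x s i a \<omega> * d (i + l) c' \<omega>"
      and c = "\<lambda>s i a l. \<Sum>c<m. mean_kernel k p B a c * R (Suc l) c c'", OF _ mean_decay])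
  show "(LINT \<omega>|M. x s (Suc i) a \<omega> * d (Suc i + l) c' \<omega>) =
      (\<Sum>b<N. mean_kernel k p A a b * (LINT \<omega>|M. x s i b \<omega> * d (i + Suc l) c' \<omega>)) +
      (\<Sum>c<m. mean_kernel k p B a c * R (Suc l) c c')" if "s \<in> S" "a \<in> {..<N}" for s i a l
    using jump_loop.state_dist_Suc[OF loop[OF that(1)] _ c', of a i l] that(2) by simp
  show "common_limit S (\<lambda>s i. \<Sum>c<m. mean_kernel k p B a c * R (Suc l) c c')" for a l
    by (rule common_limit_const)
  fix s assume s: "s \<in> S"
  \<comment> \<open>Stationarity bounds a correlation at any lag by second moments at lag 0, whence
    a bound free of \<open>l\<close>. Summing over the rows makes it free of \<open>a\<close>; all
    summands are nonnegative.\<close>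
  define K where "K = (\<Sum>a<N. \<Sum>c<m. \<bar>mean_kernel k p B a c\<bar> * (R 0 c c + R 0 c' c'))"
  have pos: "0 \<le> R 0 c c" if "c < m" for c
    using jump_loop.correlation_bound[OF loop[OF s] that that, of 0] by simp
  have "\<bar>\<Sum>c<m. mean_kernel k p B a c * R (Suc l) c c'\<bar> \<le> K" if "a \<in> {..<N}" for a l
  proof -
    have "\<bar>\<Sum>c<m. mean_kernel k p B a c * R (Suc l) c c'\<bar> \<le>
        (\<Sum>c<m. \<bar>mean_kernel k p B a c\<bar> * \<bar>R (Suc l) c c'\<bar>)"
      by (rule order_trans[OF sum_abs]) (simp add: abs_mult)
    also have "\<dots> \<le> (\<Sum>c<m. \<bar>mean_kernel k p B a c\<bar> * (R 0 c c + R 0 c' c'))"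
      by (intro sum_mono mult_left_mono jump_loop.correlation_bound[OF loop[OF s] _ c']) auto
    also have "\<dots> \<le> K"
      unfolding K_def using that pos c'
      by (intro member_le_sum[where f = "\<lambda>a. \<Sum>c<m. \<bar>mean_kernel k p B a c\<bar> * (R 0 c c + R 0 c' c')"])
        (auto intro!: sum_nonneg mult_nonneg_nonneg add_nonneg_nonneg)
    finally show ?thesis .
  qed
  then show "\<exists>K. \<forall>i. \<forall>a\<in>{..<N}. \<forall>l. \<bar>\<Sum>c<m. mean_kernel k p B a c * R (Suc l) c c'\<bar> \<le> K"
    by blast
  define K' where "K' = (\<Sum>a<N. (LINT \<omega>|M. x s 0 a \<omega> * x s 0 a \<omega>) + R 0 c' c')"
  have "\<bar>LINT \<omega>|M. x s 0 a \<omega> * d (0 + l) c' \<omega>\<bar> \<le> K'" if "a \<in> {..<N}" for a l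
  proof -
    have "\<bar>LINT \<omega>|M. x s 0 a \<omega> * d (0 + l) c' \<omega>\<bar> \<le> (LINT \<omega>|M. x s 0 a \<omega> * x s 0 a \<omega>) + R 0 c' c'"
      using jump_loop.init_dist_bound[OF loop[OF s] _ c', of a l] that by simp
    also have "\<dots> \<le> K'"
      unfolding K'_def using that pos[OF c']
      by (intro member_le_sum[where f = "\<lambda>a. (LINT \<omega>|M. x s 0 a \<omega> * x s 0 a \<omega>) + R 0 c' c'"])
        (auto intro!: add_nonneg_nonneg Bochner_Integration.integral_nonneg)
    finally show ?thesis .
  qed
  then show "\<exists>K. \<forall>a\<in>{..<N}. \<forall>l. \<bar>LINT \<omega>|M. x s 0 a \<omega> * d (0 + l) c' \<omega>\<bar> \<le> K"
    by blast
qed (use a in auto)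

text \<open>The forcing term contains the disturbance correlation at lag 0, whose convergence is
  already available; everything else in it is constant in time.\<close>

lemma common_limit_second_moment:
  assumes "a < N" "a' < N"
  shows "common_limit S (\<lambda>s i. LINT \<omega>|M. x s i a \<omega> * x s i a' \<omega>)"
proof -
  have "common_limit S (\<lambda>s i. LINT \<omega>|M. x s i (fst (a, a')) \<omega> * x s i (snd (a, a')) \<omega>)"
  proof (rule common_limit_recursion_simple[where
        u = "\<lambda>s i aa. LINT \<omega>|M. x s i (fst aa) \<omega> * x s i (snd aa) \<omega>" and a = "(a, a')" and
        c = "\<lambda>s i aa.
        (\<Sum>b<N. \<Sum>c<m. (\<Sum>j\<le>k. p j * (A j (fst aa) b * B j (snd aa) c)) * (LINT \<omega>|M. x s i b \<omega> * d i c \<omega>)) +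
        (\<Sum>b<N. \<Sum>c<m. (\<Sum>j\<le>k. p j * (A j (snd aa) b * B j (fst aa) c)) * (LINT \<omega>|M. x s i b \<omega> * d i c \<omega>)) +
        (\<Sum>c<m. \<Sum>c'<m. (\<Sum>j\<le>k. p j * (B j (fst aa) c * B j (snd aa) c')) * R 0 c c') +
        \<beta> (fst aa) * \<beta> (snd aa) * (\<Sum>j\<le>k. p j * \<sigma>2 j)", OF _ decay])
    show "(LINT \<omega>|M. x s (Suc i) (fst aa) \<omega> * x s (Suc i) (snd aa) \<omega>) =
        (\<Sum>bb\<in>{..<N} \<times> {..<N}. square_kernel k p A aa bb * (LINT \<omega>|M. x s i (fst bb) \<omega> * x s i (snd bb) \<omega>)) +
        ((\<Sum>b<N. \<Sum>c<m. (\<Sum>j\<le>k. p j * (A j (fst aa) b * B j (snd aa) c)) * (LINT \<omega>|M. x s i b \<omega> * d i c \<omega>)) +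
        (\<Sum>b<N. \<Sum>c<m. (\<Sum>j\<le>k. p j * (A j (snd aa) b * B j (fst aa) c)) * (LINT \<omega>|M. x s i b \<omega> * d i c \<omega>)) +
        (\<Sum>c<m. \<Sum>c'<m. (\<Sum>j\<le>k. p j * (B j (fst aa) c * B j (snd aa) c')) * R 0 c c') +
        \<beta> (fst aa) * \<beta> (snd aa) * (\<Sum>j\<le>k. p j * \<sigma>2 j))"
      if "s \<in> S" "aa \<in> {..<N} \<times> {..<N}" for s i aa
      using jump_loop.second_moment_Suc[OF loop[OF that(1)], of "fst aa" "snd aa" i] that(2)
      by (simp add: split_def mem_Times_iff)
    show "common_limit S (\<lambda>s i.
        (\<Sum>b<N. \<Sum>c<m. (\<Sum>j\<le>k. p j * (A j (fst aa) b * B j (snd aa) c)) * (LINT \<omega>|M. x s i b \<omega> * d i c \<omega>)) +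
        (\<Sum>b<N. \<Sum>c<m. (\<Sum>j\<le>k. p j * (A j (snd aa) b * B j (fst aa) c)) * (LINT \<omega>|M. x s i b \<omega> * d i c \<omega>)) +
        (\<Sum>c<m. \<Sum>c'<m. (\<Sum>j\<le>k. p j * (B j (fst aa) c * B j (snd aa) c')) * R 0 c c') +
        \<beta> (fst aa) * \<beta> (snd aa) * (\<Sum>j\<le>k. p j * \<sigma>2 j))" for aa
      by (intro common_limit_add common_limit_sum common_limit_scale common_limit_const
          common_limit_state_dist[where l = 0, simplified]) auto
  qed (use assms in auto)
  then show ?thesis by simp
qed

text \<open>Raising the lag by one expresses the moment as a finite combination of moments known to
  converge, so an induction on \<open>h\<close> replaces a recursion in time.\<close>

lemma common_limit_lagged_moment:
  assumes "a < N" "a' < N"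
  shows "common_limit S (\<lambda>s i. LINT \<omega>|M. x s (i + h) a \<omega> * x s i a' \<omega>)"
  using assms(1)
proof (induction h arbitrary: a)
  case 0
  then show ?case using common_limit_second_moment[OF _ assms(2)] by simp
next
  case (Suc h)
  have "common_limit S (\<lambda>s i. (\<Sum>b<N. mean_kernel k p A a b * (LINT \<omega>|M. x s (i + h) b \<omega> * x s i a' \<omega>)) +
      (\<Sum>c<m. mean_kernel k p B a c * (LINT \<omega>|M. x s i a' \<omega> * d (i + h) c \<omega>)))"
    by (intro common_limit_add common_limit_sum common_limit_scale Suc.IH
        common_limit_state_dist assms(2)) auto
  then show ?case
  proof (rule common_limit_cong)
    fix s i assume "s \<in> S"
    from jump_loop.state_state_Suc[OF loop[OF this] Suc.prems assms(2), of i "i + h"]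
    show "(LINT \<omega>|M. x s (i + Suc h) a \<omega> * x s i a' \<omega>) =
      (\<Sum>b<N. mean_kernel k p A a b * (LINT \<omega>|M. x s (i + h) b \<omega> * x s i a' \<omega>)) +
      (\<Sum>c<m. mean_kernel k p B a c * (LINT \<omega>|M. x s i a' \<omega> * d (i + h) c \<omega>))"
      by simp
  qed
qed

lemma common_limit_covariance_nat:
  assumes "a < N" "a' < N"
  shows "common_limit S (\<lambda>s i. covariance M (x s (i + h) a) (x s i a'))"
proof -
  have "common_limit S (\<lambda>s i. (LINT \<omega>|M. x s (i + h) a \<omega> * x s i a' \<omega>) -
      (LINT \<omega>|M. x s (i + h) a \<omega>) * (LINT \<omega>|M. x s i a' \<omega>))"
    by (intro common_limit_diff common_limit_mult common_limit_lagged_moment assms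
        common_limit_mean common_limit_shift[where f = "\<lambda>s i. LINT \<omega>|M. x s i a \<omega>"])
  then show ?thesis
  proof (rule common_limit_cong)
    fix s i assume s: "s \<in> S"
    interpret jump_loop M "W s" k N m p \<xi> A B \<beta> d q R D \<sigma>2 "x s"
      by (rule loop[OF s])
    show "covariance M (x s (i + h) a) (x s i a') = (LINT \<omega>|M. x s (i + h) a \<omega> * x s i a' \<omega>) -
      (LINT \<omega>|M. x s (i + h) a \<omega>) * (LINT \<omega>|M. x s i a' \<omega>)"
      by (rule covariance_eq[OF state_sq_int[OF assms(1)] state_sq_int[OF assms(2)]])
  qed
qed

lemma common_limit_covariance:
  fixes \<tau> :: int
  assumes "a < N" "a' < N"
  shows "common_limit S (\<lambda>s i. covariance M (x s (nat (int i + \<tau>)) a) (x s i a'))"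
proof (cases "\<tau> \<ge> 0")
  case True
  then have "nat (int i + \<tau>) = i + nat \<tau>" for i by simp
  then show ?thesis using common_limit_covariance_nat[OF assms] by simp
next
  case False
  \<comment> \<open>After a time shift by \<open>nat (- \<tau>)\<close> the truncation disappears,
    and a negative lag becomes the opposite one with the two components exchanged.\<close>
  then have "nat (int (i + nat (- \<tau>)) + \<tau>) = i" for i by simp
  then have "covariance M (x s (nat (int (i + nat (- \<tau>)) + \<tau>)) a) (x s (i + nat (- \<tau>)) a') =
      covariance M (x s (i + nat (- \<tau>)) a') (x s i a)" for s i
    unfolding covariance_def by (simp only: mult.commute)
  then show ?thesis
    by (rule common_limit_unshift[where h = "nat (- \<tau>)",
          OF common_limit_cong[OF common_limit_covariance_nat[OF assms(2,1), of "nat (- \<tau>)"]]])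
qed

end

section \<open>The packet losses\<close>

lemma (in prob_space) iid_losses_measurable:
  assumes "iid_losses M k pl rcv" "l < k"
  shows "{\<omega>\<in>space M. rcv i l \<omega>} \<in> events"
proof -
  have "(\<lambda>(i, l). rcv i l) (i, l) \<in> M \<rightarrow>\<^sub>M count_space UNIV"
    using assms unfolding iid_losses_def indep_vars_def by blast
  then have "rcv i l \<in> M \<rightarrow>\<^sub>M count_space UNIV" by simp
  then show ?thesis by measurable
qed

lemma num_received_le: "num_received k rcv i \<omega> \<le> k"
  unfolding num_received_def using card_mono[of "{..<k}" "{l. l < k \<and> rcv i l \<omega>}"] by auto

text \<open>Partition by the set of descriptions that arrive: every set of size \<open>j\<close> has
  the same product probability, and the binomial coefficient counts these sets.\<close>

lemma (in prob_space) prob_num_received: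
  assumes loss: "iid_losses M k pl rcv" and k: "k \<ge> 1"
  shows "prob {\<omega>\<in>space M. num_received k rcv i \<omega> = j} = prob_received k pl j"
proof -
  let ?ev = "\<lambda>S. {\<omega>\<in>space M. \<forall>l<k. rcv i l \<omega> \<longleftrightarrow> l \<in> S}"
  define F where "F = {S. S \<subseteq> {..<k} \<and> card S = j}"
  have F: "finite F" unfolding F_def by (rule finite_subset[of _ "Pow {..<k}"]) auto
  have ind: "indep_vars (\<lambda>_. count_space UNIV) (\<lambda>(i, l). rcv i l) (UNIV \<times> {..<k})"
    and pl: "\<And>i l. l < k \<Longrightarrow> prob {\<omega>\<in>space M. \<not> rcv i l \<omega>} = pl"
    using loss unfolding iid_losses_def by auto
  note meas = iid_losses_measurable[OF loss]
  have pr: "prob {\<omega>\<in>space M. rcv i l \<omega>} = 1 - pl" if "l < k" for l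
  proof -
    have "space M - {\<omega>\<in>space M. rcv i l \<omega>} = {\<omega>\<in>space M. \<not> rcv i l \<omega>}" by auto
    with prob_compl[OF meas[OF that, of i]] pl[OF that, of i] show ?thesis by simp
  qed
  \<comment> \<open>At least one description keeps the intersection nonempty, so that it forces the
    sample point into \<open>space M\<close>.\<close>
  have ev_eq: "?ev S = (\<Inter>l\<in>{..<k}. {\<omega>\<in>space M. rcv i l \<omega> \<longleftrightarrow> l \<in> S})" for S
  proof (rule Set.set_eqI)
    fix \<omega>
    show "\<omega> \<in> ?ev S \<longleftrightarrow> \<omega> \<in> (\<Inter>l\<in>{..<k}. {\<omega>\<in>space M. rcv i l \<omega> \<longleftrightarrow> l \<in> S})"
      unfolding INT_iff mem_Collect_eq using k by (cases "\<omega> \<in> space M") (auto intro: exI[of _ 0])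
  qed
  have prob_ev: "prob (?ev S) = (1 - pl) ^ j * pl ^ (k - j)" if S: "S \<in> F" for S
  proof -
    have "(\<Inter>x\<in>{i} \<times> {..<k}. (\<lambda>(i, l). rcv i l) x -` {snd x \<in> S} \<inter> space M) =
        (\<Inter>l\<in>{..<k}. rcv i l -` {l \<in> S} \<inter> space M)"
      by (simp only: set_eq_iff INT_iff) auto
    moreover have "rcv i l -` {l \<in> S} \<inter> space M = {\<omega>\<in>space M. rcv i l \<omega> \<longleftrightarrow> l \<in> S}" for l
      by auto
    ultimately have "?ev S = (\<Inter>x\<in>{i} \<times> {..<k}. (\<lambda>(i, l). rcv i l) x -` {snd x \<in> S} \<inter> space M)"
      unfolding ev_eq by simp
    also have "prob \<dots> = (\<Prod>x\<in>{i} \<times> {..<k}. prob ((\<lambda>(i, l). rcv i l) x -` {snd x \<in> S} \<inter> space M))"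
      using k by (intro indep_varsD[OF ind]) (auto simp: lessThan_empty_iff)
    also have "\<dots> = (\<Prod>l<k. prob (rcv i l -` {l \<in> S} \<inter> space M))"
      by (rule prod.reindex_bij_witness[where i = "\<lambda>l. (i, l)" and j = snd]) auto
    also have "\<dots> = (\<Prod>l<k. if l \<in> S then 1 - pl else pl)"
    proof (intro prod.cong refl)
      fix l assume l: "l \<in> {..<k}"
      have "rcv i l -` {l \<in> S} \<inter> space M =
          (if l \<in> S then {\<omega>\<in>space M. rcv i l \<omega>} else {\<omega>\<in>space M. \<not> rcv i l \<omega>})"
        by auto
      then show "prob (rcv i l -` {l \<in> S} \<inter> space M) = (if l \<in> S then 1 - pl else pl)"
        using pr[of l] pl[of l i] l by simp
    qed
    also have "\<dots> = (1 - pl) ^ card ({..<k} \<inter> S) * pl ^ card ({..<k} \<inter> - S)"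
      by (simp add: prod.If_cases)
    also have "{..<k} \<inter> S = S" using S by (auto simp: F_def)
    also have "{..<k} \<inter> - S = {..<k} - S" by auto
    also have "card ({..<k} - S) = k - j"
      using S by (auto simp: F_def card_Diff_subset finite_subset)
    finally show ?thesis using S by (simp add: F_def)
  qed
  have ev: "?ev S \<in> events" for S
  proof -
    have "(\<Inter>l\<in>{..<k}. {\<omega>\<in>space M. rcv i l \<omega> \<longleftrightarrow> l \<in> S}) \<in> events"
    proof (intro sets.finite_INT)
      fix l assume l: "l \<in> {..<k}"
      have "{\<omega>\<in>space M. rcv i l \<omega> \<longleftrightarrow> l \<in> S} =
        (if l \<in> S then {\<omega>\<in>space M. rcv i l \<omega>} else space M - {\<omega>\<in>space M. rcv i l \<omega>})"
        by auto
      then show "{\<omega>\<in>space M. rcv i l \<omega> \<longleftrightarrow> l \<in> S} \<in> events"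
        using meas[of l i] l by auto
    qed (use k in \<open>auto simp: lessThan_empty_iff\<close>)
    then show ?thesis unfolding ev_eq .
  qed
  have "{\<omega>\<in>space M. num_received k rcv i \<omega> = j} = (\<Union>S\<in>F. ?ev S)"
  proof (intro equalityI subsetI)
    fix \<omega> assume "\<omega> \<in> {\<omega>\<in>space M. num_received k rcv i \<omega> = j}"
    then show "\<omega> \<in> (\<Union>S\<in>F. ?ev S)"
      by (intro UN_I[of "{l. l < k \<and> rcv i l \<omega>}"]) (auto simp: F_def num_received_def)
  next
    fix \<omega> assume "\<omega> \<in> (\<Union>S\<in>F. ?ev S)"
    then obtain S where S: "S \<in> F" "\<omega> \<in> space M" "\<forall>l<k. rcv i l \<omega> \<longleftrightarrow> l \<in> S" by auto
    then have "{l. l < k \<and> rcv i l \<omega>} = S" by (auto simp: F_def)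
    then show "\<omega> \<in> {\<omega>\<in>space M. num_received k rcv i \<omega> = j}"
      using S by (simp add: F_def num_received_def)
  qed
  moreover have "prob (\<Union>S\<in>F. ?ev S) = (\<Sum>S\<in>F. prob (?ev S))"
  proof (rule finite_measure_finite_Union[OF F])
    show "?ev ` F \<subseteq> events" by (rule image_subsetI) (rule ev)
    show "disjoint_family_on ?ev F"
      unfolding disjoint_family_on_def
    proof (intro ballI impI equals0I)
      fix S S' \<omega> assume SS': "S \<in> F" "S' \<in> F" "S \<noteq> S'" "\<omega> \<in> ?ev S \<inter> ?ev S'"
      have path: "T = {l. l < k \<and> rcv i l \<omega>}" if "T \<in> F" "\<omega> \<in> ?ev T" for T
        using that by (auto simp: F_def)
      have "S = S'"
        by (rule trans[OF path[OF SS'(1) IntD1[OF SS'(4)]] path[OF SS'(2) IntD2[OF SS'(4)], symmetric]])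
      with SS'(3) show False by contradiction
    qed
  qed
  moreover have "(\<Sum>S\<in>F. prob (?ev S)) = real (card F) * ((1 - pl) ^ j * pl ^ (k - j))"
    by (simp add: prob_ev)
  moreover have "card F = k choose j"
    unfolding F_def using n_subsets[of "{..<k}" j] by simp
  ultimately show ?thesis
    by (simp add: prob_received_def mult.assoc)
qed

text \<open>The count as a function of the loss pattern. \<open>I\<close> is a single time for
  independence between times, and all times for independence from the exogenous signals.\<close>

lemma num_received_path_measurable:
  fixes k :: nat
  assumes "i \<in> I"
  shows "(\<lambda>f. card {l. l < k \<and> f (i, l)}) \<in> PiM (I \<times> {..<k}) (\<lambda>_. count_space UNIV) \<rightarrow>\<^sub>M count_space UNIV"
proof (rule measurable_card)
  fix l
  show "{f \<in> space (PiM (I \<times> {..<k}) (\<lambda>_. count_space UNIV)). l \<in> {l. l < k \<and> f (i, l)}}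
      \<in> sets (PiM (I \<times> {..<k}) (\<lambda>_. count_space UNIV))"
  proof (cases "l < k")
    case True
    then have "(\<lambda>f. f (i, l)) \<in> PiM (I \<times> {..<k}) (\<lambda>_. count_space UNIV) \<rightarrow>\<^sub>M count_space (UNIV :: bool set)"
      using assms by (intro measurable_component_singleton) auto
    then show ?thesis using True by simp
  qed simp
qed

text \<open>Losses at different times form disjoint blocks of independent variables, and each count
  is a function of its own block.\<close>

lemma (in prob_space) num_received_indep:
  assumes loss: "iid_losses M k pl rcv"
  shows "indep_vars (\<lambda>_. count_space UNIV) (num_received k rcv) UNIV"
proof -
  have ind: "indep_vars (\<lambda>_. count_space UNIV) (\<lambda>(i, l). rcv i l) (UNIV \<times> {..<k})"
    using loss unfolding iid_losses_def by simp
  have "indep_vars (\<lambda>i. PiM ({i} \<times> {..<k}) (\<lambda>_. count_space UNIV))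
      (\<lambda>i \<omega>. restrict (\<lambda>x. (\<lambda>(i, l). rcv i l) x \<omega>) ({i} \<times> {..<k})) UNIV"
    by (rule indep_vars_restrict[OF ind]) (auto simp: disjoint_family_on_def)
  from indep_vars_compose2[OF this num_received_path_measurable[of _ "{_}"]]
  have "indep_vars (\<lambda>_. count_space UNIV)
      (\<lambda>i \<omega>. card {l. l < k \<and> restrict (\<lambda>x. (\<lambda>(i, l). rcv i l) x \<omega>) ({i} \<times> {..<k}) (i, l)}) UNIV"
    by simp
  moreover have "card {l. l < k \<and> restrict (\<lambda>x. (\<lambda>(i, l). rcv i l) x \<omega>) ({i} \<times> {..<k}) (i, l)} =
      num_received k rcv i \<omega>" for i \<omega>
    unfolding num_received_def by (intro arg_cong[where f = card]) auto
  ultimately show ?thesis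
    by (simp add: fun_eq_iff[symmetric])
qed

lemma (in prob_space) prob_num_received_path:
  assumes loss: "iid_losses M k pl rcv" and k: "k \<ge> 1"
  shows "prob {\<omega>\<in>space M. \<forall>t<i. num_received k rcv t \<omega> = h t} = (\<Prod>t<i. prob_received k pl (h t))"
proof (cases "i = 0")
  case True
  then show ?thesis by (simp add: prob_space)
next
  case False
  have "{\<omega>\<in>space M. \<forall>t<i. num_received k rcv t \<omega> = h t} =
      (\<Inter>t\<in>{..<i}. num_received k rcv t -` {h t} \<inter> space M)"
    using False by auto
  also have "prob \<dots> = (\<Prod>t<i. prob (num_received k rcv t -` {h t} \<inter> space M))"
    using False by (intro indep_varsD[OF num_received_indep[OF loss]]) auto
  also have "\<dots> = (\<Prod>t<i. prob_received k pl (h t))"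
    using prob_num_received[OF assms] by (intro prod.cong refl) (simp add: vimage_def Int_def conj_commute)
  finally show ?thesis .
qed

lemma (in prob_space) num_received_measurable:
  assumes "iid_losses M k pl rcv"
  shows "num_received k rcv i \<in> M \<rightarrow>\<^sub>M count_space UNIV"
  using num_received_indep[OF assms] unfolding indep_vars_def by simp

lemma (in prob_space) markov_chain_num_received:
  assumes loss: "iid_losses M k pl rcv" and k: "k \<ge> 1"
  shows "markov_chain M k (trans_prob k pl) (num_received k rcv)"
  unfolding markov_chain_def
proof (intro conjI allI impI)
  fix i
  show "num_received k rcv i \<in> M \<rightarrow>\<^sub>M count_space {0..k}"
    using num_received_measurable[OF loss, of i] num_received_le[of k rcv i]
    by (auto simp: measurable_def)
next
  fix i j :: nat and h :: "nat \<Rightarrow> nat"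
  \<comment> \<open>Both sides are path probabilities, of lengths \<open>i + 2\<close> and
    \<open>i + 1\<close>, and the products differ by the last factor only.\<close>
  have "{\<omega>\<in>space M. (\<forall>t\<le>i. num_received k rcv t \<omega> = h t) \<and> num_received k rcv (Suc i) \<omega> = j} =
      {\<omega>\<in>space M. \<forall>t<Suc (Suc i). num_received k rcv t \<omega> = (h(Suc i := j)) t}"
    by (auto simp: less_Suc_eq_le le_Suc_eq)
  moreover have "{\<omega>\<in>space M. \<forall>t\<le>i. num_received k rcv t \<omega> = h t} =
      {\<omega>\<in>space M. \<forall>t<Suc i. num_received k rcv t \<omega> = h t}"
    by (auto simp: less_Suc_eq_le)
  ultimately show "prob {\<omega>\<in>space M. (\<forall>t\<le>i. num_received k rcv t \<omega> = h t) \<and> num_received k rcv (Suc i) \<omega> = j} =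
      trans_prob k pl j (h i) * prob {\<omega>\<in>space M. \<forall>t\<le>i. num_received k rcv t \<omega> = h t}"
    unfolding trans_prob_def by (simp only: prob_num_received_path[OF assms]) simp
qed

lemma prob_received_nonneg: "0 \<le> pl \<Longrightarrow> pl \<le> 1 \<Longrightarrow> 0 \<le> prob_received k pl j"
  by (simp add: prob_received_def)

lemma sum_prob_received: "(\<Sum>j\<le>k. prob_received k pl j) = 1"
  using binomial_ring[of "1 - pl" pl k] by (simp add: prob_received_def)

section \<open>Disturbance and noises\<close>

lemma (in prob_space) normal_rv_sq_int:
  assumes "normal_rv M X"
  shows "sq_int M X"
proof -
  have X: "X \<in> borel_measurable M" using assms by (simp add: normal_rv_def)
  from assms obtain \<mu> \<sigma> where
    "(\<sigma> > 0 \<and> distributed M lborel X (normal_density \<mu> \<sigma>)) \<or> (AE \<omega> in M. X \<omega> = \<mu>)"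
    unfolding normal_rv_def by auto
  then show ?thesis
  proof
    assume *: "\<sigma> > 0 \<and> distributed M lborel X (normal_density \<mu> \<sigma>)"
    \<comment> \<open>The normal density yields the moment centred at \<open>\<mu>\<close>; adding
      the constant back preserves square integrability.\<close>
    have "integrable lborel (\<lambda>x. normal_density \<mu> \<sigma> x * (x - \<mu>)\<^sup>2)"
      using * by (intro integrable_normal_moment) simp
    then have "integrable M (\<lambda>\<omega>. (X \<omega> - \<mu>)\<^sup>2)"
      using distributed_integrable[of M lborel X "normal_density \<mu> \<sigma>" "\<lambda>x. (x - \<mu>)\<^sup>2"] * by simp
    then have "sq_int M (\<lambda>\<omega>. X \<omega> - \<mu>)"
      using X by (simp add: sq_int_def)
    from sq_int_add[OF this sq_int_scale[OF sq_int_one, of \<mu>]] show ?thesis by simp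
  next
    assume *: "AE \<omega> in M. X \<omega> = \<mu>"
    have "integrable M (\<lambda>\<omega>. (X \<omega>)\<^sup>2) \<longleftrightarrow> integrable M (\<lambda>\<omega>. \<mu>\<^sup>2)"
      using X * by (intro integrable_cong_AE) auto
    then show ?thesis using X by (simp add: sq_int_def)
  qed
qed

lemma (in prob_space) stationary_gaussian_sq_int:
  assumes "stationary_gaussian M m d" "c < m"
  shows "sq_int M (\<lambda>\<omega>. d i \<omega> $ c)"
proof -
  have "normal_rv M (\<lambda>\<omega>. \<Sum>x\<in>{(i, c)}. 1 * (case x of (i, a) \<Rightarrow> \<lambda>\<omega>. d i \<omega> $ a) \<omega>)"
    using assms unfolding stationary_gaussian_def gaussian_family_def
    by (elim conjE allE[of _ "{(i, c)}"] allE[of _ "\<lambda>_. 1"]) auto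
  then have "normal_rv M (\<lambda>\<omega>. d i \<omega> $ c)" by simp
  then show ?thesis by (rule normal_rv_sq_int)
qed

lemma path_measurable:
  assumes "\<And>i. i \<in> I \<Longrightarrow> Z i \<in> borel_measurable M"
  shows "path I Z \<in> M \<rightarrow>\<^sub>M path_space I"
  unfolding path_def[abs_def] path_space_def using assms by (rule measurable_restrict)

lemma path_space_component:
  "i \<in> I \<Longrightarrow> (\<lambda>f. f i) \<in> borel_measurable (path_space I)"
  unfolding path_space_def by (rule measurable_component_singleton)

text \<open>Both expectations are integrals of coordinate functions against the law of the whole
  path, and that law is invariant under time shifts.\<close>

lemma (in prob_space) stationary_gaussian_shift:
  assumes d: "stationary_gaussian M m d" and c: "c < m" "c' < m"
  shows "expectation (\<lambda>\<omega>. d i \<omega> $ c) = expectation (\<lambda>\<omega>. d 0 \<omega> $ c)"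
    "expectation (\<lambda>\<omega>. d i \<omega> $ c * d (i + s) \<omega> $ c') = expectation (\<lambda>\<omega>. d 0 \<omega> $ c * d s \<omega> $ c')"
proof -
  let ?P = "path_space (UNIV \<times> {..<m})"
  have meas: "vec_path m (\<lambda>j. d (j + i)) \<in> M \<rightarrow>\<^sub>M ?P" for i
    unfolding vec_path_def using stationary_gaussian_sq_int[OF d]
    by (intro path_measurable) (auto simp: sq_int_def)
  have eq: "distr M ?P (vec_path m (\<lambda>j. d (j + i))) = distr M ?P (vec_path m d)"
    using d unfolding stationary_gaussian_def by blast
  have shift: "expectation (\<lambda>\<omega>. f (vec_path m (\<lambda>j. d (j + i)) \<omega>)) = expectation (\<lambda>\<omega>. f (vec_path m d \<omega>))"
    if "f \<in> borel_measurable ?P" for f :: "_ \<Rightarrow> real"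
    using integral_distr[OF meas[of i] that] integral_distr[OF meas[of 0] that] eq by simp
  have comp: "vec_path m e \<omega> (j, b) = e j \<omega> $ b" if "b < m" for e \<omega> j b
    using that by (simp add: vec_path_def path_def)
  have "(\<lambda>f. f (0, c)) \<in> borel_measurable ?P"
    using c by (intro path_space_component) auto
  from shift[OF this] show "expectation (\<lambda>\<omega>. d i \<omega> $ c) = expectation (\<lambda>\<omega>. d 0 \<omega> $ c)"
    using c by (simp add: comp)
  have "(\<lambda>f. f (0, c) * f (s, c')) \<in> borel_measurable ?P"
    using c by (intro borel_measurable_times path_space_component) auto
  from shift[OF this]
  show "expectation (\<lambda>\<omega>. d i \<omega> $ c * d (i + s) \<omega> $ c') = expectation (\<lambda>\<omega>. d 0 \<omega> $ c * d s \<omega> $ c')"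
    using c by (simp add: comp add.commute)
qed

section \<open>The closed loop as a jump system\<close>

lemma smult_mat_mult_vec:
  fixes A :: "real mat"
  assumes "A \<in> carrier_mat nr nc" "v \<in> carrier_vec nc"
  shows "(c \<cdot>\<^sub>m A) *\<^sub>v v = c \<cdot>\<^sub>v (A *\<^sub>v v)"
  using assms by (intro eq_vecI) (auto simp: scalar_prod_def sum_distrib_left mult.assoc)

lemma zero_mat_mult_vec:
  fixes v :: "real vec"
  assumes "v \<in> carrier_vec nc"
  shows "0\<^sub>m nr nc *\<^sub>v v = 0\<^sub>v nr"
  using assms by (intro eq_vecI) (auto simp: scalar_prod_def)

lemma single_col_mult_vec:
  fixes B :: "real mat"
  assumes "B \<in> carrier_mat n 1" "u \<in> carrier_vec 1" "i < n"
  shows "(B *\<^sub>v u) $ i = B $$ (i, 0) * u $ 0"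
  using assms by (simp add: scalar_prod_def)

lemma append_vec_assoc: "u @\<^sub>v v @\<^sub>v w = (u @\<^sub>v v) @\<^sub>v w"
  by (intro eq_vecI) auto

lemma scal_carrier [simp]: "scal s \<in> carrier_vec 1"
  by (simp add: scal_def)

lemma append_vec_add4:
  fixes a1 :: "real vec"
  assumes "a1 \<in> carrier_vec n1" "b1 \<in> carrier_vec n1" "a2 \<in> carrier_vec n2" "b2 \<in> carrier_vec n2"
    "a3 \<in> carrier_vec n3" "b3 \<in> carrier_vec n3" "a4 \<in> carrier_vec n4" "b4 \<in> carrier_vec n4"
  shows "((a1 @\<^sub>v a2) @\<^sub>v (a3 @\<^sub>v a4)) + ((b1 @\<^sub>v b2) @\<^sub>v (b3 @\<^sub>v b4)) =
    ((a1 + b1) @\<^sub>v (a2 + b2)) @\<^sub>v ((a3 + b3) @\<^sub>v (a4 + b4))"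
  using assms by (simp add: append_vec_add[of _ "n1 + n2" _ _ "n3 + n4"]
      append_vec_add[of _ n1 _ _ n2] append_vec_add[of _ n3 _ _ n4])

lemma four_block_nested_mult_vec:
  fixes A11 :: "real mat"
  assumes A: "A11 \<in> carrier_mat m1 n1" "A12 \<in> carrier_mat m1 n2" "A13 \<in> carrier_mat m1 n3" "A14 \<in> carrier_mat m1 n4"
    "A21 \<in> carrier_mat m2 n1" "A22 \<in> carrier_mat m2 n2" "A23 \<in> carrier_mat m2 n3" "A24 \<in> carrier_mat m2 n4"
    "A31 \<in> carrier_mat m3 n1" "A32 \<in> carrier_mat m3 n2" "A33 \<in> carrier_mat m3 n3" "A34 \<in> carrier_mat m3 n4"
    "A41 \<in> carrier_mat m4 n1" "A42 \<in> carrier_mat m4 n2" "A43 \<in> carrier_mat m4 n3" "A44 \<in> carrier_mat m4 n4"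
    and v: "v1 \<in> carrier_vec n1" "v2 \<in> carrier_vec n2" "v3 \<in> carrier_vec n3" "v4 \<in> carrier_vec n4"
  shows "four_block_mat (four_block_mat A11 A12 A21 A22) (four_block_mat A13 A14 A23 A24)
      (four_block_mat A31 A32 A41 A42) (four_block_mat A33 A34 A43 A44) *\<^sub>v ((v1 @\<^sub>v v2) @\<^sub>v (v3 @\<^sub>v v4)) =
    ((A11 *\<^sub>v v1 + A12 *\<^sub>v v2 + (A13 *\<^sub>v v3 + A14 *\<^sub>v v4)) @\<^sub>v
      (A21 *\<^sub>v v1 + A22 *\<^sub>v v2 + (A23 *\<^sub>v v3 + A24 *\<^sub>v v4))) @\<^sub>v
    ((A31 *\<^sub>v v1 + A32 *\<^sub>v v2 + (A33 *\<^sub>v v3 + A34 *\<^sub>v v4)) @\<^sub>v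
      (A41 *\<^sub>v v1 + A42 *\<^sub>v v2 + (A43 *\<^sub>v v3 + A44 *\<^sub>v v4)))"
proof -
  note block = four_block_mat_mult_vec[OF A(1,2,5,6) v(1,2)] four_block_mat_mult_vec[OF A(3,4,7,8) v(3,4)]
    four_block_mat_mult_vec[OF A(9,10,13,14) v(1,2)] four_block_mat_mult_vec[OF A(11,12,15,16) v(3,4)]
  note car = four_block_carrier_mat[OF A(1,6), of A12 A21] four_block_carrier_mat[OF A(3,8), of A14 A23]
    four_block_carrier_mat[OF A(9,14), of A32 A41] four_block_carrier_mat[OF A(11,16), of A34 A43]
  note vcar = append_carrier_vec[OF v(1,2)] append_carrier_vec[OF v(3,4)]
  note sum_car =
    add_carrier_vec[OF mult_mat_vec_carrier[OF A(1) v(1)] mult_mat_vec_carrier[OF A(2) v(2)]]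
    add_carrier_vec[OF mult_mat_vec_carrier[OF A(3) v(3)] mult_mat_vec_carrier[OF A(4) v(4)]]
    add_carrier_vec[OF mult_mat_vec_carrier[OF A(5) v(1)] mult_mat_vec_carrier[OF A(6) v(2)]]
    add_carrier_vec[OF mult_mat_vec_carrier[OF A(7) v(3)] mult_mat_vec_carrier[OF A(8) v(4)]]
    add_carrier_vec[OF mult_mat_vec_carrier[OF A(9) v(1)] mult_mat_vec_carrier[OF A(10) v(2)]]
    add_carrier_vec[OF mult_mat_vec_carrier[OF A(11) v(3)] mult_mat_vec_carrier[OF A(12) v(4)]]
    add_carrier_vec[OF mult_mat_vec_carrier[OF A(13) v(1)] mult_mat_vec_carrier[OF A(14) v(2)]]
    add_carrier_vec[OF mult_mat_vec_carrier[OF A(15) v(3)] mult_mat_vec_carrier[OF A(16) v(4)]]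
  show ?thesis
    unfolding four_block_mat_mult_vec[OF car vcar] block
    unfolding append_vec_add[OF sum_car(1,2) sum_car(3,4)] append_vec_add[OF sum_car(5,6) sum_car(7,8)] ..
qed

text \<open>The column of the noise block of \<open>B_jump\<close> selected by \<open>jumpJ\<close>:
  the jump decides which column is nonzero, but its entries are always these. The last row feeds the
  stored quantizer output.\<close>

definition noise_gain :: "nat \<Rightarrow> nat \<Rightarrow> nat \<Rightarrow> plant \<Rightarrow> real \<Rightarrow> nat \<Rightarrow> real" where
  "noise_gain n ny nw P F a =
     (if a < n then F * pl_B2 P $$ (a, 0) else if a < n + ny + nw then 0 else 1)"

context
  fixes n m ny nw k :: nat and P :: plant and F :: real and Ry Rw :: realization
  assumes P: "plant_dims n m P"
    and Ry: "rz_A Ry \<in> carrier_mat ny ny" "rz_B Ry \<in> carrier_mat ny 1"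
      "rz_C Ry \<in> carrier_mat 1 ny" "rz_D Ry \<in> carrier_mat 1 1"
    and Rw: "rz_A Rw \<in> carrier_mat nw nw" "rz_B Rw \<in> carrier_mat nw 1"
      "rz_C Rw \<in> carrier_mat 1 nw" "rz_D Rw \<in> carrier_mat 1 1"
begin

lemma plant_carrier: "pl_A P \<in> carrier_mat n n" "pl_B1 P \<in> carrier_mat n m" "pl_B2 P \<in> carrier_mat n 1"
  "pl_C2 P \<in> carrier_mat 1 n" "pl_D21 P \<in> carrier_mat 1 m"
  using P unfolding plant_dims_def by auto

lemmas carriers = plant_carrier Ry Rw

lemmas dims = carriers[THEN carrier_matD(1)] carriers[THEN carrier_matD(2)]

lemma Sigma_carrier: "Sigma_mat P F \<xi> \<in> carrier_mat n 1"
  using carriers by (simp add: Sigma_mat_def)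

lemma jumpJ_carrier: "mat_of_row (jumpJ k \<xi>) \<in> carrier_mat 1 (k + 1)"
  by (simp add: jumpJ_def mat_of_row_def)

lemma A_jump_carrier: "A_jump n ny nw P F Ry Rw \<xi> \<in> carrier_mat (n + ny + nw + 1) (n + ny + nw + 1)"
proof -
  have "A_jump n ny nw P F Ry Rw \<xi> \<in> carrier_mat ((n + ny) + (nw + 1)) ((n + ny) + (nw + 1))"
    unfolding A_jump_def Let_def using carriers Sigma_carrier
    by (intro four_block_carrier_mat) (auto intro!: add_carrier_mat mult_carrier_mat)
  then show ?thesis by (simp add: add.assoc)
qed

lemma B_jump_carrier: "B_jump m ny nw k P F Ry \<xi> \<in> carrier_mat (n + ny + nw + 1) (m + (k + 1))"
proof -
  have "B_jump m ny nw k P F Ry \<xi> \<in> carrier_mat ((n + ny) + (nw + 1)) (m + (k + 1))"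
    unfolding B_jump_def Let_def using carriers Sigma_carrier jumpJ_carrier[of \<xi>]
    by (intro carrier_append_rows four_block_carrier_mat)
      (auto intro!: add_carrier_mat mult_carrier_mat)
  then show ?thesis by (simp add: add.assoc)
qed

lemma B_jump_noise_entry:
  assumes a: "a < n + ny + nw + 1" and l: "l \<le> k"
  shows "B_jump m ny nw k P F Ry \<xi> $$ (a, m + l) = (if l = \<xi> then noise_gain n ny nw P F a else 0)"
proof -
  let ?JT = "mat_of_row (jumpJ k \<xi>)"
  have JT: "?JT $$ (0, l) = (if l = \<xi> then 1 else 0)"
    using l by (auto simp: jumpJ_def mat_of_row_def unit_vec_def)
  have BJ: "(F \<cdot>\<^sub>m (pl_B2 P * ?JT)) $$ (a, l) = (if l = \<xi> then F * pl_B2 P $$ (a, 0) else 0)" if "a < n"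
    using that l JT carrier_matD[OF jumpJ_carrier[of \<xi>]] by (simp add: dims scalar_prod_def)
  show ?thesis
    using a l JT BJ carrier_matD[OF Sigma_carrier[of \<xi>]] carrier_matD[OF jumpJ_carrier[of \<xi>]]
    by (auto simp: B_jump_def Let_def append_rows_def noise_gain_def dims)
qed

text \<open>One deterministic time step: the block rows of the jump matrices are the loop equations
  with \<open>y\<close> and \<open>w\<close> eliminated, whereas the right-hand side keeps both as
  abbreviations. The identity is checked block by block.\<close>

lemma jump_matrices_mult_vec:
  assumes x: "x \<in> carrier_vec n" and xy: "xy \<in> carrier_vec ny" and xw: "xw \<in> carrier_vec nw"
    and s: "s \<in> carrier_vec 1" and dd: "dd \<in> carrier_vec m" and qb: "qb \<in> carrier_vec (k + 1)"
    and y: "y = pl_C2 P *\<^sub>v x + pl_D21 P *\<^sub>v dd"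
    and w: "w = jumpM \<xi> \<cdot>\<^sub>v ((rz_C Ry *\<^sub>v xy + rz_D Ry *\<^sub>v y) + (rz_C Rw *\<^sub>v xw + rz_D Rw *\<^sub>v s)) +
      mat_of_row (jumpJ k \<xi>) *\<^sub>v qb"
  shows "A_jump n ny nw P F Ry Rw \<xi> *\<^sub>v (x @\<^sub>v xy @\<^sub>v xw @\<^sub>v s) + B_jump m ny nw k P F Ry \<xi> *\<^sub>v (dd @\<^sub>v qb) =
    (pl_A P *\<^sub>v x + pl_B1 P *\<^sub>v dd + F \<cdot>\<^sub>v (pl_B2 P *\<^sub>v w)) @\<^sub>v
    (rz_A Ry *\<^sub>v xy + rz_B Ry *\<^sub>v y) @\<^sub>v (rz_A Rw *\<^sub>v xw + rz_B Rw *\<^sub>v s) @\<^sub>v w"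
proof -
  let ?S = "Sigma_mat P F \<xi>" and ?c = "jumpM \<xi>" and ?JT = "mat_of_row (jumpJ k \<xi>)"
  note S = Sigma_carrier[of \<xi>] and JT = jumpJ_carrier[of \<xi>]
  have y_car: "y \<in> carrier_vec 1" and w_car: "w \<in> carrier_vec 1"
    using carriers x dd xy xw s qb JT by (auto simp: y w)
  let ?A1 = "(pl_A P + ?S * rz_D Ry * pl_C2 P) *\<^sub>v x + (?S * rz_C Ry) *\<^sub>v xy +
      ((?S * rz_C Rw) *\<^sub>v xw + (?S * rz_D Rw) *\<^sub>v s)"
  let ?A2 = "(rz_B Ry * pl_C2 P) *\<^sub>v x + rz_A Ry *\<^sub>v xy + (0\<^sub>m ny nw *\<^sub>v xw + 0\<^sub>m ny 1 *\<^sub>v s)"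
  let ?A3 = "0\<^sub>m nw n *\<^sub>v x + 0\<^sub>m nw ny *\<^sub>v xy + (rz_A Rw *\<^sub>v xw + rz_B Rw *\<^sub>v s)"
  let ?A4 = "(?c \<cdot>\<^sub>m (rz_D Ry * pl_C2 P)) *\<^sub>v x + (?c \<cdot>\<^sub>m rz_C Ry) *\<^sub>v xy +
      ((?c \<cdot>\<^sub>m rz_C Rw) *\<^sub>v xw + (?c \<cdot>\<^sub>m rz_D Rw) *\<^sub>v s)"
  let ?B1 = "(pl_B1 P + ?S * rz_D Ry * pl_D21 P) *\<^sub>v dd + (F \<cdot>\<^sub>m (pl_B2 P * ?JT)) *\<^sub>v qb"
  let ?B2 = "(rz_B Ry * pl_D21 P) *\<^sub>v dd + 0\<^sub>m ny (k + 1) *\<^sub>v qb"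
  let ?B3 = "0\<^sub>m nw m *\<^sub>v dd + 0\<^sub>m nw (k + 1) *\<^sub>v qb"
  let ?B4 = "(?c \<cdot>\<^sub>m (rz_D Ry * pl_D21 P)) *\<^sub>v dd + ?JT *\<^sub>v qb"
  have car: "?S * rz_D Ry * pl_C2 P \<in> carrier_mat n n" "?S * rz_C Ry \<in> carrier_mat n ny"
    "?S * rz_C Rw \<in> carrier_mat n nw" "?S * rz_D Rw \<in> carrier_mat n 1"
    "rz_B Ry * pl_C2 P \<in> carrier_mat ny n" "rz_D Ry * pl_C2 P \<in> carrier_mat 1 n"
    "?S * rz_D Ry * pl_D21 P \<in> carrier_mat n m" "F \<cdot>\<^sub>m (pl_B2 P * ?JT) \<in> carrier_mat n (k + 1)"
    "rz_B Ry * pl_D21 P \<in> carrier_mat ny m" "rz_D Ry * pl_D21 P \<in> carrier_mat 1 m"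
    using carriers S JT by (auto intro!: mult_carrier_mat)
  define j where "j = ?JT *\<^sub>v qb"
  have in1: "pl_C2 P *\<^sub>v x \<in> carrier_vec 1" "pl_D21 P *\<^sub>v dd \<in> carrier_vec 1" "j \<in> carrier_vec 1"
    "rz_D Ry *\<^sub>v (pl_C2 P *\<^sub>v x) \<in> carrier_vec 1" "rz_D Ry *\<^sub>v (pl_D21 P *\<^sub>v dd) \<in> carrier_vec 1"
    "rz_C Ry *\<^sub>v xy \<in> carrier_vec 1" "rz_C Rw *\<^sub>v xw \<in> carrier_vec 1" "rz_D Rw *\<^sub>v s \<in> carrier_vec 1"
    unfolding j_def using carriers JT x dd qb xy xw s by (auto intro!: mult_mat_vec_carrier)
  have Dy_y: "rz_D Ry *\<^sub>v y = rz_D Ry *\<^sub>v (pl_C2 P *\<^sub>v x) + rz_D Ry *\<^sub>v (pl_D21 P *\<^sub>v dd)"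
    unfolding y by (rule mult_add_distrib_mat_vec[OF Ry(4) in1(1,2)])
  have By_y: "rz_B Ry *\<^sub>v y = (rz_B Ry * pl_C2 P) *\<^sub>v x + (rz_B Ry * pl_D21 P) *\<^sub>v dd"
    unfolding y mult_add_distrib_mat_vec[OF Ry(2) in1(1,2)]
      assoc_mult_mat_vec[OF Ry(2) plant_carrier(4) x] assoc_mult_mat_vec[OF Ry(2) plant_carrier(5) dd] ..
  \<comment> \<open>\<open>w\<close> has dimension 1, so its single entry determines it and the
    remaining comparison is scalar algebra.\<close>
  have w0: "w $ 0 = ?c * ((rz_C Ry *\<^sub>v xy) $ 0 + (rz_D Ry *\<^sub>v y) $ 0 +
      ((rz_C Rw *\<^sub>v xw) $ 0 + (rz_D Rw *\<^sub>v s) $ 0)) + j $ 0"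
    unfolding w j_def[symmetric] using carrier_vecD[OF in1(3)] by (simp add: dims carrier_matD[OF JT] del: index_mult_mat_vec)
  have "A_jump n ny nw P F Ry Rw \<xi> *\<^sub>v ((x @\<^sub>v xy) @\<^sub>v (xw @\<^sub>v s)) =
      ((?A1 @\<^sub>v ?A2)) @\<^sub>v (?A3 @\<^sub>v ?A4)"
    unfolding A_jump_def Let_def
    by (rule four_block_nested_mult_vec[where ?n1.0 = n and ?n2.0 = ny and ?n3.0 = nw and ?n4.0 = 1
          and ?m1.0 = n and ?m2.0 = ny and ?m3.0 = nw and ?m4.0 = 1])
      (use carriers S car x xy xw s in \<open>simp_all only: add_carrier_mat smult_carrier_mat zero_carrier_mat\<close>)
  moreover have "B_jump m ny nw k P F Ry \<xi> *\<^sub>v (dd @\<^sub>v qb) = (?B1 @\<^sub>v ?B2) @\<^sub>v (?B3 @\<^sub>v ?B4)"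
  proof -
    have "four_block_mat (pl_B1 P + ?S * rz_D Ry * pl_D21 P) (F \<cdot>\<^sub>m (pl_B2 P * ?JT))
        (rz_B Ry * pl_D21 P) (0\<^sub>m ny (k + 1)) *\<^sub>v (dd @\<^sub>v qb) = ?B1 @\<^sub>v ?B2"
      by (rule four_block_mat_mult_vec[of _ n m _ "k + 1" _ ny])
        (use carriers car dd qb in \<open>simp_all only: add_carrier_mat smult_carrier_mat zero_carrier_mat\<close>)
    moreover have "four_block_mat (0\<^sub>m nw m) (0\<^sub>m nw (k + 1)) (?c \<cdot>\<^sub>m (rz_D Ry * pl_D21 P)) ?JT *\<^sub>v (dd @\<^sub>v qb) =
        ?B3 @\<^sub>v ?B4"
      by (rule four_block_mat_mult_vec[of _ nw m _ "k + 1" _ 1])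
        (use carriers car JT dd qb in \<open>simp_all only: add_carrier_mat smult_carrier_mat zero_carrier_mat\<close>)
    moreover have "four_block_mat (pl_B1 P + ?S * rz_D Ry * pl_D21 P) (F \<cdot>\<^sub>m (pl_B2 P * ?JT))
        (rz_B Ry * pl_D21 P) (0\<^sub>m ny (k + 1)) \<in> carrier_mat (n + ny) (m + (k + 1))"
      "four_block_mat (0\<^sub>m nw m) (0\<^sub>m nw (k + 1)) (?c \<cdot>\<^sub>m (rz_D Ry * pl_D21 P)) ?JT \<in>
        carrier_mat (nw + 1) (m + (k + 1))"
      using carriers car JT by (intro four_block_carrier_mat; simp)+
    ultimately show ?thesis
      unfolding B_jump_def Let_def using dd qb
      by (simp only: mat_mult_append[of _ "n + ny" "m + (k + 1)" _ "nw + 1"] append_carrier_vec)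
  qed
  moreover have "?A1 + ?B1 = pl_A P *\<^sub>v x + pl_B1 P *\<^sub>v dd + F \<cdot>\<^sub>v (pl_B2 P *\<^sub>v w)"
  proof (rule eq_vecI)
    fix i assume "i < dim_vec (pl_A P *\<^sub>v x + pl_B1 P *\<^sub>v dd + F \<cdot>\<^sub>v (pl_B2 P *\<^sub>v w))"
    then have i: "i < n" by (simp add: dims)
    \<comment> \<open>A one-column matrix acts on a vector of dimension 1 as a scalar multiple of
      its column. Every contribution through \<open>Sigma_mat\<close>, and the noise, thus becomes a
      multiple of the same entry of \<open>pl_B2 P\<close>, and these add up to \<open>F\<close>
      times that entry times \<open>w $ 0\<close>.\<close>
    have col: "(pl_B2 P *\<^sub>v u) $ i = pl_B2 P $$ (i, 0) * u $ 0" if "u \<in> carrier_vec 1" for u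
      by (rule single_col_mult_vec[OF plant_carrier(3) that i])
    have gain: "(?S *\<^sub>v u) $ i = F * ?c * (pl_B2 P $$ (i, 0) * u $ 0)" if "u \<in> carrier_vec 1" for u
      unfolding Sigma_mat_def smult_mat_mult_vec[OF plant_carrier(3) that] using i
      by (simp add: dims col[OF that] del: index_mult_mat_vec)
    have "(F \<cdot>\<^sub>m (pl_B2 P * ?JT)) *\<^sub>v qb = F \<cdot>\<^sub>v (pl_B2 P *\<^sub>v j)"
      unfolding j_def smult_mat_mult_vec[OF mult_carrier_mat[OF plant_carrier(3) JT] qb]
        assoc_mult_mat_vec[OF plant_carrier(3) JT qb] ..
    then show "(?A1 + ?B1) $ i = (pl_A P *\<^sub>v x + pl_B1 P *\<^sub>v dd + F \<cdot>\<^sub>v (pl_B2 P *\<^sub>v w)) $ i"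
      using i
      by (simp add: dims carrier_matD[OF S] col[OF w_car] w0 Dy_y
          add_mult_distrib_mat_vec[OF plant_carrier(1) car(1) x]
          add_mult_distrib_mat_vec[OF plant_carrier(2) car(7) dd]
          assoc_mult_mat_vec[OF mult_carrier_mat[OF S Ry(4)] plant_carrier(4) x]
          assoc_mult_mat_vec[OF mult_carrier_mat[OF S Ry(4)] plant_carrier(5) dd]
          assoc_mult_mat_vec[OF S Ry(4) in1(1)] assoc_mult_mat_vec[OF S Ry(4) in1(2)] assoc_mult_mat_vec[OF S Ry(3) xy]
          assoc_mult_mat_vec[OF S Rw(3) xw] assoc_mult_mat_vec[OF S Rw(4) s]
          gain[OF in1(4)] gain[OF in1(5)] gain[OF in1(6)] gain[OF in1(7)] gain[OF in1(8)] col[OF in1(3)]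
          del: index_mult_mat_vec)
        (simp add: algebra_simps)
  qed (simp add: dims carrier_matD[OF S])
  moreover have "?A2 + ?B2 = rz_A Ry *\<^sub>v xy + rz_B Ry *\<^sub>v y"
    unfolding By_y zero_mat_mult_vec[OF xw] zero_mat_mult_vec[OF s] zero_mat_mult_vec[OF qb]
    by (rule eq_vecI) (simp_all add: dims del: index_mult_mat_vec)
  moreover have "?A3 + ?B3 = rz_A Rw *\<^sub>v xw + rz_B Rw *\<^sub>v s"
    unfolding zero_mat_mult_vec[OF x] zero_mat_mult_vec[OF xy] zero_mat_mult_vec[OF dd] zero_mat_mult_vec[OF qb]
    by (rule eq_vecI) (simp_all add: dims del: index_mult_mat_vec)
  moreover have "?A4 + ?B4 = w"
  proof (rule eq_vecI)
    fix i assume "i < dim_vec w"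
    then have "i = 0" using carrier_vecD[OF w_car] by simp
    then show "(?A4 + ?B4) $ i = w $ i"
      unfolding j_def[symmetric] using carrier_vecD[OF in1(3)]
      by (simp add: dims carrier_matD[OF JT] w0 Dy_y smult_mat_mult_vec[OF car(6) x]
          smult_mat_mult_vec[OF Ry(3) xy] smult_mat_mult_vec[OF Rw(3) xw] smult_mat_mult_vec[OF Rw(4) s]
          smult_mat_mult_vec[OF car(10) dd] assoc_mult_mat_vec[OF Ry(4) plant_carrier(4) x]
          assoc_mult_mat_vec[OF Ry(4) plant_carrier(5) dd] del: index_mult_mat_vec)
        (simp add: algebra_simps)
  qed (use carrier_vecD[OF w_car] in \<open>simp add: dims carrier_matD[OF JT]\<close>)
  moreover have "((?A1 @\<^sub>v ?A2) @\<^sub>v (?A3 @\<^sub>v ?A4)) + ((?B1 @\<^sub>v ?B2) @\<^sub>v (?B3 @\<^sub>v ?B4)) =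
      ((?A1 + ?B1) @\<^sub>v (?A2 + ?B2)) @\<^sub>v ((?A3 + ?B3) @\<^sub>v (?A4 + ?B4))"
    by (rule append_vec_add4[where ?n1.0 = n and ?n2.0 = ny and ?n3.0 = nw and ?n4.0 = 1])
      (rule carrier_vecI, simp add: dims carrier_matD[OF S] carrier_matD[OF JT])+
  ultimately show ?thesis
    by (simp only: append_vec_assoc)
qed

end

section \<open>From the loop equations to the recursion of the augmented state\<close>

lemma sum_lessThan_add:
  "(\<Sum>i<m + n. f i) = (\<Sum>i<m. f i) + (\<Sum>i<n. f (m + i))" for f :: "nat \<Rightarrow> 'a :: comm_monoid_add"
  by (induction n) (simp_all add: add.assoc)

text \<open>The last summand of a vector sum fixes its dimension. Here it is the product with an
  input matrix, so after time 0 the row counts of the input matrices determine the dimensions of the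
  states.\<close>

lemma loop_state_carrier:
  assumes P: "plant_dims n m P"
    and Ry: "rz_B Ry \<in> carrier_mat ny 1" and Rw: "rz_B Rw \<in> carrier_mat nw 1"
    and loop: "loop_equations M n ny nw P F Ry Rw d sg" and \<omega>: "\<omega> \<in> space M"
  shows "sg_x sg i \<omega> \<in> carrier_vec n" "sg_xyv sg i \<omega> \<in> carrier_vec ny" "sg_xwv sg i \<omega> \<in> carrier_vec nw"
    "aug_state sg i \<omega> \<in> carrier_vec (n + ny + nw + 1)"
proof -
  have "sg_x sg i \<omega> \<in> carrier_vec n \<and> sg_xyv sg i \<omega> \<in> carrier_vec ny \<and> sg_xwv sg i \<omega> \<in> carrier_vec nw"
  proof (cases i)
    case 0
    then show ?thesis using loop \<omega> unfolding loop_equations_def by blast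
  next
    case (Suc j)
    have "pl_B2 P \<in> carrier_mat n 1" using P by (simp add: plant_dims_def)
    moreover have "sg_x sg (Suc j) \<omega> =
        pl_A P *\<^sub>v sg_x sg j \<omega> + pl_B1 P *\<^sub>v d j \<omega> + pl_B2 P *\<^sub>v scal (sg_u sg j \<omega>)"
      "sg_xyv sg (Suc j) \<omega> = rz_A Ry *\<^sub>v sg_xyv sg j \<omega> + rz_B Ry *\<^sub>v scal (sg_y sg j \<omega>)"
      "sg_xwv sg (Suc j) \<omega> = rz_A Rw *\<^sub>v sg_xwv sg j \<omega> + rz_B Rw *\<^sub>v scal (w_delayed sg j \<omega>)"
      using loop \<omega> unfolding loop_equations_def by blast+
    ultimately show ?thesis
      using Suc carrier_matD(1)[OF Ry] carrier_matD(1)[OF Rw] by (auto intro: carrier_vecI)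
  qed
  then show "sg_x sg i \<omega> \<in> carrier_vec n" "sg_xyv sg i \<omega> \<in> carrier_vec ny" "sg_xwv sg i \<omega> \<in> carrier_vec nw"
    by auto
  then have "aug_state sg i \<omega> \<in> carrier_vec (n + (ny + (nw + 1)))"
    unfolding aug_state_def by (intro append_carrier_vec scal_carrier)
  then show "aug_state sg i \<omega> \<in> carrier_vec (n + ny + nw + 1)"
    by (simp add: add.assoc)
qed

lemma realizes_carrier:
  assumes "realizes r R h"
  shows "rz_A R \<in> carrier_mat r r" "rz_B R \<in> carrier_mat r 1" "rz_C R \<in> carrier_mat 1 r"
    "rz_D R \<in> carrier_mat 1 1"
  using assms by (auto simp: realizes_def)

lemma loop_aug_state_Suc:
  assumes P: "plant_dims n m P"
    and Ry: "realizes ny Ry Ly" and Rw: "realizes nw Rw Lw"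
    and loop: "loop_equations M n ny nw P F Ry Rw d sg" and out: "quantizer_output M k q \<xi> sg"
    and d: "d i \<omega> \<in> carrier_vec m" and \<omega>: "\<omega> \<in> space M"
  shows "aug_state sg (Suc i) \<omega> = A_jump n ny nw P F Ry Rw (\<xi> i \<omega>) *\<^sub>v aug_state sg i \<omega> +
    B_jump m ny nw k P F Ry (\<xi> i \<omega>) *\<^sub>v (d i \<omega> @\<^sub>v qbar k q i \<omega>)"
proof -
  note Ry' = realizes_carrier[OF Ry] and Rw' = realizes_carrier[OF Rw]
  have B2: "pl_B2 P \<in> carrier_mat n 1" using P by (simp add: plant_dims_def)
  note car = loop_state_carrier[OF P Ry'(2) Rw'(2) loop \<omega>, of i]
  have qb: "qbar k q i \<omega> \<in> carrier_vec (k + 1)" by (simp add: qbar_def)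
  have x: "sg_x sg (Suc i) \<omega> =
      pl_A P *\<^sub>v sg_x sg i \<omega> + pl_B1 P *\<^sub>v d i \<omega> + pl_B2 P *\<^sub>v scal (sg_u sg i \<omega>)"
    and y: "scal (sg_y sg i \<omega>) = pl_C2 P *\<^sub>v sg_x sg i \<omega> + pl_D21 P *\<^sub>v d i \<omega>"
    and u: "sg_u sg i \<omega> = F * sg_w sg i \<omega>"
    and xyv: "sg_xyv sg (Suc i) \<omega> = rz_A Ry *\<^sub>v sg_xyv sg i \<omega> + rz_B Ry *\<^sub>v scal (sg_y sg i \<omega>)"
    and vy: "scal (sg_vy sg i \<omega>) = rz_C Ry *\<^sub>v sg_xyv sg i \<omega> + rz_D Ry *\<^sub>v scal (sg_y sg i \<omega>)"
    and xwv: "sg_xwv sg (Suc i) \<omega> = rz_A Rw *\<^sub>v sg_xwv sg i \<omega> + rz_B Rw *\<^sub>v scal (w_delayed sg i \<omega>)"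
    and vw: "scal (sg_vw sg i \<omega>) = rz_C Rw *\<^sub>v sg_xwv sg i \<omega> + rz_D Rw *\<^sub>v scal (w_delayed sg i \<omega>)"
    and v: "sg_v sg i \<omega> = sg_vy sg i \<omega> + sg_vw sg i \<omega>"
    using loop \<omega> unfolding loop_equations_def by blast+
  have w: "sg_w sg i \<omega> = jumpM (\<xi> i \<omega>) * sg_v sg i \<omega> + scalar_prod (jumpJ k (\<xi> i \<omega>)) (qbar k q i \<omega>)"
    using out \<omega> unfolding quantizer_output_def by blast
  \<comment> \<open>The scalar quantizer law as an equation between vectors of dimension 1, the
    shape in which the block computation takes \<open>w\<close>.\<close>
  have "scal (sg_w sg i \<omega>) = jumpM (\<xi> i \<omega>) \<cdot>\<^sub>v (scal (sg_vy sg i \<omega>) + scal (sg_vw sg i \<omega>)) +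
      mat_of_row (jumpJ k (\<xi> i \<omega>)) *\<^sub>v qbar k q i \<omega>"
    by (rule eq_vecI) (auto simp: scal_def w v)
  from jump_matrices_mult_vec[OF P Ry' Rw' car(1-3) scal_carrier d qb y this[unfolded vy vw]]
  have "A_jump n ny nw P F Ry Rw (\<xi> i \<omega>) *\<^sub>v aug_state sg i \<omega> +
      B_jump m ny nw k P F Ry (\<xi> i \<omega>) *\<^sub>v (d i \<omega> @\<^sub>v qbar k q i \<omega>) =
    (pl_A P *\<^sub>v sg_x sg i \<omega> + pl_B1 P *\<^sub>v d i \<omega> + F \<cdot>\<^sub>v (pl_B2 P *\<^sub>v scal (sg_w sg i \<omega>))) @\<^sub>v
    sg_xyv sg (Suc i) \<omega> @\<^sub>v sg_xwv sg (Suc i) \<omega> @\<^sub>v scal (sg_w sg i \<omega>)"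
    unfolding aug_state_def xyv xwv .
  also have "F \<cdot>\<^sub>v (pl_B2 P *\<^sub>v scal (sg_w sg i \<omega>)) = pl_B2 P *\<^sub>v scal (sg_u sg i \<omega>)"
  proof -
    have "scal (sg_u sg i \<omega>) = F \<cdot>\<^sub>v scal (sg_w sg i \<omega>)"
      unfolding u by (rule eq_vecI) (auto simp: scal_def)
    then show ?thesis using mult_mat_vec[OF B2 scal_carrier] by simp
  qed
  \<comment> \<open>The last component of the next augmented state is
    \<open>w_delayed sg (Suc i)\<close>, which is \<open>w\<close> at time \<open>i\<close>.\<close>
  finally show ?thesis
    unfolding x[symmetric] by (simp add: aug_state_def w_delayed_def)
qed

section \<open>The sigma-algebra of initial state, disturbance and quantization noise\<close>

definition exo_path ::
  "nat \<Rightarrow> nat \<Rightarrow> nat \<Rightarrow> ('w \<Rightarrow> real vec) \<Rightarrow> (nat \<Rightarrow> 'w \<Rightarrow> real vec) \<Rightarrow> (nat \<Rightarrow> nat \<Rightarrow> 'w \<Rightarrow> real) \<Rightarrow> 'w \<Rightarrow>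
   (nat \<times> nat \<Rightarrow> real) \<times> (nat \<Rightarrow> real) \<times> (nat \<times> nat \<Rightarrow> real)" where
  "exo_path N m k z d q \<omega> =
     (path ({1..k} \<times> UNIV) (\<lambda>(l, i). q l i) \<omega>, init_path N z \<omega>, vec_path m d \<omega>)"

definition exo_space ::
  "nat \<Rightarrow> nat \<Rightarrow> nat \<Rightarrow> ((nat \<times> nat \<Rightarrow> real) \<times> (nat \<Rightarrow> real) \<times> (nat \<times> nat \<Rightarrow> real)) measure" where
  "exo_space N m k = path_space ({1..k} \<times> UNIV) \<Otimes>\<^sub>M (path_space {..<N} \<Otimes>\<^sub>M path_space (UNIV \<times> {..<m}))"

text \<open>The instance of \<open>W\<close>. It is generated by entire paths because an adapted
  variable may combine exogenous signals at any times, and the jumps must be independent of all of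
  them jointly.\<close>

definition exo_algebra ::
  "'w measure \<Rightarrow> nat \<Rightarrow> nat \<Rightarrow> nat \<Rightarrow> ('w \<Rightarrow> real vec) \<Rightarrow> (nat \<Rightarrow> 'w \<Rightarrow> real vec) \<Rightarrow> (nat \<Rightarrow> nat \<Rightarrow> 'w \<Rightarrow> real) \<Rightarrow>
   'w measure" where
  "exo_algebra M N m k z d q = vimage_algebra (space M) (exo_path N m k z d q) (exo_space N m k)"

context prob_space
begin

context
  fixes N m k :: nat and pl :: real and z :: "'a \<Rightarrow> real vec" and d :: "nat \<Rightarrow> 'a \<Rightarrow> real vec"
    and q :: "nat \<Rightarrow> nat \<Rightarrow> 'a \<Rightarrow> real" and rcv :: "nat \<Rightarrow> nat \<Rightarrow> 'a \<Rightarrow> bool"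
  assumes exo: "exogenous_indep M N m k z d q rcv"
begin

lemma noise_indep:
  "indep_elements M (path_space ({1..k} \<times> UNIV)) (path ({1..k} \<times> UNIV) (\<lambda>(l, i). q l i))
     (path_space {..<N} \<Otimes>\<^sub>M path_space (UNIV \<times> {..<m})) (\<lambda>\<omega>. (init_path N z \<omega>, vec_path m d \<omega>))"
  using exo unfolding exogenous_indep_def Let_def by blast

lemma losses_indep:
  "indep_elements M (PiM (UNIV \<times> {..<k}) (\<lambda>_. count_space UNIV)) (path (UNIV \<times> {..<k}) (\<lambda>(i, l). rcv i l))
     (exo_space N m k) (exo_path N m k z d q)"
  using exo unfolding exogenous_indep_def Let_def exo_space_def exo_path_def[abs_def] by blast

lemma exo_path_measurable: "exo_path N m k z d q \<in> M \<rightarrow>\<^sub>M exo_space N m k"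
  using losses_indep unfolding indep_elements_def by blast

lemma exo_path_measurable': "exo_path N m k z d q \<in> exo_algebra M N m k z d q \<rightarrow>\<^sub>M exo_space N m k"
  unfolding exo_algebra_def using measurable_space[OF exo_path_measurable]
  by (intro measurable_vimage_algebra1) auto

lemma sets_exo_algebra:
  "sets (exo_algebra M N m k z d q) = {exo_path N m k z d q -` A \<inter> space M | A. A \<in> sets (exo_space N m k)}"
  unfolding exo_algebra_def using measurable_space[OF exo_path_measurable]
  by (intro sets_vimage_algebra2) auto

lemma subalgebra_exo: "subalgebra M (exo_algebra M N m k z d q)"
  unfolding subalgebra_def sets_exo_algebra using exo_path_measurable
  by (auto simp: exo_algebra_def)

lemma exo_init_measurable:
  assumes "a < N"
  shows "(\<lambda>\<omega>. z \<omega> $ a) \<in> borel_measurable (exo_algebra M N m k z d q)"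
proof -
  have "(\<lambda>e. fst (snd e) a) \<in> borel_measurable (exo_space N m k)"
    unfolding exo_space_def using assms
    by (intro measurable_compose[OF measurable_compose[OF measurable_snd measurable_fst]] path_space_component) auto
  from measurable_compose[OF exo_path_measurable' this] show ?thesis
    using assms by (simp add: exo_path_def init_path_def path_def)
qed

lemma exo_dist_measurable:
  assumes "c < m"
  shows "(\<lambda>\<omega>. d i \<omega> $ c) \<in> borel_measurable (exo_algebra M N m k z d q)"
proof -
  have "(\<lambda>e. snd (snd e) (i, c)) \<in> borel_measurable (exo_space N m k)"
    unfolding exo_space_def using assms
    by (intro measurable_compose[OF measurable_compose[OF measurable_snd measurable_snd]] path_space_component) auto
  from measurable_compose[OF exo_path_measurable' this] show ?thesis
    using assms by (simp add: exo_path_def vec_path_def path_def)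
qed

lemma exo_noise_measurable:
  assumes "l \<in> {1..k}"
  shows "q l i \<in> borel_measurable (exo_algebra M N m k z d q)"
proof -
  have "(\<lambda>e. fst e (l, i)) \<in> borel_measurable (exo_space N m k)"
    unfolding exo_space_def using assms
    by (intro measurable_compose[OF measurable_fst] path_space_component) auto
  from measurable_compose[OF exo_path_measurable' this] show ?thesis
    using assms by (simp add: exo_path_def path_def)
qed

text \<open>Independence factorizes the expectation, and the noise factor has mean zero. Initial
  state and disturbance are both coordinates of the one element that the noise is independent
  of.\<close>

lemma noise_uncorrelated:
  assumes l: "l \<in> {1..k}" and q: "sq_int M (q l i)" "expectation (q l i) = 0"
  shows "a < N \<Longrightarrow> sq_int M (\<lambda>\<omega>. z \<omega> $ a) \<Longrightarrow> expectation (\<lambda>\<omega>. q l i \<omega> * z \<omega> $ a) = 0"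
    and "c < m \<Longrightarrow> sq_int M (\<lambda>\<omega>. d i' \<omega> $ c) \<Longrightarrow> expectation (\<lambda>\<omega>. q l i \<omega> * d i' \<omega> $ c) = 0"
proof -
  let ?S = "path_space {..<N} \<Otimes>\<^sub>M path_space (UNIV \<times> {..<m})"
  have f: "(\<lambda>f. f (l, i)) \<in> borel_measurable (path_space ({1..k} \<times> UNIV))"
    using l by (intro path_space_component) auto
  have zero: "expectation (\<lambda>\<omega>. q l i \<omega> * g (init_path N z \<omega>, vec_path m d \<omega>)) = 0"
    if g: "g \<in> borel_measurable ?S" and int: "integrable M (\<lambda>\<omega>. g (init_path N z \<omega>, vec_path m d \<omega>))" for g
  proof -
    have *: "path ({1..k} \<times> UNIV) (\<lambda>(l, i). q l i) \<omega> (l, i) = q l i \<omega>" for \<omega>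
      using l by (simp add: path_def)
    show ?thesis
      using indep_elements_expectation_mult[OF noise_indep f g _ int] sq_int_integrable[OF q(1)] q(2)
      unfolding * by simp
  qed
  show "expectation (\<lambda>\<omega>. q l i \<omega> * z \<omega> $ a) = 0" if a: "a < N" and int: "sq_int M (\<lambda>\<omega>. z \<omega> $ a)"
  proof -
    have "(\<lambda>e. fst e a) \<in> borel_measurable ?S"
      using a by (intro measurable_compose[OF measurable_fst] path_space_component) auto
    from zero[OF this] show ?thesis
      using a sq_int_integrable[OF int] by (simp add: init_path_def path_def)
  qed
  show "expectation (\<lambda>\<omega>. q l i \<omega> * d i' \<omega> $ c) = 0" if c: "c < m" and int: "sq_int M (\<lambda>\<omega>. d i' \<omega> $ c)"
  proof -
    have "(\<lambda>e. snd e (i', c)) \<in> borel_measurable ?S"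
      using c by (intro measurable_compose[OF measurable_snd] path_space_component) auto
    from zero[OF this] show ?thesis
      using c sq_int_integrable[OF int] by (simp add: vec_path_def path_def)
  qed
qed

text \<open>This is \<open>jump_law\<close> for the erasure channel. An event about the counts is
  the preimage of a measurable set of loss patterns, so independence of the loss path from the
  exogenous path splits the probability.\<close>

lemma prob_losses_exo:
  assumes loss: "iid_losses M k pl rcv" and k: "k \<ge> 1" and E: "E \<in> sets (exo_algebra M N m k z d q)"
  shows "prob ({\<omega>\<in>space M. \<forall>t<i. num_received k rcv t \<omega> = h t} \<inter> E) =
    (\<Prod>t<i. prob_received k pl (h t)) * prob E"
proof -
  let ?T = "PiM (UNIV \<times> {..<k}) (\<lambda>_. count_space UNIV)" and ?r = "path (UNIV \<times> {..<k}) (\<lambda>(i, l). rcv i l)"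
  obtain B where B: "B \<in> sets (exo_space N m k)" "E = exo_path N m k z d q -` B \<inter> space M"
    using E unfolding sets_exo_algebra by auto
  have r: "?r \<in> M \<rightarrow>\<^sub>M ?T"
    using losses_indep unfolding indep_elements_def by blast
  have card: "(\<lambda>f. card {l. l < k \<and> f (t, l)}) \<in> ?T \<rightarrow>\<^sub>M count_space UNIV" for t
    by (rule num_received_path_measurable) simp
  have A: "{f\<in>space ?T. \<forall>t<i. card {l. l < k \<and> f (t, l)} = h t} \<in> sets ?T" (is "?A \<in> _")
    using card by measurable
  have num: "card {l. l < k \<and> ?r \<omega> (t, l)} = num_received k rcv t \<omega>" for t \<omega>
    unfolding num_received_def by (intro arg_cong[where f = card]) (auto simp: path_def)
  have path_eq: "?r -` ?A \<inter> space M = {\<omega>\<in>space M. \<forall>t<i. num_received k rcv t \<omega> = h t}"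
    using measurable_space[OF r] by (auto simp: num)
  have "prob ((?r -` ?A \<inter> space M) \<inter> E) = prob (?r -` ?A \<inter> space M) * prob E"
    using losses_indep A B unfolding indep_elements_def by (intro indep_setD[where A = "{?r -` A \<inter> space M | A. A \<in> sets ?T}"
          and B = "{exo_path N m k z d q -` B \<inter> space M | B. B \<in> sets (exo_space N m k)}"]) blast+
  then show ?thesis
    unfolding path_eq prob_num_received_path[OF loss k] .
qed

end

end

text \<open>The componentwise form demanded by \<open>state_step\<close>. Since \<open>jumpJ\<close>
  is a unit vector, the sum over the noise entries collapses to the one chosen by the jump; the
  conditional reflects that entry 0 of \<open>qbar\<close> is zero.\<close>

lemma erasure_loop_components:
  assumes P: "plant_dims n m P"
    and Ry: "realizes ny Ry Ly" and Rw: "realizes nw Rw Lw"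
    and loop: "loop_equations M n ny nw P F Ry Rw d sg" and out: "quantizer_output M k q \<xi> sg"
    and d: "d i \<omega> \<in> carrier_vec m" and \<omega>: "\<omega> \<in> space M" and \<xi>: "\<xi> i \<omega> \<le> k"
    and a: "a < n + ny + nw + 1"
  shows "aug_state sg (Suc i) \<omega> $ a =
    (\<Sum>b<n + ny + nw + 1. A_jump n ny nw P F Ry Rw (\<xi> i \<omega>) $$ (a, b) * aug_state sg i \<omega> $ b) +
    (\<Sum>c<m. B_jump m ny nw k P F Ry (\<xi> i \<omega>) $$ (a, c) * d i \<omega> $ c) +
    noise_gain n ny nw P F a * (if \<xi> i \<omega> = 0 then 0 else q (\<xi> i \<omega>) i \<omega>)"
proof -
  let ?A = "A_jump n ny nw P F Ry Rw (\<xi> i \<omega>)" and ?B = "B_jump m ny nw k P F Ry (\<xi> i \<omega>)"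
  let ?N = "n + ny + nw + 1"
  note Ry' = realizes_carrier[OF Ry] and Rw' = realizes_carrier[OF Rw]
  have A: "?A \<in> carrier_mat ?N ?N" and B: "?B \<in> carrier_mat ?N (m + (k + 1))"
    by (rule A_jump_carrier[OF P Ry' Rw'], rule B_jump_carrier[OF P Ry' Rw'])
  have x: "aug_state sg i \<omega> \<in> carrier_vec ?N"
    by (rule loop_state_carrier(4)[OF P Ry'(2) Rw'(2) loop \<omega>])
  have qb: "qbar k q i \<omega> \<in> carrier_vec (k + 1)" by (simp add: qbar_def)
  have dq: "d i \<omega> @\<^sub>v qbar k q i \<omega> \<in> carrier_vec (m + (k + 1))"
    using d qb by (rule append_carrier_vec)
  have mult: "(X *\<^sub>v v) $ a = (\<Sum>b<c. X $$ (a, b) * v $ b)"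
    if "X \<in> carrier_mat ?N c" "v \<in> carrier_vec c" for X :: "real mat" and v c
    using carrier_matD[OF that(1)] carrier_vecD[OF that(2)] a by (simp add: scalar_prod_def lessThan_atLeast0)
  have "aug_state sg (Suc i) \<omega> $ a = (?A *\<^sub>v aug_state sg i \<omega>) $ a + (?B *\<^sub>v (d i \<omega> @\<^sub>v qbar k q i \<omega>)) $ a"
    unfolding loop_aug_state_Suc[OF P Ry Rw loop out d \<omega>]
    by (rule index_add_vec(1)) (simp only: dim_mult_mat_vec carrier_matD(1)[OF B] a)
  also have "(?B *\<^sub>v (d i \<omega> @\<^sub>v qbar k q i \<omega>)) $ a =
      (\<Sum>c<m + (k + 1). ?B $$ (a, c) * (d i \<omega> @\<^sub>v qbar k q i \<omega>) $ c)"
    by (rule mult[OF B dq])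
  also have "\<dots> = (\<Sum>c<m. ?B $$ (a, c) * d i \<omega> $ c) + (\<Sum>l<k + 1. ?B $$ (a, m + l) * qbar k q i \<omega> $ l)"
    unfolding sum_lessThan_add using carrier_vecD[OF d] carrier_vecD[OF qb]
    by (intro arg_cong2[where f = "(+)"] sum.cong refl) auto
  also have "(\<Sum>l<k + 1. ?B $$ (a, m + l) * qbar k q i \<omega> $ l) =
      (\<Sum>l<k + 1. if l = \<xi> i \<omega> then noise_gain n ny nw P F a * (if l = 0 then 0 else q l i \<omega>) else 0)"
    using B_jump_noise_entry[OF P Ry' Rw' a, of _ k] by (intro sum.cong refl) (simp add: qbar_def)
  also have "\<dots> = noise_gain n ny nw P F a * (if \<xi> i \<omega> = 0 then 0 else q (\<xi> i \<omega>) i \<omega>)"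
    using \<xi> by simp
  finally show ?thesis
    unfolding mult[OF A x] by (simp only: add.assoc)
qed

text \<open>The model prescribes noises for \<open>1\<close> to \<open>k\<close> received
  descriptions. Extending them by the zero noise of variance 0 lets the jump value 0, total loss, be
  handled like the others.\<close>

lemma jump_loop_erasure:
  fixes M :: "'w measure" and d :: "nat \<Rightarrow> 'w \<Rightarrow> real vec"
  assumes M: "prob_space M" and P: "plant_dims n m P"
    and Ry: "realizes ny Ry Ly" and Rw: "realizes nw Rw Lw"
    and d: "stationary_gaussian M m d" and k: "k \<ge> 1"
    and loss: "iid_losses M k pl rcv" and noise: "white_noises M k \<sigma>2 q"
    and sg: "sg \<in> erasure_loops M n m ny nw k P F Ry Rw d q rcv"
  shows "jump_loop M (exo_algebra M (n + ny + nw + 1) m k (aug_state sg 0) d q) k (n + ny + nw + 1) m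
    (prob_received k pl) (num_received k rcv)
    (\<lambda>j a b. A_jump n ny nw P F Ry Rw j $$ (a, b)) (\<lambda>j a c. B_jump m ny nw k P F Ry j $$ (a, c))
    (noise_gain n ny nw P F) (\<lambda>i c \<omega>. d i \<omega> $ c) (\<lambda>l i \<omega>. if l = 0 then 0 else q l i \<omega>)
    (\<lambda>s c c'. LINT \<omega>|M. d 0 \<omega> $ c * d s \<omega> $ c') (\<lambda>c. LINT \<omega>|M. d 0 \<omega> $ c)
    (\<lambda>l. if l = 0 then 0 else \<sigma>2 l) (\<lambda>i a \<omega>. aug_state sg i \<omega> $ a)"
proof -
  interpret prob_space M by (rule M)
  have loop: "loop_equations M n ny nw P F Ry Rw d sg"
    and out: "quantizer_output M k q (num_received k rcv) sg"
    and init: "initial_state M n (n + ny + nw + 1) (aug_state sg 0)"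
    and exo: "exogenous_indep M (n + ny + nw + 1) m k (aug_state sg 0) d q rcv"
    using sg unfolding erasure_loops_def by auto
  have init_sq: "sq_int M (\<lambda>\<omega>. aug_state sg 0 \<omega> $ a)" if "a < n + ny + nw + 1" for a
    using init that unfolding initial_state_def second_order_def sq_int_def by blast
  note dist_sq = stationary_gaussian_sq_int[OF d]
  have q_sq: "sq_int M (q l i)" and q_mean: "expectation (q l i) = 0"
    and q_var: "expectation (\<lambda>\<omega>. q l i \<omega> * q l i \<omega>) = \<sigma>2 l"
    if "l \<le> k" "l \<noteq> 0" for l i
  proof -
    have l: "l \<in> {1..k}" using that by auto
    show "sq_int M (q l i)"
      using noise l unfolding white_noises_def sq_int_def by blast
    show mean: "expectation (q l i) = 0"
      using noise l unfolding white_noises_def by blast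
    have "covariance M (q l i) (q l i) = \<sigma>2 l"
      using noise l unfolding white_noises_def by blast
    then show "expectation (\<lambda>\<omega>. q l i \<omega> * q l i \<omega>) = \<sigma>2 l"
      by (simp add: covariance_def mean)
  qed
  have q_white: "expectation (\<lambda>\<omega>. q l i \<omega> * q l' i' \<omega>) = 0"
    if "l \<le> k" "l \<noteq> 0" "l' \<le> k" "l' \<noteq> 0" "i \<noteq> i'" for l l' i i'
  proof -
    have "l \<in> {1..k}" "l' \<in> {1..k}" using that by auto
    then have "covariance M (q l i) (q l' i') = 0"
      using noise that(5) unfolding white_noises_def by blast
    then show ?thesis
      using that by (simp add: covariance_def q_mean)
  qed
  show ?thesis
  proof (unfold_locales, goal_cases)
    case 1
    show ?case by (rule subalgebra_exo[OF exo])
  next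
    case (2 i)
    show ?case by (rule num_received_measurable[OF loss])
  next
    case (3 i \<omega>)
    show ?case by (rule num_received_le)
  next
    case (4 i h E)
    then show ?case by (intro prob_losses_exo[OF exo loss k])
  next
    case (5 a)
    then show ?case by (rule exo_init_measurable[OF exo])
  next
    case (6 a)
    then show ?case by (rule init_sq)
  next
    case (7 i c)
    then show ?case by (rule exo_dist_measurable[OF exo])
  next
    case (8 i c)
    then show ?case by (rule dist_sq)
  next
    case (9 l i)
    then show ?case using exo_noise_measurable[OF exo, of l i] by (cases "l = 0") simp_all
  next
    case (10 l i)
    then show ?case using q_sq[of l i] by (cases "l = 0") (simp_all add: sq_int_zero)
  next
    case (11 l i)
    then show ?case using q_mean[of l i] by (cases "l = 0") simp_all
  next
    case (12 l l' i i')
    then show ?case using q_white[of l l' i i'] by (cases "l = 0"; cases "l' = 0") simp_all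
  next
    case (13 l i)
    then show ?case using q_var[of l i] by (cases "l = 0") simp_all
  next
    case (14 l i i' c)
    then show ?case
      using noise_uncorrelated(2)[OF exo _ q_sq q_mean, where l = l and i = i and c = c and i' = i'] dist_sq[of c i']
      by (cases "l = 0") simp_all
  next
    case (15 l i a)
    then show ?case
      using noise_uncorrelated(1)[OF exo _ q_sq q_mean, where l = l and i = i and a = a] init_sq[of a]
      by (cases "l = 0") simp_all
  next
    case (16 i c)
    then show ?case by (intro stationary_gaussian_shift(1)[OF d])
  next
    case (17 i s c c')
    then show ?case by (intro stationary_gaussian_shift(2)[OF d])
  next
    case (18 i a \<omega>)
    have "d i \<omega> \<in> carrier_vec m"
      using d 18 unfolding stationary_gaussian_def by blast
    from erasure_loop_components[OF P Ry Rw loop out this 18(1) num_received_le 18(2)]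
    show ?case .
  qed
qed

lemma mjls_erasure_loop:
  assumes M: "prob_space M" and P: "plant_dims n m P"
    and Ry: "realizes ny Ry Ly" and Rw: "realizes nw Rw Lw"
    and d: "stationary_gaussian M m d" and k: "k \<ge> 1" and loss: "iid_losses M k pl rcv"
    and sg: "sg \<in> erasure_loops M n m ny nw k P F Ry Rw d q rcv"
  shows "mjls M k (trans_prob k pl) (num_received k rcv) (A_jump n ny nw P F Ry Rw) (B_jump m ny nw k P F Ry)
    (\<lambda>i \<omega>. d i \<omega> @\<^sub>v qbar k q i \<omega>) (aug_state sg)"
proof -
  interpret prob_space M by (rule M)
  have loop: "loop_equations M n ny nw P F Ry Rw d sg"
    and out: "quantizer_output M k q (num_received k rcv) sg"
    using sg unfolding erasure_loops_def by auto
  have "d i \<omega> \<in> carrier_vec m" if "\<omega> \<in> space M" for i \<omega>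
    using d that unfolding stationary_gaussian_def by blast
  then show ?thesis
    unfolding mjls_def
    using markov_chain_num_received[OF loss k] loop_aug_state_Suc[OF P Ry Rw loop out] by auto
qed

theorem lemma7:
  fixes M :: "'w measure" and M' :: "'v measure"
    and n m ny nw k :: nat
    and P :: plant and F \<gamma> pl :: real
    and Ly Lw :: "nat \<Rightarrow> real" and Ry Rw :: realization
    and d :: "nat \<Rightarrow> 'w \<Rightarrow> real vec" and d' :: "nat \<Rightarrow> 'v \<Rightarrow> real vec"
    and q :: "nat \<Rightarrow> nat \<Rightarrow> 'w \<Rightarrow> real" and \<sigma>2 :: "nat \<Rightarrow> real"
    and rcv :: "nat \<Rightarrow> nat \<Rightarrow> 'w \<Rightarrow> bool"
  defines "N \<equiv> n + ny + nw + 1"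
    and "loops \<equiv> erasure_loops M n m ny nw k P F Ry Rw d q rcv"
    and "\<xi> \<equiv> num_received k rcv"
    and "\<A> \<equiv> A_jump n ny nw P F Ry Rw"
    and "\<B> \<equiv> B_jump m ny nw k P F Ry"
  assumes "prob_space M"
    and "plant_dims n m P"
    and "minimal_realization ny Ry Ly"
    and "minimal_realization nw Rw Lw"
    and "stationary_gaussian M m d"
    \<comment> \<open>\<open>\<gamma>\<close> is the SNR of a nominal loop, which may live on another probability space\<close>
    and "prob_space M'"
    and "stationary_gaussian M' m d'"
    and "distr M' (path_space (UNIV \<times> {..<m})) (vec_path m d') =
         distr M (path_space (UNIV \<times> {..<m})) (vec_path m d)"
    and "awgn_loop_snr M' n m ny nw P F Ry Rw d' \<gamma>"
    and "k \<ge> 1"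
    and "0 \<le> pl" and "pl \<le> 1"
    and "iid_losses M k pl rcv"
    and "white_noises M k \<sigma>2 q"
  shows "(\<forall>sg\<in>loops.
            mjls M k (trans_prob k pl) \<xi> \<A> \<B> (\<lambda>i \<omega>. d i \<omega> @\<^sub>v qbar k q i \<omega>) (aug_state sg)) \<and>
         (spectral_radius (map_mat complex_of_real (big_A k N (trans_prob k pl) \<A>)) < 1 \<longrightarrow>
            awss M N {aug_state sg | sg. sg \<in> loops})"
proof (intro conjI impI ballI)
  fix sg assume "sg \<in> loops"
  then show "mjls M k (trans_prob k pl) \<xi> \<A> \<B> (\<lambda>i \<omega>. d i \<omega> @\<^sub>v qbar k q i \<omega>) (aug_state sg)"
    using assms(8,9) mjls_erasure_loop[OF assms(6,7) _ _ assms(10,15,18)]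
    unfolding loops_def \<xi>_def \<A>_def \<B>_def minimal_realization_def by blast
next
  assume sr: "spectral_radius (map_mat complex_of_real (big_A k N (trans_prob k pl) \<A>)) < 1"
  have Ry: "realizes ny Ry Ly" and Rw: "realizes nw Rw Lw"
    using assms(8,9) by (simp_all add: minimal_realization_def)
  note Ry' = realizes_carrier[OF Ry] and Rw' = realizes_carrier[OF Rw]
  let ?p = "prob_received k pl" and ?A = "\<lambda>j a b. \<A> j $$ (a, b)"
  \<comment> \<open>The transition probabilities ignore the previous state, which is the form of the
    big matrix that factors through the averaged Kronecker square.\<close>
  have "trans_prob k pl = (\<lambda>j _. ?p j)"
    by (simp add: fun_eq_iff trans_prob_def)
  then have decay: "geometric_decay ({..<N} \<times> {..<N}) (square_kernel k ?p ?A)"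
    using sr A_jump_carrier[OF assms(7) Ry' Rw'] sum_prob_received
    by (intro geometric_decay_square_kernel) (simp_all add: N_def \<A>_def)
  have jl: "jump_loop M (exo_algebra M N m k (aug_state sg 0) d q) k N m ?p \<xi>
    ?A (\<lambda>j a c. \<B> j $$ (a, c))
    (noise_gain n ny nw P F) (\<lambda>i c \<omega>. d i \<omega> $ c) (\<lambda>l i \<omega>. if l = 0 then 0 else q l i \<omega>)
    (\<lambda>s c c'. LINT \<omega>|M. d 0 \<omega> $ c * d s \<omega> $ c') (\<lambda>c. LINT \<omega>|M. d 0 \<omega> $ c)
    (\<lambda>l. if l = 0 then 0 else \<sigma>2 l) (\<lambda>i a \<omega>. aug_state sg i \<omega> $ a)" if "sg \<in> loops" for sg
    using jump_loop_erasure[OF assms(6,7) Ry Rw assms(10,15,18,19)] that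
    unfolding N_def \<xi>_def \<A>_def \<B>_def loops_def by blast
  note p = prob_received_nonneg[OF assms(16,17)]
  have "\<exists>\<mu>. \<forall>sg\<in>loops. (\<lambda>i. LINT \<omega>|M. aug_state sg i \<omega> $ a) \<longlonglongrightarrow> \<mu>" if "a < N" for a
    using common_limit_mean[OF jl p sum_prob_received decay that] unfolding common_limit_def .
  then obtain \<mu> where \<mu>: "\<And>a sg. a < N \<Longrightarrow> sg \<in> loops \<Longrightarrow> (\<lambda>i. LINT \<omega>|M. aug_state sg i \<omega> $ a) \<longlonglongrightarrow> \<mu> a"
    by metis
  \<comment> \<open>The limit is picked for each lag and pair of components before a trajectory is
    fixed, so it can serve as the one covariance function for all of them.\<close>
  define c where "c \<tau> a b = (SOME c. \<forall>sg\<in>loops. (\<lambda>i. covariance M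
      (\<lambda>\<omega>. aug_state sg (nat (int i + \<tau>)) \<omega> $ a) (\<lambda>\<omega>. aug_state sg i \<omega> $ b)) \<longlonglongrightarrow> c)" for \<tau> a b
  have c: "(\<lambda>i. covariance M (\<lambda>\<omega>. aug_state sg (nat (int i + \<tau>)) \<omega> $ a) (\<lambda>\<omega>. aug_state sg i \<omega> $ b))
      \<longlonglongrightarrow> c \<tau> a b" if "a < N" "b < N" "sg \<in> loops" for \<tau> a b sg
    using common_limit_covariance[OF jl p sum_prob_received decay that(1,2), where \<tau> = \<tau>]
    unfolding common_limit_def c_def by (rule bspec[OF someI_ex that(3)])
  have second: "second_order M N (aug_state sg i)" if sg: "sg \<in> loops" for sg i
  proof -
    have "loop_equations M n ny nw P F Ry Rw d sg"
      using sg unfolding loops_def erasure_loops_def by auto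
    then have "aug_state sg i \<omega> \<in> carrier_vec N" if "\<omega> \<in> space M" for \<omega>
      unfolding N_def by (rule loop_state_carrier(4)[OF assms(7) Ry'(2) Rw'(2) _ that])
    moreover have "sq_int M (\<lambda>\<omega>. aug_state sg i \<omega> $ a)" if "a < N" for a
      by (rule jump_loop.state_sq_int[OF jl[OF sg] that])
    ultimately show ?thesis
      unfolding second_order_def sq_int_def by blast
  qed
  show "awss M N {aug_state sg | sg. sg \<in> loops}"
    unfolding awss_def
  proof (intro exI[of _ "vec N \<mu>"] exI[of _ "\<lambda>\<tau>. mat N N (\<lambda>(a, b). c \<tau> a b)"] conjI allI ballI impI)
    fix X assume "X \<in> {aug_state sg | sg. sg \<in> loops}"
    then obtain sg where sg: "sg \<in> loops" and X: "X = aug_state sg" by auto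
    show "second_order M N (X i)" for i
      unfolding X by (rule second[OF sg])
    show "(\<lambda>i. LINT \<omega>|M. X i \<omega> $ a) \<longlonglongrightarrow> vec N \<mu> $ a" if "a < N" for a
      unfolding X using \<mu>[OF that sg] that by simp
    show "(\<lambda>i. covariance M (\<lambda>\<omega>. X (nat (int i + \<tau>)) \<omega> $ a) (\<lambda>\<omega>. X i \<omega> $ b)) \<longlonglongrightarrow>
        mat N N (\<lambda>(a, b). c \<tau> a b) $$ (a, b)" if "a < N" "b < N" for \<tau> a b
      unfolding X using c[OF that sg] that by simp
  qed simp_all
qed

end
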